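(* Let $i$ and $d$ be positive integers, and write $d=qi+r$ with $q,r$ the unique integers satisfying $1\le r\le i$. Let $S(i,d-1):=(\partial\sigma^i)^{*q}*\partial\sigma^r$. Let $\mathbf{k}$ be a field or $\mathbb{Z}$, and let $\Delta$ be a $(d-1)$-dimensional simplicial complex without missing faces of dimension larger than $i$. (1) If $\tilde H_{d-1}(\Delta;\mathbf{k})\neq 0$, then $f_j(\Delta)\ge f_j(S(i,d-1))$ for all $j$. If moreover $f_0(\Delta)=f_0(S(i,d-1))$ and, unless $d$ is divisible by $i$, also $f_r(\Delta)=f_r(S(i,d-1))$, then $\Delta=S(i,d-1)$ (i.e. $\Delta$ is isomorphic to $S(i,d-1)$ as a simplicial complex). (2) If $\Delta$ is 2-CM over $\mathbf{k}$, then $h_j(\Delta)\ge h_j(S(i,d-1))$ for all $j$. If moreover $h_1(\Delta)=h_1(S(i,d-1))$ and, unless $d$ is divisible by $i$, also $h_{r+1}(\Delta)=h_{r+1}(S(i,d-1))$, then $\Delta=S(i,d-1)$ (up to isomorphism of simplicial complexes).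
   Context: A simplicial complex $\Delta$ on the finite vertex set $[n]=\{1,\dots,n\}$ is a collection of subsets of $[n]$ (faces) closed under inclusion and containing all singletons $\{v\}$, $v\in[n]$. For a face or any vertex subset $F$, $\dim F=|F|-1$; $\dim\Delta$ is the maximal dimension of a face. A missing face of $\Delta$ is a set $F\subseteq[n]$ that is not a face of $\Delta$ but all of whose proper subsets are faces. If $\dim\Delta=d-1$, $f_j(\Delta)$ is the number of $j$-dimensional faces ($f_{-1}=1$), $f(\Delta,x)=\sum_{j=0}^{d}f_{j-1}x^j$, and the $h$-numbers $h_0,\dots,h_d$ are defined by $h(\Delta,x)=\sum_{j=0}^d h_jx^j=(1-x)^d f\left(\Delta,\frac{x}{1-x}\right)$. Numbers $f_j$ with $j>d-1$ and $h_j$ with $j>d$ are $0$. $\sigma^j$ is the $j$-dimensional simplex and $\partial\sigma^j$ its boundary complex (all proper subsets of a $(j+1)$-element set). The join of complexes on disjoint vertex sets is $\Delta_1*\Delta_2=\{F_1\cup F_2: F_1\in\Delta_1,F_2\in\Delta_2\}$, and $(\partial\sigma^i)^{*q}$ is the join of $q$ copies of $\partial\sigma^i$ on disjoint vertex sets (for $q=0$ it is omitted). $\tilde H_*(-;\mathbf{k})$ is reduced simplicial homology. The link of $F\in\Delta$ is $\mathrm{lk}\,F=\{G\in\Delta: F\cup G\in\Delta, F\cap G=\emptyset\}$. A $(d-1)$-dimensional complex $\Delta$ is Cohen–Macaulay (CM) over $\mathbf{k}$ if $\tilde H_m(\mathrm{lk}\,F;\mathbf{k})=0$ for all $F\in\Delta$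 (including $F=\emptyset$) and all $m<d-|F|-1$. For $W\subseteq[n]$, $\Delta_{-W}=\{F\in\Delta: F\subseteq[n]\setminus W\}$. $\Delta$ is $p$-CM over $\mathbf{k}$ if for all $W\subset[n]$ with $|W|\le p-1$, $\Delta_{-W}$ is CM over $\mathbf{k}$ and has the same dimension as $\Delta$; 2-CM is the case $p=2$. *)

theory Defs
  imports
    "HOL-Algebra.Elementary_Groups"
    "HOL-Computational_Algebra.Formal_Power_Series"
begin

definition simplicial_complex :: "nat \<Rightarrow> nat set set \<Rightarrow> bool" where
  "simplicial_complex n \<Delta> \<longleftrightarrow>
     \<Delta> \<subseteq> Pow {1..n} \<and> {} \<in> \<Delta> \<and>
     (\<forall>F\<in>\<Delta>. \<forall>G. G \<subseteq> F \<longrightarrow> G \<in> \<Delta>) \<and>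
     (\<forall>v\<in>{1..n}. {v} \<in> \<Delta>)"

definition face_dim :: "'v set \<Rightarrow> int" where
  "face_dim F = int (card F) - 1"

definition complex_dim :: "'v set set \<Rightarrow> int" where
  "complex_dim \<Delta> = Max (face_dim ` \<Delta>)"

definition missing_face :: "nat \<Rightarrow> nat set set \<Rightarrow> nat set \<Rightarrow> bool" where
  "missing_face n \<Delta> F \<longleftrightarrow> F \<subseteq> {1..n} \<and> F \<notin> \<Delta> \<and> (\<forall>G. G \<subset> F \<longrightarrow> G \<in> \<Delta>)"

definition link :: "'v set set \<Rightarrow> 'v set \<Rightarrow> 'v set set" where
  "link \<Delta> F = {G \<in> \<Delta>. F \<union> G \<in> \<Delta> \<and> F \<inter> G = {}}"

definition deletion :: "'v set set \<Rightarrow> 'v set \<Rightarrow> 'v set set" where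
  "deletion \<Delta> W = {F \<in> \<Delta>. F \<inter> W = {}}"

text \<open>The join is intended only for complexes on disjoint vertex sets.\<close>

definition join :: "'v set set \<Rightarrow> 'v set set \<Rightarrow> 'v set set" where
  "join \<Delta>1 \<Delta>2 = {F1 \<union> F2 | F1 F2. F1 \<in> \<Delta>1 \<and> F2 \<in> \<Delta>2}"

definition complex_iso :: "'v set set \<Rightarrow> 'w set set \<Rightarrow> bool" where
  "complex_iso \<Delta> \<Gamma> \<longleftrightarrow>
     (\<exists>\<phi>. bij_betw \<phi> (\<Union>\<Delta>) (\<Union>\<Gamma>) \<and> (\<forall>F. F \<subseteq> \<Union>\<Delta> \<longrightarrow> (F \<in> \<Delta> \<longleftrightarrow> \<phi> ` F \<in> \<Gamma>)))"


subsection \<open>Face numbers\<close>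

definition f_num :: "'v set set \<Rightarrow> int \<Rightarrow> nat" where
  "f_num \<Delta> j = card {F \<in> \<Delta>. face_dim F = j}"

definition f_eval :: "'v set set \<Rightarrow> 'a::comm_semiring_1 \<Rightarrow> 'a" where
  "f_eval \<Delta> x = (\<Sum>j=0..nat (complex_dim \<Delta> + 1). of_nat (f_num \<Delta> (int j - 1)) * x ^ j)"

text \<open>\<open>(1 - x)\<^sup>d f(\<Delta>, x / (1 - x))\<close>, read as a formal power series in \<open>x\<close>; the quotient
  \<open>x / (1 - x)\<close> is the geometric series \<open>x + x\<^sup>2 + \<dots>\<close>.  The result is a polynomial of degree
  at most \<open>d\<close>, so the coefficients beyond \<open>d\<close> vanish.\<close>

definition h_series :: "'v set set \<Rightarrow> rat fps" where
  "h_series \<Delta> = (1 - fps_X) ^ nat (complex_dim \<Delta> + 1) * f_eval \<Delta> (fps_X / (1 - fps_X))"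

definition h_num :: "'v set set \<Rightarrow> nat \<Rightarrow> rat" where
  "h_num \<Delta> j = fps_nth (h_series \<Delta>) j"


subsection \<open>Reduced simplicial homology\<close>

definition simplicial_chains :: "'v set set \<Rightarrow> int \<Rightarrow> ('v set \<Rightarrow> 'k::comm_ring_1) set" where
  "simplicial_chains \<Delta> m = {c. \<forall>F. c F \<noteq> 0 \<longrightarrow> F \<in> \<Delta> \<and> face_dim F = m}"

text \<open>A face is oriented by the order of its vertices.  In coordinates, the usual formula
  \<open>\<partial>[v\<^sub>0,\<dots>,v\<^sub>m] = (\<Sum>k. (-1)\<^sup>k [v\<^sub>0,\<dots>,v\<^sub>k\<^sub>-\<^sub>1,v\<^sub>k\<^sub>+\<^sub>1,\<dots>,v\<^sub>m])\<close> says that the coefficient of \<open>\<partial>c\<close> at \<open>G\<close>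
  collects the coefficients of \<open>c\<close> at the sets \<open>G \<union> {v}\<close>, where the position \<open>k\<close> of \<open>v\<close> is the
  number of elements of \<open>G\<close> below \<open>v\<close>.  For \<open>m = 0\<close> this is the augmentation onto the
  coefficient of the empty face.\<close>

definition simplicial_boundary ::
    "'v::linorder set set \<Rightarrow> ('v set \<Rightarrow> 'k::comm_ring_1) \<Rightarrow> 'v set \<Rightarrow> 'k" where
  "simplicial_boundary \<Delta> c G =
     (\<Sum>v\<in>\<Union>\<Delta> - G. (-1) ^ card {u \<in> G. u < v} * c (insert v G))"

definition simplicial_cycles ::
    "'v::linorder set set \<Rightarrow> int \<Rightarrow> ('v set \<Rightarrow> 'k::comm_ring_1) set" where
  "simplicial_cycles \<Delta> m = {c \<in> simplicial_chains \<Delta> m. simplicial_boundary \<Delta> c = (\<lambda>_. 0)}"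

definition simplicial_boundaries ::
    "'v::linorder set set \<Rightarrow> int \<Rightarrow> ('v set \<Rightarrow> 'k::comm_ring_1) set" where
  "simplicial_boundaries \<Delta> m = simplicial_boundary \<Delta> ` simplicial_chains \<Delta> (m + 1)"

definition cycle_group ::
    "'v::linorder set set \<Rightarrow> int \<Rightarrow> ('v set \<Rightarrow> 'k::comm_ring_1) monoid" where
  "cycle_group \<Delta> m =
     \<lparr>carrier = simplicial_cycles \<Delta> m, monoid.mult = (\<lambda>a b F. a F + b F), one = (\<lambda>_. 0)\<rparr>"

text \<open>The homology is taken as an abelian group; its module structure plays no role for
  whether it vanishes.\<close>

definition reduced_homology ::
    "'v::linorder set set \<Rightarrow> int \<Rightarrow> ('v set \<Rightarrow> 'k::comm_ring_1) set monoid" where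
  "reduced_homology \<Delta> m = cycle_group \<Delta> m Mod simplicial_boundaries \<Delta> m"

definition homology_vanishes ::
    "'k::comm_ring_1 itself \<Rightarrow> 'v::linorder set set \<Rightarrow> int \<Rightarrow> bool" where
  "homology_vanishes k \<Delta> m \<longleftrightarrow>
     trivial_group (reduced_homology \<Delta> m :: ('v set \<Rightarrow> 'k) set monoid)"

text \<open>The second alternative says that the ring is a copy of the integers: \<open>of_int\<close> is the
  only ring homomorphism from \<open>int\<close>.\<close>

definition field_or_integers :: "'k::comm_ring_1 itself \<Rightarrow> bool" where
  "field_or_integers k \<longleftrightarrow>
     (\<forall>x::'k. x \<noteq> 0 \<longrightarrow> (\<exists>y. x * y = 1)) \<or> bij (of_int :: int \<Rightarrow> 'k)"

definition cohen_macaulay :: "'k::comm_ring_1 itself \<Rightarrow> 'v::linorder set set \<Rightarrow> bool" where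
  "cohen_macaulay k \<Delta> \<longleftrightarrow>
     (\<forall>F\<in>\<Delta>. \<forall>m. m < complex_dim \<Delta> - int (card F) \<longrightarrow> homology_vanishes k (link \<Delta> F) m)"

text \<open>\<open>W\<close> may be all of the vertex set; in particular a single point is not 2-CM.\<close>

definition multi_cohen_macaulay ::
    "'k::comm_ring_1 itself \<Rightarrow> nat \<Rightarrow> nat \<Rightarrow> nat set set \<Rightarrow> bool" where
  "multi_cohen_macaulay k p n \<Delta> \<longleftrightarrow>
     (\<forall>W. W \<subseteq> {1..n} \<and> int (card W) \<le> int p - 1 \<longrightarrow>
        cohen_macaulay k (deletion \<Delta> W) \<and> complex_dim (deletion \<Delta> W) = complex_dim \<Delta>)"


subsection \<open>The extremal spheres\<close>

definition simplex_boundary :: "'v set \<Rightarrow> 'v set set" where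
  "simplex_boundary V = {F. F \<subset> V}"

text \<open>The copy with index \<open>a\<close> of the boundary of the \<open>j\<close>-simplex lives on the vertex set
  \<open>{a} \<times> {0..j}\<close>.  The complex \<open>{{}}\<close> is the neutral element of the join.\<close>

primrec join_power :: "nat \<Rightarrow> nat \<Rightarrow> (nat \<times> nat) set set" where
  "join_power i 0 = {{}}"
| "join_power i (Suc q) = join (join_power i q) (simplex_boundary ({q} \<times> {0..i}))"

text \<open>\<open>extremal_sphere i q r\<close> is \<open>S(i, d - 1)\<close> for \<open>d = q * i + r\<close> with \<open>1 \<le> r \<le> i\<close>.\<close>

definition extremal_sphere :: "nat \<Rightarrow> nat \<Rightarrow> nat \<Rightarrow> (nat \<times> nat) set set" where
  "extremal_sphere i q r = join (join_power i q) (simplex_boundary ({q} \<times> {0..r}))"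

end

theory Submission
  imports Defs "HOL-Computational_Algebra.Computational_Algebra" "HOL-Library.Function_Algebras"
begin

text \<open>
  Both inequalities come from one recursion. If \<open>M\<close> is a minimal nonface with \<open>m + 1 \<le> i + 1\<close>
  vertices, then removing its vertices one at a time expresses the face enumerator of \<open>K\<close> through
  deletions in links of subsets of \<open>M\<close>, each of which dominates the link of some \<open>M - {v}\<close>;
  by induction on the dimension \<open>K\<close> dominates \<open>\<partial>\<sigma>\<^sup>m * S(i, d - 1 - m)\<close>, which dominates
  \<open>S(i, d - 1)\<close>.

  For face numbers, discarding the faces with at most \<open>i + 1\<close> vertices that miss the support of a
  top-dimensional cycle creates only small new missing faces; afterwards every \<open>M - {v}\<close> lies in the
  support, so its link again carries a top-dimensional cycle. In the equality case the vertex count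
  forces a missing face with \<open>r + 1\<close> vertices whose links are extremal by induction, and their
  missing faces partition the remaining vertices into nonfaces.

  For h-numbers, one needs \<open>h(lk A) \<le> h(K)\<close> for Cohen--Macaulay \<open>K\<close>. Over an infinite field
  \<open>h\<^sub>j\<close> is the dimension of a space of stresses (the inverse system of the Stanley--Reisner
  ring modulo a linear system of parameters), which is visibly monotone under inclusion of
  complexes of the same dimension, in particular of the closed star of \<open>A\<close> in \<open>K\<close>.
\<close>

section \<open>Coefficientwise comparison of polynomials\<close>

text \<open>All bounds concern \<open>weight z d\<close>, so one recursion serves both parts: with y
  = x + z, the boundary of the a-simplex has enumerator \<open>bpoly y a\<close>. Joins of such
  boundaries correspond to partitions of d into parts at most i. S(i, d - 1) takes the greedy, most
  uneven partition, and levelling two parts with fixed sum only increases the product; hence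
  splitting off any part m and continuing greedily never goes below \<open>epoly y i d\<close>. The
  two parts differ in how a deletion inside a link is compared with a star that it contains. Face
  numbers are monotone under inclusion, h-numbers are not: there both complexes must be
  Cohen-Macaulay for the same d and share one system of linear forms, so that one stress space
  contains the other. The moment curve supplies such a system if the field has as many elements as
  there are vertices, whereas k may be finite or the integers; this forces the change of
  coefficients. In the equality case f_0 only fixes the number of vertices. For r < i also f_r
  enters, because the bound on missing faces does not exclude a face filling the block of r + 1
  vertices; for blocks of i + 1 vertices it does.\<close>

definition coeff_le :: "int poly \<Rightarrow> int poly \<Rightarrow> bool" (infix \<open>\<preceq>\<close> 50) where
  "p \<preceq> q \<longleftrightarrow> (\<forall>k. coeff p k \<le> coeff q k)"

lemma coeff_le_refl [simp]: "p \<preceq> p"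
  by (simp add: coeff_le_def)

lemma coeff_le_trans [trans]: "p \<preceq> q \<Longrightarrow> q \<preceq> r \<Longrightarrow> p \<preceq> r"
  unfolding coeff_le_def by (meson order_trans)

lemma coeff_le_add: "p \<preceq> q \<Longrightarrow> p' \<preceq> q' \<Longrightarrow> p + p' \<preceq> q + q'"
  by (simp add: coeff_le_def add_mono)

lemma coeff_le_sum: "(\<And>a. a \<in> A \<Longrightarrow> f a \<preceq> g a) \<Longrightarrow> sum f A \<preceq> sum g A"
  by (simp add: coeff_le_def coeff_sum sum_mono)

lemma coeff_le_mult: "0 \<preceq> r \<Longrightarrow> p \<preceq> q \<Longrightarrow> r * p \<preceq> r * q"
  by (simp add: coeff_le_def coeff_mult sum_mono mult_left_mono)

lemma coeff_nonneg_mult: "0 \<preceq> p \<Longrightarrow> 0 \<preceq> q \<Longrightarrow> 0 \<preceq> p * q"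
  using coeff_le_mult[of p 0 q] by simp

lemma coeff_nonneg_one [simp]: "0 \<preceq> 1"
  by (simp add: coeff_le_def)

lemma coeff_nonneg_X [simp]: "0 \<preceq> [:0, 1:]"
  by (simp add: coeff_le_def coeff_pCons split: nat.split)

lemma coeff_nonneg_power: "0 \<preceq> p \<Longrightarrow> 0 \<preceq> p ^ n"
  by (induction n) (auto intro: coeff_nonneg_mult)

lemma coeff_nonneg_sum: "(\<And>a. a \<in> A \<Longrightarrow> 0 \<preceq> f a) \<Longrightarrow> 0 \<preceq> sum f A"
  using coeff_le_sum[of A "\<lambda>_. 0" f] by simp

text \<open>This is (y^(a+1) - x^(a+1)) / (y - x). For \<open>y = 1\<close> it is 1 + x + ... + x^a,
  the h-polynomial of the boundary of the a-simplex; for \<open>y = [:0, 1:] + 1\<close> it is the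
  f-polynomial.\<close>

definition bpoly :: "int poly \<Rightarrow> nat \<Rightarrow> int poly" where
  "bpoly y a = (\<Sum>k\<le>a. [:0, 1:] ^ k * y ^ (a - k))"

lemma bpoly_0 [simp]: "bpoly y 0 = 1"
  by (simp add: bpoly_def)

lemma bpoly_Suc: "bpoly y (Suc a) = [:0, 1:] * bpoly y a + y ^ Suc a"
  unfolding bpoly_def
  by (subst sum.atMost_Suc_shift) (simp add: sum_distrib_left algebra_simps)

lemma bpoly_split:
  assumes "b \<le> a"
  shows "bpoly y a = y ^ (a - b) * bpoly y b + (\<Sum>k\<in>{Suc b..a}. [:0, 1:] ^ k * y ^ (a - k))"
proof -
  have "{..a} = {..b} \<union> {Suc b..a}" using assms by auto
  then have "bpoly y a = (\<Sum>k\<le>b. [:0, 1:] ^ k * y ^ (a - k)) + (\<Sum>k\<in>{Suc b..a}. [:0, 1:] ^ k * y ^ (a - k))"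
    unfolding bpoly_def by (simp add: sum.union_disjoint)
  also have "(\<Sum>k\<le>b. [:0, 1:] ^ k * y ^ (a - k)) = y ^ (a - b) * bpoly y b"
    unfolding bpoly_def sum_distrib_left
    by (rule sum.cong) (use assms in \<open>auto simp: power_add[symmetric] algebra_simps\<close>)
  finally show ?thesis .
qed

context
  fixes y :: "int poly"
  assumes y_nonneg: "0 \<preceq> y"
begin

lemma bpoly_nonneg: "0 \<preceq> bpoly y a"
  unfolding bpoly_def
  by (intro coeff_nonneg_sum coeff_nonneg_mult coeff_nonneg_power y_nonneg coeff_nonneg_X)

text \<open>Expanding both longer factors by the recursion leaves as difference y^(b+1) times the
  terms of \<open>bpoly y a\<close> with index above b, which are nonnegative.\<close>

lemma bpoly_exchange_Suc:
  assumes "b \<le> a"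
  shows "bpoly y (Suc a) * bpoly y b \<preceq> bpoly y a * bpoly y (Suc b)"
proof -
  define R where "R = (\<Sum>k\<in>{Suc b..a}. [:0, 1:] ^ k * y ^ (a - k))"
  have R: "0 \<preceq> R" unfolding R_def
    by (intro coeff_nonneg_sum coeff_nonneg_mult coeff_nonneg_power y_nonneg coeff_nonneg_X)
  have e: "y ^ Suc a = y ^ Suc b * y ^ (a - b)"
    using assms by (simp add: power_add[symmetric])
  have "bpoly y a * bpoly y (Suc b) = bpoly y (Suc a) * bpoly y b + y ^ Suc b * (bpoly y a - y ^ (a - b) * bpoly y b)"
    unfolding bpoly_Suc e by (simp add: algebra_simps)
  also have "bpoly y a - y ^ (a - b) * bpoly y b = R"
    using bpoly_split[OF assms] by (simp add: R_def)
  finally have "bpoly y a * bpoly y (Suc b) = bpoly y (Suc a) * bpoly y b + y ^ Suc b * R" .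
  moreover have "0 \<preceq> y ^ Suc b * R"
    by (intro coeff_nonneg_mult coeff_nonneg_power y_nonneg R)
  ultimately show ?thesis
    using coeff_le_add[OF coeff_le_refl, of 0 "y ^ Suc b * R"] by simp
qed

lemma bpoly_exchange:
  assumes "b \<le> a" "c \<le> b"
  shows "bpoly y (a + c) * bpoly y (b - c) \<preceq> bpoly y a * bpoly y b"
  using assms(2)
proof (induction c)
  case (Suc c)
  have "bpoly y (Suc (a + c)) * bpoly y (b - Suc c) \<preceq> bpoly y (a + c) * bpoly y (Suc (b - Suc c))"
    using assms(1) Suc.prems by (intro bpoly_exchange_Suc) auto
  also have "Suc (b - Suc c) = b - c" using Suc.prems by auto
  also have "bpoly y (a + c) * bpoly y (b - c) \<preceq> bpoly y a * bpoly y b"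
    using Suc by simp
  finally show ?case by simp
qed simp

text \<open>Of two index pairs with the same sum, the closer one gives the larger product. Which of
  a and b is larger is left open; both orders reduce to \<open>bpoly_exchange\<close>.\<close>

lemma bpoly_majorize:
  assumes "a + b = c + e" "a \<le> c" "b \<le> c"
  shows "bpoly y c * bpoly y e \<preceq> bpoly y a * bpoly y b"
proof (cases "b \<le> a")
  case True
  have "c = a + (c - a)" "e = b - (c - a)" "c - a \<le> b" using assms by auto
  then show ?thesis using bpoly_exchange[OF True, of "c - a"] by metis
next
  case False
  have "c = b + (c - b)" "e = a - (c - b)" "c - b \<le> a" "a \<le> b" using assms False by auto
  then show ?thesis using bpoly_exchange[of a b "c - b"] by (metis mult.commute)
qed

end

text \<open>For \<open>y = x + z\<close> this is the sum of \<open>x\<^sup>k z\<^sup>d\<^sup>-\<^sup>k\<close> over the faces of \<open>S(i, d - 1)\<close> of size \<open>k\<close>.\<close>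

function epoly :: "int poly \<Rightarrow> nat \<Rightarrow> nat \<Rightarrow> int poly" where
  "epoly y i d = (if i = 0 \<or> d \<le> i then bpoly y d else bpoly y i * epoly y i (d - i))"
  by pat_completeness auto
termination by (relation "measure (\<lambda>(y, i, d). d)") auto

declare epoly.simps [simp del]

lemma epoly_small: "d \<le> i \<Longrightarrow> epoly y i d = bpoly y d"
  by (subst epoly.simps) simp

lemma epoly_large: "0 < i \<Longrightarrow> i < d \<Longrightarrow> epoly y i d = bpoly y i * epoly y i (d - i)"
  by (subst epoly.simps) simp

lemma epoly_eq:
  assumes "1 \<le> r" "r \<le> i"
  shows "epoly y i (q * i + r) = bpoly y i ^ q * bpoly y r"
proof (induction q)
  case 0
  then show ?case using assms by (simp add: epoly_small)
next
  case (Suc q)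
  have "epoly y i (Suc q * i + r) = bpoly y i * epoly y i (Suc q * i + r - i)"
    using assms by (intro epoly_large) auto
  with Suc show ?case by simp
qed

text \<open>The greedy partition i, i, ..., r of d is compared with one that first takes a part a.
  While a full part i can be split off on both sides, induction applies; near the end the pair (a, d
  - a) is compared by majorization with (d, 0) or (i, d - i).\<close>

lemma epoly_le:
  assumes y: "0 \<preceq> y" and "1 \<le> a" "a \<le> i" "a \<le> d"
  shows "epoly y i d \<preceq> bpoly y a * epoly y i (d - a)"
  using assms(4)
proof (induction d rule: less_induct)
  case (less d)
  have i: "0 < i" using assms by simp
  consider "d \<le> i" | "i < d" "d - a \<le> i" | "i < d" "i < d - a" by linarith
  then show ?case
  proof cases
    case 1
    then show ?thesis
      using bpoly_majorize[OF y, of a "d - a" d 0] less.prems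
      by (simp add: epoly_small)
  next
    case 2
    then show ?thesis
      using bpoly_majorize[OF y, of a "d - a" i "d - i"] less.prems assms(3) i
      by (simp add: epoly_small epoly_large)
  next
    case 3
    have "epoly y i (d - i) \<preceq> bpoly y a * epoly y i (d - i - a)"
      using 3 i assms by (intro less.IH) auto
    then have "bpoly y i * epoly y i (d - i) \<preceq> bpoly y i * (bpoly y a * epoly y i (d - i - a))"
      by (intro coeff_le_mult bpoly_nonneg y)
    moreover have "epoly y i (d - a) = bpoly y i * epoly y i (d - i - a)"
      using epoly_large[of i "d - a" y] 3 i by (simp add: diff_diff_left add.commute)
    ultimately show ?thesis
      using 3 i by (simp add: epoly_large[of i d] algebra_simps)
  qed
qed

section \<open>Simplicial complexes and weighted face enumerators\<close>

definition scomplex :: "'v set set \<Rightarrow> bool" where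
  "scomplex K \<longleftrightarrow> finite K \<and> {} \<in> K \<and> (\<forall>F\<in>K. finite F \<and> (\<forall>G. G \<subseteq> F \<longrightarrow> G \<in> K))"

lemma subface: "scomplex K \<Longrightarrow> F \<in> K \<Longrightarrow> G \<subseteq> F \<Longrightarrow> G \<in> K"
  by (auto simp: scomplex_def)

lemma scomplex_finite: "scomplex K \<Longrightarrow> finite K"
  by (simp add: scomplex_def)

lemma scomplex_empty: "scomplex K \<Longrightarrow> {} \<in> K"
  by (simp add: scomplex_def)

lemma finite_face: "scomplex K \<Longrightarrow> F \<in> K \<Longrightarrow> finite F"
  by (auto simp: scomplex_def)

lemma scomplex_vertex: "scomplex K \<Longrightarrow> v \<in> \<Union>K \<Longrightarrow> {v} \<in> K"
  using subface by fastforce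

lemma scomplex_link: "scomplex K \<Longrightarrow> A \<in> K \<Longrightarrow> scomplex (link K A)"
  unfolding scomplex_def link_def
  by (auto intro: finite_subset) (meson Un_mono order_refl subset_iff)+

lemma scomplex_deletion: "scomplex K \<Longrightarrow> scomplex (deletion K W)"
  unfolding scomplex_def deletion_def by (auto intro: finite_subset)

lemma link_link:
  assumes "scomplex K" "A \<inter> B = {}"
  shows "link (link K A) B = link K (A \<union> B)"
proof -
  have sub: "\<forall>G. A \<union> (B \<union> G) \<in> K \<longrightarrow> A \<union> G \<in> K \<and> B \<union> G \<in> K \<and> G \<in> K"
    by (meson assms(1) subface Un_mono sup_ge2 order_refl subset_trans)
  show ?thesis
  proof (rule Set.set_eqI)
    fix G
    have "A \<inter> (B \<union> G) = {} \<longleftrightarrow> A \<inter> G = {}" "(A \<union> B) \<inter> G = {} \<longleftrightarrow> A \<inter> G = {} \<and> B \<inter> G = {}"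
      using assms(2) by blast+
    then show "G \<in> link (link K A) B \<longleftrightarrow> G \<in> link K (A \<union> B)"
      using sub unfolding link_def mem_Collect_eq Un_assoc by blast
  qed
qed

lemma link_empty [simp]: "link K {} = K"
  by (auto simp: link_def)

lemma link_deletion: "A \<inter> W = {} \<Longrightarrow> link (deletion K W) A = deletion (link K A) W"
  by (auto simp: link_def deletion_def)

lemma deletion_link_self: "A \<inter> W = W \<Longrightarrow> deletion (link K A) W = link K A"
  by (auto simp: link_def deletion_def)

lemma card_link_face:
  assumes "scomplex K" "\<forall>F\<in>K. card F \<le> d" "G \<in> link K A"
  shows "card G \<le> d - card A"
proof -
  have "A \<union> G \<in> K" "A \<inter> G = {}" using assms(3) by (auto simp: link_def)
  moreover from this have "card (A \<union> G) = card A + card G"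
    using finite_face[OF assms(1)] by (metis card_Un_disjoint finite_Un)
  ultimately show ?thesis using assms(2) by force
qed

text \<open>The ambient vertex set does not appear: \<open>{v}\<close> is a minimal nonface for every \<open>v\<close> that is
  not a vertex, which is harmless for bounds on the size of minimal nonfaces.\<close>

definition min_nonface :: "'v set set \<Rightarrow> 'v set \<Rightarrow> bool" where
  "min_nonface K M \<longleftrightarrow> finite M \<and> M \<notin> K \<and> (\<forall>G. G \<subset> M \<longrightarrow> G \<in> K)"

definition nonfaces_le :: "nat \<Rightarrow> 'v set set \<Rightarrow> bool" where
  "nonfaces_le i K \<longleftrightarrow> (\<forall>M. min_nonface K M \<longrightarrow> card M \<le> Suc i)"

lemma min_nonface_ex:
  assumes "finite X" "X \<notin> K"
  shows "\<exists>M\<subseteq>X. min_nonface K M"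
  using assms
proof (induction "card X" arbitrary: X rule: less_induct)
  case less
  show ?case
  proof (cases "\<exists>G. G \<subset> X \<and> G \<notin> K")
    case True
    then obtain G where "G \<subset> X" "G \<notin> K" by blast
    with less show ?thesis
      by (metis psubset_card_mono finite_subset psubset_imp_subset subset_trans)
  next
    case False
    with less.prems show ?thesis unfolding min_nonface_def by blast
  qed
qed

text \<open>A vertex of this link inside M could only be v, and then M would lie in a face. So the
  link lives off M, and the vertex counts of M and of the link add up.\<close>

lemma link_facet_of_nonface:
  assumes "scomplex K" "min_nonface K M" "v \<in> M"
  shows "\<Union>(link K (M - {v})) \<subseteq> \<Union>K - M"
proof
  fix u assume "u \<in> \<Union>(link K (M - {v}))"
  then obtain G where G: "u \<in> G" "G \<in> K" "(M - {v}) \<inter> G = {}" "(M - {v}) \<union> G \<in> K"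
    by (auto simp: link_def)
  have "\<not> M \<subseteq> (M - {v}) \<union> G"
    using G(4) assms(2) subface[OF assms(1)] by (auto simp: min_nonface_def)
  then show "u \<in> \<Union>K - M" using G by blast
qed

text \<open>If M is a minimal nonface of the link disjoint from A, a minimal nonface T of K inside A
  \<union> M cannot avoid any w in M, because A together with M - {w} is a face. Hence M \<subseteq>
  T, and the size bound passes from T to M. A minimal nonface meeting A is a single vertex.\<close>

lemma nonfaces_le_link:
  assumes "scomplex K" "nonfaces_le i K" "A \<in> K"
  shows "nonfaces_le i (link K A)"
  unfolding nonfaces_le_def
proof (intro allI impI)
  fix M assume M: "min_nonface (link K A) M"
  then have fM: "finite M" by (simp add: min_nonface_def)
  show "card M \<le> Suc i"
  proof (cases "A \<inter> M = {}")
    case False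
    then obtain w where w: "w \<in> A" "w \<in> M" by blast
    then have "{w} \<notin> link K A" by (auto simp: link_def)
    then have "\<not> {w} \<subset> M" using M by (auto simp: min_nonface_def)
    then have "M = {w}" using w by auto
    then show ?thesis by simp
  next
    case True
    have "A \<union> M \<notin> K"
      using M True subface[OF assms(1)] unfolding min_nonface_def link_def by blast
    then obtain T where T: "T \<subseteq> A \<union> M" "min_nonface K T"
      using min_nonface_ex fM finite_face[OF assms(1,3)] by (metis finite_Un)
    have "M \<subseteq> T"
    proof
      fix w assume w: "w \<in> M"
      then have "M - {w} \<in> link K A" using M by (auto simp: min_nonface_def)
      then have "A \<union> (M - {w}) \<in> K" by (auto simp: link_def)
      then have "\<not> T \<subseteq> A \<union> (M - {w})"
        using T(2) subface[OF assms(1)] by (auto simp: min_nonface_def)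
      then show "w \<in> T" using T(1) by auto
    qed
    then have "card M \<le> card T"
      using T(2) by (intro card_mono) (auto simp: min_nonface_def)
    also have "card T \<le> Suc i" using T(2) assms(2) by (simp add: nonfaces_le_def)
    finally show ?thesis .
  qed
qed

text \<open>This is \<open>f(x)\<close> for \<open>z = 1\<close> and \<open>h(x)\<close> for \<open>z = 1 - x\<close>.\<close>

definition weight :: "int poly \<Rightarrow> nat \<Rightarrow> 'v set set \<Rightarrow> int poly" where
  "weight z d K = (\<Sum>F\<in>K. [:0, 1:] ^ card F * z ^ (d - card F))"

lemma weight_deletion_link:
  assumes "scomplex K"
  shows "weight z d K = weight z d (deletion K {v}) + [:0, 1:] * weight z (d - 1) (link K {v})"
proof -
  have fin: "finite K" using assms by (rule scomplex_finite)
  have e: "K = deletion K {v} \<union> {F \<in> K. v \<in> F}" by (auto simp: deletion_def)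
  have "weight z d K = weight z d (deletion K {v}) + weight z d {F \<in> K. v \<in> F}"
    unfolding weight_def by (subst e, rule sum.union_disjoint) (use fin in \<open>auto simp: deletion_def\<close>)
  moreover have "weight z d {F \<in> K. v \<in> F} = (\<Sum>G\<in>link K {v}. [:0, 1:] * ([:0, 1:] ^ card G * z ^ (d - 1 - card G)))"
    unfolding weight_def
  proof (rule sum.reindex_bij_witness[where i = "insert v" and j = "\<lambda>F. F - {v}"])
    fix F assume F: "F \<in> {F \<in> K. v \<in> F}"
    then show "insert v (F - {v}) = F" by auto
    show "F - {v} \<in> link K {v}"
      using F subface[OF assms] unfolding link_def by (auto simp: insert_absorb)
    have "finite F" using F finite_face[OF assms] by auto
    then have "card F = Suc (card (F - {v}))" using F by (metis card_Suc_Diff1 mem_Collect_eq)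
    then show "[:0, 1:] * ([:0, 1:] ^ card (F - {v}) * z ^ (d - 1 - card (F - {v}))) =
         [:0, 1:] ^ card F * z ^ (d - card F)" by simp
  qed (auto simp: link_def)
  ultimately show ?thesis by (simp add: weight_def sum_distrib_left)
qed

lemma weight_join:
  assumes "finite K1" "finite K2" "\<Union>K1 \<inter> \<Union>K2 = {}"
    and "\<forall>F\<in>K1. finite F \<and> card F \<le> a" "\<forall>F\<in>K2. finite F \<and> card F \<le> b"
  shows "weight z (a + b) (join K1 K2) = weight z a K1 * weight z b K2"
proof -
  have j: "join K1 K2 = (\<lambda>(F, G). F \<union> G) ` (K1 \<times> K2)"
    by (auto simp: join_def)
  have inj: "inj_on (\<lambda>(F, G). F \<union> G) (K1 \<times> K2)"
  proof (rule inj_onI, clarify)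
    fix F G F' G' assume h: "F \<in> K1" "G \<in> K2" "F' \<in> K1" "G' \<in> K2" "F \<union> G = F' \<union> G'"
    then have "F = (F \<union> G) \<inter> \<Union>K1" "F' = (F \<union> G) \<inter> \<Union>K1"
      "G = (F \<union> G) \<inter> \<Union>K2" "G' = (F \<union> G) \<inter> \<Union>K2" using assms(3) by auto
    then show "F = F' \<and> G = G'" by simp
  qed
  have "weight z (a + b) (join K1 K2) =
      (\<Sum>(F, G)\<in>K1 \<times> K2. [:0, 1:] ^ card (F \<union> G) * z ^ (a + b - card (F \<union> G)))"
    unfolding weight_def j by (subst sum.reindex[OF inj]) (simp add: case_prod_unfold)
  also have "\<dots> = (\<Sum>(F, G)\<in>K1 \<times> K2. ([:0, 1:] ^ card F * z ^ (a - card F)) * ([:0, 1:] ^ card G * z ^ (b - card G)))"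
  proof (rule sum.cong, simp, clarify)
    fix F G assume FG: "F \<in> K1" "G \<in> K2"
    then have c: "card (F \<union> G) = card F + card G"
      using assms(3-5) by (intro card_Un_disjoint) auto
    have "a + b - (card F + card G) = (a - card F) + (b - card G)"
      using FG assms(4,5) by force
    then show "[:0, 1:] ^ card (F \<union> G) * z ^ (a + b - card (F \<union> G)) =
        ([:0, 1:] ^ card F * z ^ (a - card F)) * ([:0, 1:] ^ card G * z ^ (b - card G))"
      by (simp only: c power_add) (simp only: ac_simps)
  qed
  also have "\<dots> = weight z a K1 * weight z b K2"
    unfolding weight_def sum_product sum.cartesian_product ..
  finally show ?thesis .
qed

lemma weight_Pow:
  assumes "finite A"
  shows "weight z (card A) (Pow A) = ([:0, 1:] + z) ^ card A"
proof -
  have "([:0, 1:] + z) ^ card A = (\<Prod>a\<in>A. [:0, 1:] + z)" by simp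
  also have "\<dots> = (\<Sum>F\<in>Pow A. (\<Prod>a\<in>F. [:0, 1:]) * (\<Prod>a\<in>A - F. z))"
    using assms by (rule prod_add)
  also have "\<dots> = weight z (card A) (Pow A)"
    unfolding weight_def
    by (rule sum.cong) (use assms in \<open>auto simp: card_Diff_subset finite_subset\<close>)
  finally show ?thesis by simp
qed

lemma weight_simplex_boundary:
  assumes "finite M" "card M = Suc m" "z \<noteq> 0"
  shows "weight z m (simplex_boundary M) = bpoly ([:0, 1:] + z) m"
proof -
  \<comment> \<open>The factor z raises the exponent from m to m + 1, so that M itself can be added
    and the full simplex expanded binomially; it is cancelled at the end.\<close>
  have "z * weight z m (simplex_boundary M) = weight z (Suc m) (simplex_boundary M)"
    unfolding weight_def sum_distrib_left
  proof (rule sum.cong[OF refl])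
    fix F assume "F \<in> simplex_boundary M"
    then have "card F < Suc m" using psubset_card_mono[of M F] assms by (auto simp: simplex_boundary_def)
    then show "z * ([:0, 1:] ^ card F * z ^ (m - card F)) = [:0, 1:] ^ card F * z ^ (Suc m - card F)"
      by (simp add: Suc_diff_le)
  qed
  also have "\<dots> = ([:0, 1:] + z) ^ Suc m - [:0, 1:] ^ Suc m"
  proof -
    have "Pow M = insert M (simplex_boundary M)" "M \<notin> simplex_boundary M" "finite (simplex_boundary M)"
      using assms(1) finite_subset[of "{F. F \<subset> M}" "Pow M"] by (auto simp: simplex_boundary_def)
    then have "weight z (Suc m) (Pow M) = [:0, 1:] ^ Suc m + weight z (Suc m) (simplex_boundary M)"
      by (simp add: weight_def assms(2))
    then show ?thesis using weight_Pow[OF assms(1), of z] assms(2) by simp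
  qed
  also have "\<dots> = z * bpoly ([:0, 1:] + z) m"
    using power_diff_sumr2[of "[:0, 1:]" "Suc m" "[:0, 1:] + z"]
    by (simp add: bpoly_def lessThan_Suc_atMost mult.commute algebra_simps)
  finally show ?thesis using assms(3) by simp
qed

text \<open>For A inside M, splitting the link of A at a vertex of M - A by
  \<open>weight_deletion_link\<close> mirrors the recursion \<open>bpoly_Suc\<close> at index m -
  card A. The deletion supplies the power of y, the link of the larger set the remaining
  terms.\<close>

lemma weight_min_nonface:
  assumes "scomplex K" "min_nonface K M" "card M = Suc m"
    and bound: "\<And>A v. A \<subset> M \<Longrightarrow> v \<in> M - A \<Longrightarrow>
      y ^ (m - card A) * Q \<preceq> weight z (d - card A) (deletion (link K A) {v})"
  shows "bpoly y m * Q \<preceq> weight z d K"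
proof -
  have fM: "finite M" and face: "\<And>A. A \<subset> M \<Longrightarrow> A \<in> K"
    using assms(2) by (auto simp: min_nonface_def)
  have "bpoly y k * Q \<preceq> weight z (d - card A) (link K A)"
    if "A \<subset> M" "card A + k = m" for k A
    using that
  proof (induction k arbitrary: A)
    \<comment> \<open>Here A is M without one vertex v. Its link avoids v already, so the deletion
      in the hypothesis changes nothing and the power of y is y^0.\<close>
    case 0
    then obtain v where v: "v \<in> M - A" by blast
    have "insert v A = M"
    proof (rule card_subset_eq[OF fM])
      show "insert v A \<subseteq> M" using v 0 by auto
      show "card (insert v A) = card M"
        using v 0 assms(3) finite_subset[OF psubset_imp_subset[OF 0(1)] fM] by simp
    qed
    then have "A = M - {v}" using v by auto
    then have "v \<notin> G" if "G \<in> link K A" for G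
      using link_facet_of_nonface[OF assms(1,2)] v that by blast
    then have "deletion (link K A) {v} = link K A"
      by (auto simp: deletion_def)
    then show ?case using bound[OF 0(1) v] 0 by simp
  next
    case (Suc k)
    then obtain v where v: "v \<in> M - A" by blast
    have fA: "finite A" using finite_subset[OF psubset_imp_subset[OF Suc(2)] fM] .
    have c: "card (insert v A) = Suc (card A)" using v fA by simp
    have ps: "insert v A \<subset> M"
    proof (rule psubsetI)
      show "insert v A \<subseteq> M" using v Suc by auto
      show "insert v A \<noteq> M" using c Suc.prems(2) assms(3) by auto
    qed
    have sc: "scomplex (link K A)" using assms(1) face[OF Suc(2)] by (rule scomplex_link)
    have l: "link (link K A) {v} = link K (insert v A)"
      using link_link[OF assms(1), of A "{v}"] v by auto
    have "bpoly y (Suc k) * Q = y ^ (m - card A) * Q + [:0, 1:] * (bpoly y k * Q)"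
    proof -
      have "m - card A = Suc k" using Suc.prems by auto
      then show ?thesis by (simp only: bpoly_Suc algebra_simps)
    qed
    also have "\<dots> \<preceq> weight z (d - card A) (deletion (link K A) {v}) + [:0, 1:] * weight z (d - card A - 1) (link (link K A) {v})"
      using Suc.IH[OF ps] c Suc.prems bound[OF Suc(2) v] unfolding l
      by (intro coeff_le_add coeff_le_mult coeff_nonneg_X) auto
    also have "\<dots> = weight z (d - card A) (link K A)"
      using weight_deletion_link[OF sc, of z "d - card A" v] by simp
    finally show ?case .
  qed
  from this[of "{}" m] show ?thesis using assms(3) by (cases "M = {}") auto
qed

definition closed_star :: "'v set set \<Rightarrow> 'v set \<Rightarrow> 'v set set" where
  "closed_star K A = {F \<in> K. F \<union> A \<in> K}"

lemma scomplex_closed_star: "scomplex K \<Longrightarrow> A \<in> K \<Longrightarrow> scomplex (closed_star K A)"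
  unfolding scomplex_def closed_star_def
  by (auto intro: finite_subset) (meson Un_mono order_refl subset_iff)+

lemma closed_star_iff: "scomplex K \<Longrightarrow> F \<in> closed_star K A \<longleftrightarrow> F \<union> A \<in> K"
  using subface[of K "F \<union> A" F] by (auto simp: closed_star_def)

text \<open>The star is the join of the full simplex on A with the link. For z = 1 - x the factor of
  the simplex is 1, so star and link have the same h-polynomial.\<close>

lemma weight_closed_star:
  assumes "scomplex K" "A \<in> K" "\<forall>F\<in>K. card F \<le> d"
  shows "weight z d (closed_star K A) = ([:0, 1:] + z) ^ card A * weight z (d - card A) (link K A)"
proof -
  have fA: "finite A" using finite_face[OF assms(1,2)] .
  have "closed_star K A = join (Pow A) (link K A)"
  proof (intro subset_antisym subsetI)
    fix F assume F: "F \<in> closed_star K A"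
    then have "F - A \<in> link K A"
      using subface[OF assms(1), of "F \<union> A"]
      by (auto simp: closed_star_def link_def Un_commute)
    moreover have "F = (F \<inter> A) \<union> (F - A)" by auto
    ultimately show "F \<in> join (Pow A) (link K A)" unfolding join_def by blast
  next
    fix F assume "F \<in> join (Pow A) (link K A)"
    then obtain B G where "F = B \<union> G" "B \<subseteq> A" "A \<union> G \<in> K" by (auto simp: join_def link_def)
    moreover from this have "F \<union> A = A \<union> G" by auto
    ultimately show "F \<in> closed_star K A" by (simp add: closed_star_iff[OF assms(1)])
  qed
  moreover have "d = card A + (d - card A)" using assms(2,3) by simp
  moreover have "weight z (card A + (d - card A)) (join (Pow A) (link K A)) =
      weight z (card A) (Pow A) * weight z (d - card A) (link K A)"
  proof (rule weight_join)
    show "\<Union> (Pow A) \<inter> \<Union> (link K A) = {}" by (auto simp: link_def)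
    show "\<forall>F\<in>Pow A. finite F \<and> card F \<le> card A" using fA by (auto intro: card_mono finite_subset)
    show "\<forall>F\<in>link K A. finite F \<and> card F \<le> d - card A"
      using card_link_face[OF assms(1,3)] finite_face[OF scomplex_link[OF assms(1,2)]] by blast
  qed (use fA scomplex_finite[OF scomplex_link[OF assms(1,2)]] in auto)
  ultimately show ?thesis using weight_Pow[OF fA, of z] by simp
qed

text \<open>B completes A to M - {v}, so the star of B in the deletion is built on the link of M -
  {v}. That link and its parameter d - m do not depend on A, hence one Q serves all levels of
  \<open>weight_min_nonface\<close>.\<close>

lemma min_nonface_link_split:
  assumes "scomplex K" "min_nonface K M" "card M = Suc m" "A \<subset> M" "v \<in> M - A"
  defines "B \<equiv> M - {v} - A"
  shows "card A + card B = m" "B \<in> deletion (link K A) {v}"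
    and "link (deletion (link K A) {v}) B = link K (M - {v})"
proof -
  have fM: "finite M" using assms(2) by (simp add: min_nonface_def)
  have AB: "A \<union> B = M - {v}" "A \<inter> B = {}" using assms(4,5) by (auto simp: B_def)
  then have "card (M - {v}) = card A + card B" using fM by (metis card_Un_disjoint finite_Diff finite_Un)
  moreover have "card (M - {v}) = m" using assms(3,5) fM by simp
  ultimately show "card A + card B = m" by simp
  have "M - {v} \<in> K" using assms(2,5) by (auto simp: min_nonface_def)
  then have "A \<union> B \<in> K" "B \<in> K" using AB(1) subface[OF assms(1), of "M - {v}" B] by auto
  then show "B \<in> deletion (link K A) {v}" using AB(2) by (auto simp: deletion_def link_def B_def)
  have "link (deletion (link K A) {v}) B = deletion (link (link K A) B) {v}"
    by (rule link_deletion) (simp add: B_def)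
  also have "\<dots> = deletion (link K (M - {v})) {v}" using link_link[OF assms(1) AB(2)] AB(1) by simp
  also have "\<dots> = link K (M - {v})"
    using link_facet_of_nonface[OF assms(1,2), of v] assms(5) by (auto simp: deletion_def)
  finally show "link (deletion (link K A) {v}) B = link K (M - {v})" .
qed

section \<open>Complexes with a top-dimensional cycle\<close>

definition sg :: "'v::linorder \<Rightarrow> 'v set \<Rightarrow> 'k::comm_ring_1" where
  "sg v G = (-1) ^ card {u \<in> G. u < v}"

lemma sg_square [simp]: "sg v G * sg v G = 1" "sg v G * (sg v G * x) = x"
  by (simp_all add: sg_def flip: mult.assoc power_add)

lemma sg_insert:
  assumes "finite G" "w \<notin> G"
  shows "sg v (insert w G) = (if w < v then - sg v G else sg v G)"
proof -
  have "{u \<in> insert w G. u < v} = (if w < v then insert w {u \<in> G. u < v} else {u \<in> G. u < v})"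
    by auto
  then show ?thesis using assms by (simp add: sg_def)
qed

lemma sg_swap:
  assumes "finite G" "v \<notin> G" "w \<notin> G" "v \<noteq> w"
  shows "sg w G * sg v (insert w G) = - (sg v G * sg w (insert v G))"
  using assms by (cases v w rule: linorder_cases) (auto simp: sg_insert)

text \<open>The sum runs over a fixed finite U instead of the vertices of a complex, so that one
  operator serves K, its links, deletions and stars; for chains on a complex, points outside it
  contribute zero.\<close>

definition bd :: "'v::linorder set \<Rightarrow> ('v set \<Rightarrow> 'k::comm_ring_1) \<Rightarrow> 'v set \<Rightarrow> 'k" where
  "bd U c G = (\<Sum>v\<in>U - G. sg v G * c (insert v G))"

text \<open>Faces are measured by their number d of vertices, so the degree is d - 1. When no face
  has more than d vertices there are no nonzero boundaries to divide by, and such a z is a nonzero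
  homology class.\<close>

definition top_cycle :: "'v::linorder set \<Rightarrow> nat \<Rightarrow> 'v set set \<Rightarrow> ('v set \<Rightarrow> 'k::comm_ring_1) \<Rightarrow> bool" where
  "top_cycle U d K z \<longleftrightarrow>
     (\<exists>F. z F \<noteq> 0) \<and> (\<forall>F. z F \<noteq> 0 \<longrightarrow> F \<in> K \<and> card F = d) \<and> (\<forall>G. bd U z G = 0)"

text \<open>The part of the cycle through v, with v removed. The sign \<open>sg v G\<close> makes
  its boundary at G equal, up to sign, to the boundary of z at \<open>insert v G\<close>. The
  nonzero value at F - {v} is recorded so that further vertices of F can be removed.\<close>

lemma top_cycle_link_vertex:
  fixes z :: "'v::linorder set \<Rightarrow> 'k::comm_ring_1"
  assumes "finite U" "scomplex K" "\<Union>K \<subseteq> U" "top_cycle U d K z" "z F \<noteq> 0" "v \<in> F"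
  shows "\<exists>z'::'v set \<Rightarrow> 'k. top_cycle U (d - 1) (link K {v}) z' \<and> z' (F - {v}) \<noteq> 0"
proof (intro exI conjI)
  let ?z = "\<lambda>G. if v \<in> G then 0 else sg v G * z (insert v G)"
  have z: "z F \<noteq> 0 \<Longrightarrow> F \<in> K \<and> card F = d" "bd U z G = 0" for F G
    using assms(4) by (auto simp: top_cycle_def)
  have unit: "sg v G * x = 0 \<Longrightarrow> x = 0" for G and x :: 'k
    by (metis mult_zero_right sg_square(2))
  show nz: "?z (F - {v}) \<noteq> 0"
    using assms(5,6) unit by (auto simp: insert_absorb)
  have "bd U ?z G = 0" for G
  proof (cases "v \<in> G \<or> infinite G")
    case True
    have "infinite G \<Longrightarrow> z (insert v (insert w G)) = 0" for w
      using z(1) finite_face[OF assms(2)] by (metis finite_insert)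
    with True show ?thesis by (auto simp: bd_def intro!: sum.neutral)
  next
    case False
    have "v \<in> U" using assms z by blast
    have "bd U ?z G = (\<Sum>w\<in>U - insert v G. sg w G * ?z (insert w G))"
      unfolding bd_def
      by (rule sum.mono_neutral_right) (use assms False in auto)
    also have "\<dots> = (\<Sum>w\<in>U - insert v G. - sg v G * (sg w (insert v G) * z (insert w (insert v G))))"
    proof (rule sum.cong[OF refl])
      fix w assume w: "w \<in> U - insert v G"
      then have "sg w G * ?z (insert w G) = (sg w G * sg v (insert w G)) * z (insert w (insert v G))"
        using False by (auto simp: insert_commute mult.assoc)
      also have "sg w G * sg v (insert w G) = - (sg v G * sg w (insert v G) :: 'k)"
        using sg_swap w False by blast
      finally show "sg w G * ?z (insert w G) = - sg v G * (sg w (insert v G) * z (insert w (insert v G)))"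
        by (simp add: mult.assoc)
    qed
    also have "\<dots> = - sg v G * bd U z (insert v G)"
      by (simp only: bd_def sum_distrib_left)
    finally show ?thesis using z(2) by simp
  qed
  moreover have "G \<in> link K {v} \<and> card G = d - 1" if "?z G \<noteq> 0" for G
  proof -
    have "v \<notin> G" "z (insert v G) \<noteq> 0" using that by (auto split: if_splits)
    with z(1) finite_face[OF assms(2)] subface[OF assms(2)] show ?thesis
      by (fastforce simp: link_def)
  qed
  ultimately show "top_cycle U (d - 1) (link K {v}) ?z"
    unfolding top_cycle_def using nz by blast
qed

lemma top_cycle_link:
  fixes z :: "'v::linorder set \<Rightarrow> 'k::comm_ring_1"
  assumes "finite U" "scomplex K" "\<Union>K \<subseteq> U" "top_cycle U d K z" "z F \<noteq> 0" "finite A" "A \<subseteq> F"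
  shows "\<exists>z'::'v set \<Rightarrow> 'k. top_cycle U (d - card A) (link K A) z'"
  using assms(6,2-5,7)
proof (induction A arbitrary: d K z F)
  case empty
  then show ?case by auto
next
  case (insert v A)
  obtain z' :: "'v set \<Rightarrow> 'k" where z': "top_cycle U (d - 1) (link K {v}) z'" "z' (F - {v}) \<noteq> 0"
    using top_cycle_link_vertex[OF assms(1) insert.prems(1-4)] insert.prems(5) by blast
  have "F \<in> K" using insert.prems(3,4) by (auto simp: top_cycle_def)
  then have v: "{v} \<in> K" using insert.prems(1,5) subface by blast
  have "\<exists>z''::'v set \<Rightarrow> 'k. top_cycle U (d - 1 - card A) (link (link K {v}) A) z''"
  proof (rule insert.IH)
    show "scomplex (link K {v})" using insert.prems(1) v by (rule scomplex_link)
    show "\<Union> (link K {v}) \<subseteq> U" using insert.prems(2) by (auto simp: link_def)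
    show "A \<subseteq> F - {v}" using insert.prems(5) insert.hyps by auto
  qed (use z' in auto)
  then show ?case
    using link_link[OF insert.prems(1), of "{v}" A] insert.hyps by simp
qed

text \<open>In the boundary at the ridge F - {v}, the contribution of F must be cancelled by another
  face of the support.\<close>

lemma top_cycle_adjacent:
  fixes z :: "'v::linorder set \<Rightarrow> 'k::comm_ring_1"
  assumes "finite U" "F \<subseteq> U" "top_cycle U d K z" "z F \<noteq> 0" "v \<in> F"
  obtains w where "w \<in> U - F" "z (insert w (F - {v})) \<noteq> 0"
proof (rule ccontr)
  assume "\<not> thesis"
  with that have zero: "\<And>w. w \<in> U - F \<Longrightarrow> z (insert w (F - {v})) = 0" by blast
  have "bd U z (F - {v}) = (\<Sum>w\<in>{v}. sg w (F - {v}) * z (insert w (F - {v})))"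
    unfolding bd_def
  proof (rule sum.mono_neutral_right)
    show "\<forall>w\<in>U - (F - {v}) - {v}. sg w (F - {v}) * z (insert w (F - {v})) = 0"
    proof
      fix w assume "w \<in> U - (F - {v}) - {v}"
      then have "w \<in> U - F" by auto
      then show "sg w (F - {v}) * z (insert w (F - {v})) = 0" using zero by simp
    qed
  qed (use assms in auto)
  then have "sg v (F - {v}) * z F = 0"
    using assms by (simp add: top_cycle_def insert_absorb)
  then show False using assms(4) by (metis mult_zero_right sg_square(2))
qed

text \<open>The class on which the induction runs: it survives the passage to
  \<open>low_supported_subcomplex\<close>, and from there to the link of a missing face without one
  vertex.\<close>

definition cyclic_complex :: "'v::linorder set \<Rightarrow> nat \<Rightarrow> nat \<Rightarrow> 'v set set \<Rightarrow> ('v set \<Rightarrow> 'k::comm_ring_1) \<Rightarrow> bool" where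
  "cyclic_complex U i d K z \<longleftrightarrow> finite U \<and> scomplex K \<and> \<Union>K \<subseteq> U \<and> (\<forall>F\<in>K. card F \<le> d) \<and>
     nonfaces_le i K \<and> top_cycle U d K z"

lemma cyclic_complexD:
  assumes "cyclic_complex U i d K z"
  shows "finite U" "scomplex K" "\<Union>K \<subseteq> U" "\<And>F. F \<in> K \<Longrightarrow> card F \<le> d" "nonfaces_le i K" "top_cycle U d K z"
  using assms by (auto simp: cyclic_complex_def)

definition low_supported :: "nat \<Rightarrow> 'v set set \<Rightarrow> ('v set \<Rightarrow> 'k::zero) \<Rightarrow> bool" where
  "low_supported i K z \<longleftrightarrow> (\<forall>G\<in>K. card G \<le> Suc i \<longrightarrow> (\<exists>F. z F \<noteq> 0 \<and> G \<subseteq> F))"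

text \<open>Suppose M were a minimal nonface of K' with more than i + 1 vertices. Its subsets with
  at most i + 1 vertices are proper, hence in K' and supported, so M fails to be in K' only because
  it is not in K; this contradicts the bound for K.\<close>

lemma low_supported_subcomplex:
  assumes "cyclic_complex U i d K z"
  obtains K' where "K' \<subseteq> K" "cyclic_complex U i d K' z" "low_supported i K' z"
proof -
  note c = cyclic_complexD[OF assms]
  define S where "S G \<longleftrightarrow> (\<exists>F. z F \<noteq> 0 \<and> G \<subseteq> F)" for G
  define K' where "K' = {F \<in> K. \<forall>G\<subseteq>F. card G \<le> Suc i \<longrightarrow> S G}"
  have sub: "K' \<subseteq> K" by (auto simp: K'_def)
  have "S {}" using c(6) by (auto simp: top_cycle_def S_def)
  then have sc: "scomplex K'"
    using c(2) sub unfolding scomplex_def K'_def by (auto intro: finite_subset)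
  have "nonfaces_le i K'"
    unfolding nonfaces_le_def
  proof (intro allI impI, rule ccontr)
    fix M assume M: "min_nonface K' M" "\<not> card M \<le> Suc i"
    have "S G" if "G \<subseteq> M" "card G \<le> Suc i" for G
    proof -
      have "G \<subset> M" using that M(2) by auto
      then have "G \<in> K'" using M(1) by (auto simp: min_nonface_def)
      then show ?thesis using that(2) by (auto simp: K'_def)
    qed
    then have "M \<notin> K" using M(1) by (auto simp: min_nonface_def K'_def)
    then have "min_nonface K M" using M(1) sub by (auto simp: min_nonface_def)
    then show False using M(2) c(5) by (auto simp: nonfaces_le_def)
  qed
  moreover have "F \<in> K'" if "z F \<noteq> 0" for F
    using that c(6) by (auto simp: top_cycle_def K'_def S_def)
  then have "top_cycle U d K' z" using c(6) by (auto simp: top_cycle_def)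
  ultimately have "cyclic_complex U i d K' z"
    using c sub sc by (auto simp: cyclic_complex_def)
  moreover have "low_supported i K' z"
    by (auto simp: low_supported_def K'_def S_def)
  ultimately show ?thesis using that sub by blast
qed

lemma min_nonface_vertices:
  assumes "min_nonface K M" "card M = Suc m" "1 \<le> m"
  shows "M \<subseteq> \<Union>K"
proof
  fix v assume "v \<in> M"
  moreover from this assms have "{v} \<subset> M" by (auto simp: psubset_eq)
  ultimately show "v \<in> \<Union>K" using assms(1) by (auto simp: min_nonface_def)
qed

lemma min_nonface_card:
  assumes "scomplex K" "min_nonface K M" "M \<subseteq> \<Union>K"
  obtains m where "card M = Suc m" "1 \<le> m"
proof -
  have fM: "finite M" "M \<notin> K" using assms(2) by (auto simp: min_nonface_def)
  have "card M \<noteq> 0" using fM scomplex_empty[OF assms(1)] by auto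
  moreover have "card M \<noteq> 1"
    using fM(2) scomplex_vertex[OF assms(1)] assms(3) by (auto simp: card_1_singleton_iff)
  ultimately show ?thesis using that[of "card M - 1"] by auto
qed

text \<open>A support face F and its neighbour across a ridge together have d + 1 vertices, too many
  for a face. All of these are vertices of K, so the minimal nonface among them has at least two
  elements.\<close>

lemma cyclic_complex_nonface:
  assumes "cyclic_complex U i d K z" "1 \<le> d"
  obtains M m where "min_nonface K M" "card M = Suc m" "1 \<le> m"
proof -
  note c = cyclic_complexD[OF assms(1)]
  obtain F where F: "z F \<noteq> 0" using c(6) by (auto simp: top_cycle_def)
  then have F': "F \<in> K" "card F = d" using c(6) by (auto simp: top_cycle_def)
  then obtain v where v: "v \<in> F" using assms(2) by (metis card.empty ex_in_conv not_one_le_zero)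
  have "F \<subseteq> U" using c(3) F' by auto
  then obtain w where w: "w \<in> U - F" "z (insert w (F - {v})) \<noteq> 0"
    using top_cycle_adjacent[OF c(1) _ c(6) F v] by blast
  then have w': "insert w (F - {v}) \<in> K" using c(6) by (auto simp: top_cycle_def)
  have fF: "finite F" using finite_face[OF c(2)] F' by auto
  then have "insert w F \<notin> K" using c(4) F' w by fastforce
  then obtain M where M: "M \<subseteq> insert w F" "min_nonface K M"
    using min_nonface_ex[of "insert w F" K] fF by auto
  then have "M \<subseteq> \<Union>K" using F' w' by auto
  with M(2) that show ?thesis using min_nonface_card[OF c(2)] by metis
qed

lemma cyclic_complex_link:
  fixes z :: "'v::linorder set \<Rightarrow> 'k::comm_ring_1"
  assumes "cyclic_complex U i d K z" "low_supported i K z"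
    and M: "min_nonface K M" "card M = Suc m" "v \<in> M"
  shows "\<exists>z'::'v set \<Rightarrow> 'k. cyclic_complex U i (d - m) (link K (M - {v})) z'" "m \<le> i" "m \<le> d"
proof -
  note c = cyclic_complexD[OF assms(1)]
  have fM: "finite M" using M by (simp add: min_nonface_def)
  have cM: "card (M - {v}) = m" using M fM by simp
  have face: "M - {v} \<in> K" using M by (auto simp: min_nonface_def)
  show mi: "m \<le> i" using M c(5) by (force simp: nonfaces_le_def)
  show "m \<le> d" using c(4)[OF face] cM by simp
  obtain F where F: "z F \<noteq> 0" "M - {v} \<subseteq> F"
    using assms(2) face cM mi unfolding low_supported_def by fastforce
  then obtain z' :: "'v set \<Rightarrow> 'k" where "top_cycle U (d - m) (link K (M - {v})) z'"
    using top_cycle_link[OF c(1-3,6), of F "M - {v}"] fM cM by auto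
  moreover have "card G \<le> d - m" if "G \<in> link K (M - {v})" for G
    using card_link_face[OF c(2) _ that] c(4) cM by auto
  moreover have "\<Union> (link K (M - {v})) \<subseteq> U" using c(3) by (auto simp: link_def)
  ultimately show "\<exists>z'::'v set \<Rightarrow> 'k. cyclic_complex U i (d - m) (link K (M - {v})) z'"
    using c(1) scomplex_link[OF c(2) face] nonfaces_le_link[OF c(2,5) face]
    by (auto simp: cyclic_complex_def)
qed

lemma X_power: "[:0, 1::int:] ^ n = monom 1 n"
  by (simp add: monom_altdef)

text \<open>With z = 1 the exponents leave no trace, so d and e may differ.\<close>

lemma weight_1_mono: "K \<subseteq> \<Gamma> \<Longrightarrow> finite \<Gamma> \<Longrightarrow> weight 1 d K \<preceq> weight 1 e \<Gamma>"
  unfolding weight_def coeff_le_def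
  by (auto simp: coeff_sum simp: X_power intro!: sum_mono2)

lemma coeff_weight_1:
  assumes "finite K"
  shows "coeff (weight 1 d K) k = int (card {F \<in> K. card F = k})"
proof -
  have "coeff (weight 1 d K) k = (\<Sum>F\<in>K. if card F = k then 1 else 0)"
    unfolding weight_def by (simp add: coeff_sum X_power)
  then show ?thesis using assms by (simp add: sum.If_cases Int_def)
qed

theorem weight_1_cyclic_complex:
  fixes z :: "'v::linorder set \<Rightarrow> 'k::comm_ring_1"
  assumes "cyclic_complex U i d K z"
  shows "epoly ([:0, 1:] + 1) i d \<preceq> weight 1 d K"
  using assms
proof (induction d arbitrary: K z rule: less_induct)
  case (less d)
  let ?y = "[:0, 1:] + 1 :: int poly"
  have y: "0 \<preceq> ?y" using coeff_le_add[OF coeff_nonneg_X coeff_nonneg_one] by simp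
  obtain K' where K': "K' \<subseteq> K" and cyc: "cyclic_complex U i d K' z" and low: "low_supported i K' z"
    using low_supported_subcomplex[OF less.prems] by blast
  note c = cyclic_complexD[OF cyc]
  have "epoly ?y i d \<preceq> weight 1 d K'"
  proof (cases "d = 0")
    case True
    have "weight 1 d {{} :: 'v set} \<preceq> weight 1 d K'"
      by (rule weight_1_mono) (use c(2) in \<open>auto simp: scomplex_def\<close>)
    then show ?thesis using True by (simp add: epoly_small weight_def)
  next
    case False
    obtain M m where M: "min_nonface K' M" "card M = Suc m" "1 \<le> m"
      using cyclic_complex_nonface[OF cyc] False by (metis One_nat_def Suc_leI neq0_conv)
    obtain v0 where "v0 \<in> M" using M(2) by fastforce
    then have mi: "m \<le> i" "m \<le> d" using cyclic_complex_link(2,3)[OF cyc low M(1,2)] by auto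
    let ?Q = "epoly ?y i (d - m)"
    have "bpoly ?y m * ?Q \<preceq> weight 1 d K'"
    proof (rule weight_min_nonface[OF c(2) M(1,2)])
      fix A v assume A: "A \<subset> M" "v \<in> M - A"
      let ?L = "link K' (M - {v})" and ?B = "M - {v} - A" and ?\<Gamma> = "deletion (link K' A) {v}"
      note split = min_nonface_link_split[OF c(2) M(1,2) A]
      obtain z' :: "'v set \<Rightarrow> 'k" where z': "cyclic_complex U i (d - m) ?L z'"
        using cyclic_complex_link(1)[OF cyc low M(1,2), of v] A by auto
      have Q: "?Q \<preceq> weight 1 (d - m) ?L"
        using less.IH[OF _ z'] M(3) False by simp
      have "A \<in> K'" using M(1) A(1) by (simp add: min_nonface_def)
      then have s\<Gamma>: "scomplex ?\<Gamma>" by (intro scomplex_deletion scomplex_link c(2))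
      have "\<forall>F\<in>?\<Gamma>. card F \<le> d - card A"
        using card_link_face[OF c(2), of d _ A] c(4) by (auto simp: deletion_def)
      note star = weight_closed_star[OF s\<Gamma> split(2) this, of 1]
      have "card ?B = m - card A" "d - card A - (m - card A) = d - m" using split(1) by linarith+
      with star
      have "?y ^ (m - card A) * weight 1 (d - m) ?L = weight 1 (d - card A) (closed_star ?\<Gamma> ?B)"
        by (simp only: split(3))
      \<comment> \<open>Containing the star is enough here because faces are merely counted; for
        h-numbers \<open>weight_link_le\<close> takes the place of this inclusion.\<close>
      also have "\<dots> \<preceq> weight 1 (d - card A) ?\<Gamma>"
        by (rule weight_1_mono[OF _ scomplex_finite[OF s\<Gamma>]]) (auto simp: closed_star_def)
      finally have "?y ^ (m - card A) * weight 1 (d - m) ?L \<preceq> weight 1 (d - card A) ?\<Gamma>" .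
      then show "?y ^ (m - card A) * ?Q \<preceq> weight 1 (d - card A) ?\<Gamma>"
        using coeff_le_mult[OF coeff_nonneg_power[OF y] Q] coeff_le_trans by blast
    qed
    moreover have "epoly ?y i d \<preceq> bpoly ?y m * ?Q"
      using epoly_le[OF y] M mi by auto
    ultimately show ?thesis using coeff_le_trans by blast
  qed
  also have "weight 1 d K' \<preceq> weight 1 d K"
    using K' cyclic_complexD(2)[OF less.prems] scomplex_finite by (intro weight_1_mono)
  finally show ?case .
qed

section \<open>Joins of boundaries of simplices\<close>

text \<open>For disjoint blocks this is the join of the boundaries of the simplices on them. It is
  described by its nonfaces because the equality case finds the blocks as nonfaces.\<close>

definition block_complex :: "(nat \<Rightarrow> 'v set) \<Rightarrow> nat \<Rightarrow> 'v set set" where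
  "block_complex N k = {F. F \<subseteq> (\<Union>a<k. N a) \<and> (\<forall>a<k. \<not> N a \<subseteq> F)}"

lemma block_complex_0 [simp]: "block_complex N 0 = {{}}"
  by (auto simp: block_complex_def)

lemma block_complex_Suc:
  assumes "\<forall>a<k. N a \<inter> N k = {}"
  shows "block_complex N (Suc k) = join (block_complex N k) (simplex_boundary (N k))"
proof (intro subset_antisym subsetI)
  fix F assume F: "F \<in> block_complex N (Suc k)"
  let ?F1 = "F \<inter> (\<Union>a<k. N a)" and ?F2 = "F \<inter> N k"
  have "F = ?F1 \<union> ?F2" using F by (auto simp: block_complex_def lessThan_Suc)
  moreover have "?F1 \<in> block_complex N k" "?F2 \<in> simplex_boundary (N k)"
    using F by (auto simp: block_complex_def simplex_boundary_def)
  ultimately show "F \<in> join (block_complex N k) (simplex_boundary (N k))"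
    unfolding join_def by blast
next
  fix F assume "F \<in> join (block_complex N k) (simplex_boundary (N k))"
  then obtain F1 F2 where F: "F = F1 \<union> F2" "F1 \<in> block_complex N k" "F2 \<subset> N k"
    by (auto simp: join_def simplex_boundary_def)
  have "\<not> N a \<subseteq> F" if "a < k" for a
    using F that assms unfolding block_complex_def by blast
  moreover have "\<not> N k \<subseteq> F"
    using F assms unfolding block_complex_def by blast
  moreover have "F \<subseteq> (\<Union>a<Suc k. N a)"
    using F by (auto simp: block_complex_def lessThan_Suc)
  ultimately show "F \<in> block_complex N (Suc k)"
    by (auto simp: block_complex_def less_Suc_eq)
qed

text \<open>The product formula for joins presupposes finiteness and size bounds of the factors, so
  all three facts go through one induction.\<close>

lemma weight_block_complex_prod:
  assumes "\<forall>a<k. finite (N a) \<and> card (N a) = Suc (m a)"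
    and "\<forall>a<k. \<forall>b<k. a \<noteq> b \<longrightarrow> N a \<inter> N b = {}" and "z \<noteq> 0"
  shows "weight z (\<Sum>a<k. m a) (block_complex N k) = (\<Prod>a<k. bpoly ([:0, 1:] + z) (m a)) \<and>
    finite (block_complex N k) \<and> (\<forall>F\<in>block_complex N k. finite F \<and> card F \<le> (\<Sum>a<k. m a))"
  using assms(1,2)
proof (induction k)
  case 0
  then show ?case by (simp add: weight_def)
next
  case (Suc k)
  have IH: "weight z (\<Sum>a<k. m a) (block_complex N k) = (\<Prod>a<k. bpoly ([:0, 1:] + z) (m a))"
    "finite (block_complex N k)" "\<forall>F\<in>block_complex N k. finite F \<and> card F \<le> (\<Sum>a<k. m a)"
    using Suc by auto
  have disj: "\<forall>a<k. N a \<inter> N k = {}" using Suc.prems by auto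
  have Nk: "finite (N k)" "card (N k) = Suc (m k)" using Suc.prems by auto
  have sb: "finite (simplex_boundary (N k))" "\<forall>F\<in>simplex_boundary (N k). finite F \<and> card F \<le> m k"
    using Nk psubset_card_mono[of "N k"] finite_subset[of "{F. F \<subset> N k}" "Pow (N k)"] finite_subset[of _ "N k"]
    by (auto simp: simplex_boundary_def less_Suc_eq_le)
  have dU: "\<Union>(block_complex N k) \<inter> \<Union>(simplex_boundary (N k)) = {}"
  proof -
    have "\<Union>(block_complex N k) \<subseteq> (\<Union>a<k. N a)" "\<Union>(simplex_boundary (N k)) \<subseteq> N k"
      by (auto simp: block_complex_def simplex_boundary_def)
    with disj show ?thesis by blast
  qed
  have fin: "finite (block_complex N (Suc k))" "\<forall>F\<in>block_complex N (Suc k). finite F"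
  proof -
    have U: "finite (\<Union>a<Suc k. N a)" using Suc.prems by auto
    show "finite (block_complex N (Suc k))"
      by (rule finite_subset[OF _ finite_Pow_iff[THEN iffD2, OF U]]) (auto simp: block_complex_def)
    show "\<forall>F\<in>block_complex N (Suc k). finite F"
      using U by (auto simp: block_complex_def dest: finite_subset)
  qed
  have "card F \<le> (\<Sum>a<Suc k. m a)" if F: "F \<in> block_complex N (Suc k)" for F
  proof -
    obtain F1 F2 where "F = F1 \<union> F2" "F1 \<in> block_complex N k" "F2 \<in> simplex_boundary (N k)"
      using F block_complex_Suc[OF disj] by (auto simp: join_def)
    then show ?thesis
      using IH(3) sb(2) card_Un_le[of F1 F2] by fastforce
  qed
  moreover have "weight z (\<Sum>a<Suc k. m a) (block_complex N (Suc k)) = (\<Prod>a<Suc k. bpoly ([:0, 1:] + z) (m a))"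
    using weight_join[OF IH(2) sb(1) dU IH(3) sb(2), of z] IH(1)
      weight_simplex_boundary[OF Nk assms(3)] block_complex_Suc[OF disj] by simp
  ultimately show ?case using fin by blast
qed

text \<open>The block with the last index \<open>q\<close> is the one of size \<open>r + 1\<close>.\<close>

definition blocks :: "nat \<Rightarrow> nat \<Rightarrow> nat \<Rightarrow> (nat \<Rightarrow> 'v set) \<Rightarrow> bool" where
  "blocks i r q N \<longleftrightarrow> (\<forall>a\<le>q. finite (N a) \<and> card (N a) = Suc (if a < q then i else r)) \<and>
     (\<forall>a\<le>q. \<forall>b\<le>q. a \<noteq> b \<longrightarrow> N a \<inter> N b = {})"

lemma blocksD:
  assumes "blocks i r q N"
  shows "a \<le> q \<Longrightarrow> finite (N a)" "a < q \<Longrightarrow> card (N a) = Suc i" "card (N q) = Suc r"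
    "a \<le> q \<Longrightarrow> b \<le> q \<Longrightarrow> a \<noteq> b \<Longrightarrow> N a \<inter> N b = {}"
  using assms by (auto simp: blocks_def)

lemma blocks_nonempty: "blocks i r q N \<Longrightarrow> a \<le> q \<Longrightarrow> N a \<noteq> {}"
  using blocksD(2,3)[of i r q N] by (metis card.empty nat.distinct(1) le_neq_implies_less)

lemma
  assumes "blocks i r q N" "1 \<le> r" "r \<le> i"
  shows weight_block_complex:
      "z \<noteq> 0 \<Longrightarrow> weight z (q * i + r) (block_complex N (Suc q)) = epoly ([:0, 1:] + z) i (q * i + r)"
    and scomplex_block_complex: "scomplex (block_complex N (Suc q))"
    and card_block_complex_face: "\<forall>F\<in>block_complex N (Suc q). card F \<le> q * i + r"
proof -
  let ?m = "\<lambda>a. if a < q then i else r"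
  have s: "(\<Sum>a<Suc q. ?m a) = q * i + r" by simp
  have p: "(\<Prod>a<Suc q. bpoly y (?m a)) = epoly y i (q * i + r)" for y
    by (simp add: epoly_eq[OF assms(2,3)])
  have *: "weight z (q * i + r) (block_complex N (Suc q)) = epoly ([:0, 1:] + z) i (q * i + r) \<and>
    finite (block_complex N (Suc q)) \<and> (\<forall>F\<in>block_complex N (Suc q). finite F \<and> card F \<le> q * i + r)"
    if "z \<noteq> 0" for z
    using weight_block_complex_prod[of "Suc q" N ?m z] assms(1) that
    unfolding s p blocks_def less_Suc_eq_le by blast
  show "z \<noteq> 0 \<Longrightarrow> weight z (q * i + r) (block_complex N (Suc q)) = epoly ([:0, 1:] + z) i (q * i + r)"
    using * by blast
  show "\<forall>F\<in>block_complex N (Suc q). card F \<le> q * i + r" using *[of 1] by auto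
  have "{} \<in> block_complex N (Suc q)"
    using blocks_nonempty[OF assms(1)] by (auto simp: block_complex_def less_Suc_eq_le)
  moreover have "\<forall>F\<in>block_complex N (Suc q). \<forall>G\<subseteq>F. G \<in> block_complex N (Suc q)"
    unfolding block_complex_def by blast
  ultimately show "scomplex (block_complex N (Suc q))"
    using *[of 1] by (simp add: scomplex_def)
qed

lemma
  assumes "blocks i r q N" "1 \<le> r" "r \<le> i"
  shows Union_block_complex: "\<Union>(block_complex N (Suc q)) = (\<Union>a<Suc q. N a)"
    and card_Union_block_complex: "card (\<Union>a<Suc q. N a) = q * Suc i + Suc r"
proof -
  have "{v} \<in> block_complex N (Suc q)" if "v \<in> (\<Union>a<Suc q. N a)" for v
  proof -
    have "\<not> N a \<subseteq> {v}" if "a \<le> q" for a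
    proof
      assume "N a \<subseteq> {v}"
      then have "card (N a) \<le> 1" by (metis card.empty card_insert_disjoint card_mono empty_iff finite.emptyI finite.insertI One_nat_def)
      then show False using blocksD(2,3)[OF assms(1)] assms that by (cases "a = q") (auto simp: le_less)
    qed
    then show ?thesis using that by (auto simp: block_complex_def)
  qed
  then have "(\<Union>a<Suc q. N a) \<subseteq> \<Union>(block_complex N (Suc q))" by blast
  then show "\<Union>(block_complex N (Suc q)) = (\<Union>a<Suc q. N a)"
    by (intro subset_antisym) (auto simp: block_complex_def)
  have "card (\<Union>a<Suc q. N a) = (\<Sum>a<Suc q. card (N a))"
    using blocksD(1,4)[OF assms(1)] by (intro card_UN_disjoint) auto
  also have "\<dots> = q * Suc i + Suc r"
    using blocksD(2,3)[OF assms(1)] by simp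
  finally show "card (\<Union>a<Suc q. N a) = q * Suc i + Suc r" .
qed

definition std_blocks :: "nat \<Rightarrow> nat \<Rightarrow> nat \<Rightarrow> nat \<Rightarrow> (nat \<times> nat) set" where
  "std_blocks i r q a = {a} \<times> {0..(if a < q then i else r)}"

lemma blocks_std_blocks: "blocks i r q (std_blocks i r q)"
  by (auto simp: blocks_def std_blocks_def card_cartesian_product_singleton)

lemma extremal_sphere_eq: "extremal_sphere i q r = block_complex (std_blocks i r q) (Suc q)"
proof -
  have disj: "\<forall>a<k. std_blocks i r q a \<inter> std_blocks i r q k = {}" for k
    by (auto simp: std_blocks_def)
  have "join_power i k = block_complex (std_blocks i r q) k" if "k \<le> q" for k
    using that
  proof (induction k)
    case (Suc k)
    then have "{k} \<times> {0..i} = std_blocks i r q k" by (simp add: std_blocks_def)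
    with Suc show ?case by (simp add: block_complex_Suc[OF disj])
  qed simp
  moreover have "{q} \<times> {0..r} = std_blocks i r q q" by (simp add: std_blocks_def)
  ultimately show ?thesis
    by (simp add: extremal_sphere_def block_complex_Suc[OF disj])
qed

lemma blocks_iso:
  assumes "blocks i r q N" "blocks i r q N'" "1 \<le> r" "r \<le> i"
  shows "complex_iso (block_complex N (Suc q)) (block_complex N' (Suc q))"
proof -
  have "\<exists>g. bij_betw g (N a) (N' a)" if "a \<le> q" for a
    using assms(1,2) that by (intro finite_same_card_bij) (auto simp: blocks_def)
  then obtain g where g: "\<And>a. a \<le> q \<Longrightarrow> bij_betw (g a) (N a) (N' a)" by metis
  \<comment> \<open>Bijections of the single blocks are glued; disjointness makes the block of v
    unique.\<close>
  define \<phi> where "\<phi> v = g (THE a. a \<le> q \<and> v \<in> N a) v" for v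
  have the: "(THE a. a \<le> q \<and> v \<in> N a) = a" if "a \<le> q" "v \<in> N a" for a v
    using that blocksD(4)[OF assms(1)] by (intro the_equality) blast+
  have \<phi>: "\<phi> v = g a v" if "a \<le> q" "v \<in> N a" for a v
    using the that by (simp add: \<phi>_def)
  have img: "\<phi> ` N a = N' a" if "a \<le> q" for a
    using g[OF that] \<phi>[OF that] by (auto simp: bij_betw_def)
  have inj: "inj_on \<phi> (\<Union>a<Suc q. N a)"
  proof (rule inj_onI)
    fix x y assume xy: "x \<in> (\<Union>a<Suc q. N a)" "y \<in> (\<Union>a<Suc q. N a)" "\<phi> x = \<phi> y"
    then obtain a b where ab: "a \<le> q" "x \<in> N a" "b \<le> q" "y \<in> N b" by (auto simp: less_Suc_eq_le)
    then have "\<phi> x \<in> N' a" "\<phi> x \<in> N' b"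
      using img[OF ab(1)] img[OF ab(3)] ab xy(3) by (metis imageI)+
    then have "a = b" using blocksD(4)[OF assms(2)] ab by blast
    then show "x = y" using g[OF ab(1)] \<phi> ab xy(3) by (auto simp: bij_betw_def inj_on_def)
  qed
  have im: "\<phi> ` (\<Union>a<Suc q. N a) = (\<Union>a<Suc q. N' a)"
    using img by (auto simp: image_UN less_Suc_eq_le)
  have "F \<in> block_complex N (Suc q) \<longleftrightarrow> \<phi> ` F \<in> block_complex N' (Suc q)" if F: "F \<subseteq> (\<Union>a<Suc q. N a)" for F
  proof -
    have "N a \<subseteq> F \<longleftrightarrow> N' a \<subseteq> \<phi> ` F" if a: "a < Suc q" for a
    proof -
      have "N a \<subseteq> (\<Union>a<Suc q. N a)" using a by auto
      then have "\<phi> ` N a \<subseteq> \<phi> ` F \<longleftrightarrow> N a \<subseteq> F" 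
        using F by (auto dest!: subsetD[of "\<phi> ` N a"] inj_onD[OF inj])
      then show ?thesis using img a by auto
    qed
    moreover have "\<phi> ` F \<subseteq> (\<Union>a<Suc q. N' a)" using F im by blast
    ultimately show ?thesis using F by (auto simp: block_complex_def)
  qed
  then show ?thesis
    unfolding complex_iso_def Union_block_complex[OF assms(1,3,4)] Union_block_complex[OF assms(2,3,4)]
    using inj im by (auto simp: bij_betw_def)
qed

lemma card_vertices:
  assumes "scomplex K"
  shows "card {F \<in> K. card F = 1} = card (\<Union>K)"
proof -
  have "{F \<in> K. card F = 1} = (\<lambda>v. {v}) ` \<Union>K"
    using scomplex_vertex[OF assms] by (auto simp: card_1_singleton_iff)
  then show ?thesis by (simp add: card_image)
qed

lemma coeff_epoly:
  assumes "1 \<le> r" "r \<le> i"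
  shows "coeff (epoly ([:0, 1:] + 1) i (q * i + r)) k = int (card {F \<in> extremal_sphere i q r. card F = k})"
  using weight_block_complex[OF blocks_std_blocks assms, of 1 q]
    coeff_weight_1[OF scomplex_finite[OF scomplex_block_complex[OF blocks_std_blocks assms, of q]], of "q * i + r" k]
  by (simp add: extremal_sphere_eq)

lemma coeff_epoly_1:
  assumes "1 \<le> r" "r \<le> i"
  shows "coeff (epoly ([:0, 1:] + 1) i (q * i + r)) 1 = int (q * Suc i + Suc r)"
  using coeff_epoly[OF assms, of q 1] card_vertices[OF scomplex_block_complex[OF blocks_std_blocks assms, of q]]
    Union_block_complex[OF blocks_std_blocks assms, of q]
    card_Union_block_complex[OF blocks_std_blocks assms, of q]
  by (simp only: extremal_sphere_eq)

text \<open>A nonface contains a whole block, and the smallest block has r + 1 vertices. So all sets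
  of at most r vertices are faces, while the last block is a nonface of size r + 1.\<close>

lemma coeff_epoly_choose:
  assumes "1 \<le> r" "r \<le> i"
  shows "k \<le> r \<Longrightarrow> coeff (epoly ([:0, 1:] + 1) i (q * i + r)) k = int ((q * Suc i + Suc r) choose k)"
    and "coeff (epoly ([:0, 1:] + 1) i (q * i + r)) (Suc r) < int ((q * Suc i + Suc r) choose Suc r)"
proof -
  let ?N = "std_blocks i r q"
  let ?V = "\<Union>a<Suc q. ?N a"
  note b = blocks_std_blocks[of i r q]
  have fin: "finite ?V" using blocksD(1)[OF b] by auto
  have all: "card {F. F \<subseteq> ?V \<and> card F = k} = (q * Suc i + Suc r) choose k" for k
    using n_subsets[OF fin] card_Union_block_complex[OF b assms] by simp
  have sub: "{F \<in> block_complex ?N (Suc q). card F = k} \<subseteq> {F. F \<subseteq> ?V \<and> card F = k}" for k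
    by (auto simp: block_complex_def)
  have finS: "finite {F. F \<subseteq> ?V \<and> card F = k}" for k
    using fin by simp
  show "coeff (epoly ([:0, 1:] + 1) i (q * i + r)) k = int ((q * Suc i + Suc r) choose k)" if "k \<le> r"
  proof -
    have "F \<in> block_complex ?N (Suc q)" if F: "F \<subseteq> ?V" "card F = k" for F
    proof -
      have "\<not> ?N a \<subseteq> F" if "a \<le> q" for a
      proof
        assume "?N a \<subseteq> F"
        then have "card (?N a) \<le> k" using F fin by (metis card_mono finite_subset)
        then show False
          using blocksD(2,3)[OF b] that \<open>k \<le> r\<close> assms by (cases "a = q") (auto simp: le_less)
      qed
      then show ?thesis using F by (auto simp: block_complex_def)
    qed
    then have "{F \<in> block_complex ?N (Suc q). card F = k} = {F. F \<subseteq> ?V \<and> card F = k}"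
      using sub by blast
    then show ?thesis unfolding coeff_epoly[OF assms] extremal_sphere_eq using all by simp
  qed
  have "?N q \<in> {F. F \<subseteq> ?V \<and> card F = Suc r}" using blocksD(3)[OF b] by auto
  moreover have "?N q \<notin> block_complex ?N (Suc q)" by (auto simp: block_complex_def)
  ultimately have "{F \<in> block_complex ?N (Suc q). card F = Suc r} \<subset> {F. F \<subseteq> ?V \<and> card F = Suc r}"
    using sub by blast
  from psubset_card_mono[OF finS this]
  show "coeff (epoly ([:0, 1:] + 1) i (q * i + r)) (Suc r) < int ((q * Suc i + Suc r) choose Suc r)"
    by (simp only: coeff_epoly[OF assms] extremal_sphere_eq all of_nat_less_iff)
qed

section \<open>The equality case\<close>

lemma cyclic_complex_vertices:
  assumes "cyclic_complex U i d K z" "d = q * i + r" "1 \<le> r" "r \<le> i"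
  shows "q * Suc i + Suc r \<le> card (\<Union>K)"
proof -
  have sc: "scomplex K" using cyclic_complexD[OF assms(1)] by blast
  have "int (q * Suc i + Suc r) \<le> coeff (weight 1 d K) 1"
    using weight_1_cyclic_complex[OF assms(1)] coeff_epoly_1[OF assms(3,4), of q]
    by (simp add: coeff_le_def assms(2)) (metis One_nat_def)
  then have "int (q * Suc i + Suc r) \<le> int (card (\<Union>K))"
    by (simp only: coeff_weight_1[OF scomplex_finite[OF sc]] card_vertices[OF sc])
  then show ?thesis by (simp only: of_nat_le_iff)
qed

lemma finite_Union_scomplex: "scomplex K \<Longrightarrow> finite (\<Union>K)"
  by (auto simp: scomplex_def)

text \<open>A minimal nonface S of K inside A \<union> T contains T, as for
  \<open>nonfaces_le_link\<close>; the maximal size i + 1 then leaves no room for vertices of A, so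
  S = T.\<close>

lemma nonface_of_link:
  assumes "scomplex K" "nonfaces_le i K" "A \<in> K" "A \<inter> T = {}"
    and "min_nonface (link K A) T" "card T = Suc i"
  shows "T \<notin> K"
proof -
  have "A \<union> T \<notin> K"
  proof
    assume "A \<union> T \<in> K"
    then have "T \<in> link K A"
      using assms(4) subface[OF assms(1), of "A \<union> T" T] by (auto simp: link_def)
    then show False using assms(5) by (simp add: min_nonface_def)
  qed
  moreover have "finite (A \<union> T)"
    using finite_face[OF assms(1,3)] assms(5) by (simp add: min_nonface_def)
  ultimately obtain S where S: "S \<subseteq> A \<union> T" "min_nonface K S"
    using min_nonface_ex by metis
  have "T \<subseteq> S"
  proof
    fix w assume "w \<in> T"
    then have "T - {w} \<in> link K A" using assms(5) by (auto simp: min_nonface_def)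
    then have "A \<union> (T - {w}) \<in> K" by (auto simp: link_def)
    then have "\<not> S \<subseteq> A \<union> (T - {w})"
      using S(2) subface[OF assms(1)] by (auto simp: min_nonface_def)
    then show "w \<in> S" using S(1) by auto
  qed
  moreover have "card S \<le> card T" "finite S"
    using S(2) assms(2,6) by (auto simp: nonfaces_le_def min_nonface_def)
  ultimately have "T = S" by (metis card_seteq)
  then show ?thesis using S(2) by (simp add: min_nonface_def)
qed

lemma nonface_block_complex: "a \<le> q \<Longrightarrow> N a \<subseteq> F \<Longrightarrow> F \<notin> block_complex N (Suc q)"
  using le_imp_less_Suc[of a q] unfolding block_complex_def by blast

lemma min_nonface_block_complex:
  assumes "blocks i r q N" "1 \<le> r" "r \<le> i" "a \<le> q"
  shows "min_nonface (block_complex N (Suc q)) (N a)"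
  unfolding min_nonface_def
proof (intro conjI allI impI)
  show "finite (N a)" using blocksD(1)[OF assms(1,4)] .
  show "N a \<notin> block_complex N (Suc q)" by (rule nonface_block_complex[OF assms(4) subset_refl])
  fix G assume G: "G \<subset> N a"
  have "\<not> N b \<subseteq> G" if "b \<le> q" for b
  proof (cases "b = a")
    case False
    then have "N b \<inter> N a = {}" using blocksD(4)[OF assms(1) that assms(4)] by blast
    moreover have "N b \<noteq> {}" using blocks_nonempty[OF assms(1) that] .
    ultimately show ?thesis using G by blast
  qed (use G in auto)
  then show "G \<in> block_complex N (Suc q)"
    using G assms(4) by (auto simp: block_complex_def less_Suc_eq_le)
qed

lemma subcomplex_weight_1_eq:
  assumes "K \<subseteq> \<Gamma>" "finite \<Gamma>" "coeff (weight 1 d \<Gamma>) k \<le> coeff (weight 1 e K) k"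
  shows "{F \<in> K. card F = k} = {F \<in> \<Gamma>. card F = k}"
proof (rule card_seteq)
  show "card {F \<in> \<Gamma>. card F = k} \<le> card {F \<in> K. card F = k}"
    using assms coeff_weight_1[of \<Gamma> d k] coeff_weight_1[of K e k] finite_subset[of K \<Gamma>] by simp
qed (use assms in auto)

text \<open>An extra face would contain a full block. A block of r + 1 < i + 1 vertices is excluded
  by counting faces of that size; a block of i + 1 vertices by the dimension, through a set of d + 1
  vertices in which it is the only full block.\<close>

lemma block_complex_rigid:
  assumes "scomplex K" "\<And>F. F \<in> K \<Longrightarrow> card F \<le> d" "nonfaces_le i K"
    and N: "blocks i r q N" and r: "1 \<le> r" "r \<le> i" and d: "d = q * i + r"
    and sub: "block_complex N (Suc q) \<subseteq> K" and V: "\<Union>K = (\<Union>a<Suc q. N a)"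
    and fr: "r < i \<Longrightarrow> coeff (weight 1 d K) (Suc r) = coeff (epoly ([:0, 1:] + 1) i d) (Suc r)"
  shows "K = block_complex N (Suc q)"
proof (rule ccontr)
  assume "K \<noteq> block_complex N (Suc q)"
  then obtain F where F: "F \<in> K" "F \<notin> block_complex N (Suc q)" using sub by blast
  moreover have "F \<subseteq> (\<Union>a<Suc q. N a)" using F V by blast
  ultimately obtain a where a: "a \<le> q" "N a \<subseteq> F" by (auto simp: block_complex_def less_Suc_eq_le)
  then have Na: "N a \<in> K" using F subface[OF assms(1)] by blast
  have Na': "N a \<notin> block_complex N (Suc q)" by (rule nonface_block_complex[OF a(1) subset_refl])
  show False
  proof (cases "card (N a) = Suc i")
    case False
    then have "a = q" "r < i" using a blocksD(2,3)[OF N] r by (auto simp: le_less)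
    then have "{F \<in> block_complex N (Suc q). card F = Suc r} = {F \<in> K. card F = Suc r}"
      using fr weight_block_complex[OF N r, of 1] d
      by (intro subcomplex_weight_1_eq[OF sub scomplex_finite[OF assms(1)], of d _ d]) auto
    then show False using Na Na' \<open>a = q\<close> blocksD(3)[OF N] by blast
  next
    case True
    have "\<forall>b. \<exists>x. b \<le> q \<longrightarrow> x \<in> N b" using blocks_nonempty[OF N] by blast
    then obtain w where w: "\<And>b. b \<le> q \<Longrightarrow> w b \<in> N b" by metis
    \<comment> \<open>Dropping one vertex from each of the other q blocks leaves q * (i + 1) + r + 1
      - q = d + 1 vertices. A minimal nonface inside contains a block, necessarily
      \<open>N a\<close>, and by its size equals it.\<close>
    define X where "X = (\<Union>b<Suc q. N b) - w ` ({..q} - {a})"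
    have fX: "finite X" using blocksD(1)[OF N] by (auto simp: X_def)
    have inj: "inj_on w ({..q} - {a})"
      using w blocksD(4)[OF N] by (intro inj_onI) (metis DiffD1 atMost_iff disjoint_iff)
    have "w ` ({..q} - {a}) \<subseteq> (\<Union>b<Suc q. N b)" using w by force
    then have "card X = q * Suc i + Suc r - card ({..q} - {a})"
      unfolding X_def card_image[OF inj, symmetric]
      by (subst card_Diff_subset) (auto simp only: card_Union_block_complex[OF N r] finite_imageI finite_Diff finite_atMost)
    also have "card ({..q} - {a}) = q" using a(1) by simp
    finally have "card X = Suc d" using d by simp
    then have "X \<notin> K" using assms(2)[of X] by auto
    then obtain T where T: "T \<subseteq> X" "min_nonface K T" using min_nonface_ex fX by metis
    then have "T \<notin> block_complex N (Suc q)" using sub by (auto simp: min_nonface_def)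
    moreover have "T \<subseteq> (\<Union>a<Suc q. N a)" using T(1) by (auto simp: X_def)
    ultimately obtain b where b: "b \<le> q" "N b \<subseteq> T" by (auto simp: block_complex_def less_Suc_eq_le)
    have "b = a"
    proof (rule ccontr)
      assume "b \<noteq> a"
      then have "w b \<notin> X" using b(1) by (auto simp: X_def)
      then show False using w[OF b(1)] b(2) T(1) by auto
    qed
    moreover have "finite T" "card T \<le> Suc i"
      using T(2) assms(3) by (auto simp: min_nonface_def nonfaces_le_def)
    ultimately have "N a = T" using b(2) True by (metis card_seteq)
    then show False using T(2) Na by (simp add: min_nonface_def)
  qed
qed

lemma cyclic_complex_small_nonface:
  fixes z :: "'v::linorder set \<Rightarrow> 'k::comm_ring_1"
  assumes cyc: "cyclic_complex U i d K z" and low: "low_supported i K z"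
    and d: "d = q * i + r" and r: "1 \<le> r" "r \<le> i"
    and V: "card (\<Union>K) = q * Suc i + Suc r"
    and fr: "r < i \<Longrightarrow> coeff (weight 1 d K) (Suc r) \<le> coeff (epoly ([:0, 1:] + 1) i d) (Suc r)"
  obtains M where "min_nonface K M" "card M = Suc r" "M \<subseteq> \<Union>K"
proof -
  note c = cyclic_complexD[OF cyc]
  \<comment> \<open>If m < r, the link of M without a vertex has parameter q * i + (r - m), hence at
    least q * (i + 1) + r - m + 1 vertices, one more than remain outside M.\<close>
  have size: "r \<le> m" if M: "min_nonface K M" "card M = Suc m" "1 \<le> m" for M m
  proof (rule ccontr)
    assume "\<not> r \<le> m"
    then have mr: "m < r" by simp
    obtain v where v: "v \<in> M" using M(2) by fastforce
    let ?L = "link K (M - {v})"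
    obtain z' :: "'v set \<Rightarrow> 'k" where z': "cyclic_complex U i (d - m) ?L z'"
      using cyclic_complex_link(1)[OF cyc low M(1,2) v] by blast
    have lb: "q * Suc i + Suc (r - m) \<le> card (\<Union>?L)"
      by (rule cyclic_complex_vertices[OF z']) (use mr d r in auto)
    have sub: "\<Union>?L \<subseteq> \<Union>K - M" using link_facet_of_nonface[OF c(2) M(1) v] .
    from sub have "card (\<Union>?L) \<le> card (\<Union>K - M)"
      using finite_Union_scomplex[OF c(2)] by (intro card_mono) auto
    also have "card (\<Union>K - M) = card (\<Union>K) - Suc m"
      using min_nonface_vertices[OF M] M by (simp add: card_Diff_subset min_nonface_def)
    finally have "card (\<Union>?L) \<le> q * Suc i + Suc r - Suc m" using V by simp
    with lb show False using mr by simp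
  qed
  show ?thesis
  proof (cases "r = i")
    case True
    obtain M m where M: "min_nonface K M" "card M = Suc m" "1 \<le> m"
      using cyclic_complex_nonface[OF cyc] d r by (metis trans_le_add2)
    then have "m = r" using size[OF M] True c(5) by (auto simp: nonfaces_le_def)
    then show ?thesis using M min_nonface_vertices[OF M] that by blast
  next
    case False
    have fin: "finite (\<Union>K)" using finite_Union_scomplex[OF c(2)] .
    \<comment> \<open>For r < i there are fewer faces with r + 1 vertices than sets of that size, so
      some (r + 1)-set is a nonface; by \<open>size\<close> the minimal nonface inside is the whole
      set.\<close>
    have "coeff (weight 1 d K) (Suc r) < int (card (\<Union>K) choose Suc r)"
      using fr False r coeff_epoly_choose(2)[OF r, of q] unfolding V d by linarith
    then have lt: "card {F \<in> K. card F = Suc r} < card {F. F \<subseteq> \<Union>K \<and> card F = Suc r}"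
      unfolding coeff_weight_1[OF scomplex_finite[OF c(2)]] n_subsets[OF fin] by simp
    obtain X where X: "X \<subseteq> \<Union>K" "card X = Suc r" "X \<notin> K"
    proof -
      have "\<not> {F. F \<subseteq> \<Union>K \<and> card F = Suc r} \<subseteq> {F \<in> K. card F = Suc r}"
      proof
        assume s: "{F. F \<subseteq> \<Union>K \<and> card F = Suc r} \<subseteq> {F \<in> K. card F = Suc r}"
        have "finite {F \<in> K. card F = Suc r}" using scomplex_finite[OF c(2)] by simp
        from card_mono[OF this s] lt show False by simp
      qed
      then show ?thesis using that by blast
    qed
    have fX: "finite X" using X(1) fin by (rule finite_subset)
    obtain M where M: "M \<subseteq> X" "min_nonface K M" using min_nonface_ex[OF fX X(3)] by blast
    obtain m where m: "card M = Suc m" "1 \<le> m" using min_nonface_card[OF c(2) M(2)] M(1) X(1) by blast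
    have "r \<le> m" using size[OF M(2) m] .
    moreover have "card M \<le> Suc r" using card_mono[OF fX M(1)] X(2) by simp
    ultimately show ?thesis using that[OF M(2)] m M(1) X(1) by auto
  qed
qed

theorem cyclic_complex_extremal:
  fixes z :: "'v::linorder set \<Rightarrow> 'k::comm_ring_1"
  assumes "cyclic_complex U i d K z" "d = q * i + r" "1 \<le> r" "r \<le> i"
    and "card (\<Union>K) = q * Suc i + Suc r"
    and "r < i \<Longrightarrow> coeff (weight 1 d K) (Suc r) = coeff (epoly ([:0, 1:] + 1) i d) (Suc r)"
  shows "\<exists>N. blocks i r q N \<and> K = block_complex N (Suc q)"
  using assms
proof (induction q arbitrary: r d K z)
  \<comment> \<open>The part common to both cases of the induction. Only \<open>step\<close>, which
    partitions the vertices into nonfaces, depends on how q is reached.\<close>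
  have main: "\<exists>N. blocks i r q N \<and> K = block_complex N (Suc q)"
    if cyc: "cyclic_complex U i d K z" and d: "d = q * i + r" and r: "1 \<le> r" "r \<le> i"
      and V: "card (\<Union>K) = q * Suc i + Suc r"
      and fr: "r < i \<Longrightarrow> coeff (weight 1 d K) (Suc r) = coeff (epoly ([:0, 1:] + 1) i d) (Suc r)"
      and step: "\<And>K' M. cyclic_complex U i d K' z \<Longrightarrow> low_supported i K' z \<Longrightarrow> min_nonface K' M \<Longrightarrow>
        card M = Suc r \<Longrightarrow> M \<subseteq> \<Union>K' \<Longrightarrow> card (\<Union>K') = q * Suc i + Suc r \<Longrightarrow>
        \<exists>N. blocks i r q N \<and> (\<Union>a<Suc q. N a) = \<Union>K' \<and> (\<forall>a\<le>q. N a \<notin> K')"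
    for q r d and K :: "'v set set" and z :: "'v set \<Rightarrow> 'k"
  proof -
    note c = cyclic_complexD[OF cyc]
    obtain K' where sub: "K' \<subseteq> K" and cyc': "cyclic_complex U i d K' z" and low: "low_supported i K' z"
      using low_supported_subcomplex[OF cyc] by blast
    note c' = cyclic_complexD[OF cyc']
    \<comment> \<open>The lower bound on vertices applies to K' and is attained by K, so no vertex
      is lost.\<close>
    have "card (\<Union>K) \<le> card (\<Union>K')" using cyclic_complex_vertices[OF cyc' d r] V by simp
    then have UU: "\<Union>K' = \<Union>K"
      using sub finite_Union_scomplex[OF c(2)] by (intro card_seteq) auto
    have fr': "coeff (weight 1 d K') (Suc r) \<le> coeff (epoly ([:0, 1:] + 1) i d) (Suc r)" if "r < i"
      using fr[OF that] weight_1_mono[OF sub scomplex_finite[OF c(2)], of d d] by (metis coeff_le_def)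
    obtain M where M: "min_nonface K' M" "card M = Suc r" "M \<subseteq> \<Union>K'"
      using cyclic_complex_small_nonface[OF cyc' low d r] V UU fr' by auto
    obtain N where N: "blocks i r q N" "(\<Union>a<Suc q. N a) = \<Union>K'" "\<forall>a\<le>q. N a \<notin> K'"
      using step[OF cyc' low M] V UU by auto
    have sub': "K' \<subseteq> block_complex N (Suc q)"
    proof
      fix F assume F: "F \<in> K'"
      then have "\<not> N a \<subseteq> F" if "a \<le> q" for a
        using N(3) that subface[OF c'(2)] by blast
      then show "F \<in> block_complex N (Suc q)"
        using F N(2) by (auto simp: block_complex_def less_Suc_eq_le)
    qed
    \<comment> \<open>K' lies in the block complex and has at least as many faces of each size, so
      the two coincide. Rigidity then shows that nothing had been discarded from K.\<close>
    have "{F \<in> K'. card F = k} = {F \<in> block_complex N (Suc q). card F = k}" for k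
      by (rule subcomplex_weight_1_eq[OF sub' scomplex_finite[OF scomplex_block_complex[OF N(1) r]], of d _ d])
        (use weight_1_cyclic_complex[OF cyc'] weight_block_complex[OF N(1) r, of 1] d in \<open>simp add: coeff_le_def\<close>)
    then have "K' = block_complex N (Suc q)" by blast
    then have "K = block_complex N (Suc q)"
      using block_complex_rigid[OF c(2,4,5) N(1) r d] sub UU N(2) fr by auto
    then show ?thesis using N(1) by blast
  qed
  {
    case 0
    show ?case
    proof (rule main[OF 0])
      fix K' :: "'v set set" and M
      assume h: "min_nonface K' M" "card M = Suc r" "M \<subseteq> \<Union>K'" "card (\<Union>K') = 0 * Suc i + Suc r"
      then have "finite (\<Union>K')" by (metis add_0 card.infinite mult_0 nat.distinct(1))
      then have "M = \<Union>K'" using h by (metis add_0 card_subset_eq mult_0)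
      then have "blocks i r 0 (\<lambda>_. M) \<and> (\<Union>a<Suc 0. M) = \<Union>K' \<and> (\<forall>a\<le>0::nat. M \<notin> K')"
        using h by (auto simp: blocks_def min_nonface_def)
      then show "\<exists>N. blocks i r 0 N \<and> (\<Union>a<Suc 0. N a) = \<Union>K' \<and> (\<forall>a\<le>0. N a \<notin> K')"
        by blast
    qed
  next
    case (Suc q)
    show ?case
    proof (rule main[OF Suc.prems])
      fix K' :: "'v set set" and M
      assume cyc: "cyclic_complex U i d K' z" and low: "low_supported i K' z"
        and M: "min_nonface K' M" "card M = Suc r" "M \<subseteq> \<Union>K'"
        and V: "card (\<Union>K') = Suc q * Suc i + Suc r"
      note c = cyclic_complexD[OF cyc]
      have fV: "finite (\<Union>K')" using finite_Union_scomplex[OF c(2)] .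
      have fM: "finite M" using M(3) fV by (rule finite_subset)
      obtain v where v: "v \<in> M" using M(2) by fastforce
      let ?A = "M - {v}"
      let ?L = "link K' ?A"
      have A: "?A \<in> K'" using M(1) v by (auto simp: min_nonface_def)
      obtain z' :: "'v set \<Rightarrow> 'k" where z': "cyclic_complex U i (d - r) ?L z'"
        using cyclic_complex_link(1)[OF cyc low M(1,2) v] by blast
      \<comment> \<open>The last part is now a full i, so the condition on faces of size r + 1 is
        vacuous in the induction hypothesis and the vertex count alone identifies the link.\<close>
      have dr: "d - r = q * i + i" using Suc.prems by simp
      have i: "1 \<le> i" using Suc.prems by simp
      have "\<Union>?L \<subseteq> \<Union>K' - M" using link_facet_of_nonface[OF c(2) M(1) v] .
      moreover have cVM: "card (\<Union>K' - M) = Suc q * Suc i"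
        using card_Diff_subset[OF fM M(3)] M(2) V by simp
      moreover have "Suc q * Suc i \<le> card (\<Union>?L)"
        using cyclic_complex_vertices[OF z' dr i] by simp
      ultimately have UL: "\<Union>?L = \<Union>K' - M"
        using fV by (intro card_seteq) auto
      obtain N where N: "blocks i i q N" "?L = block_complex N (Suc q)"
        using Suc.IH[OF z' dr i order_refl] UL cVM by auto
      have UN: "(\<Union>a<Suc q. N a) = \<Union>K' - M"
        using Union_block_complex[OF N(1) i order_refl] N(2) UL by simp
      define N' where "N' = N(Suc q := M)"
      have NM: "N a \<inter> M = {}" if "a \<le> q" for a
      proof -
        have "N a \<subseteq> (\<Union>a<Suc q. N a)" using that by (intro UN_upper) auto
        then show ?thesis unfolding UN by auto
      qed
      then have bl: "blocks i r (Suc q) N'"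
        using N(1) M(2) fM NM by (auto simp: blocks_def N'_def le_Suc_eq split: if_splits)
      have "(\<Union>a<Suc (Suc q). N' a) = (\<Union>a<Suc q. N a) \<union> M"
        by (auto simp: N'_def less_Suc_eq split: if_splits)
      also have "\<dots> = \<Union>K'" using UN M(3) by auto
      finally have un: "(\<Union>a<Suc (Suc q). N' a) = \<Union>K'" .
      have nf: "N a \<notin> K'" if "a \<le> q" for a
      proof (rule nonface_of_link[OF c(2,5) A])
        show "?A \<inter> N a = {}" using NM[OF that] by auto
        show "min_nonface ?L (N a)"
          unfolding N(2) using min_nonface_block_complex[OF N(1) i order_refl that] .
        show "card (N a) = Suc i"
          using blocksD(2,3)[OF N(1)] that by (cases "a = q") auto
      qed
      have "\<forall>a\<le>Suc q. N' a \<notin> K'"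
        using nf M(1) by (auto simp: N'_def min_nonface_def le_Suc_eq)
      with bl un show "\<exists>N. blocks i r (Suc q) N \<and> (\<Union>a<Suc (Suc q). N a) = \<Union>K' \<and> (\<forall>a\<le>Suc q. N a \<notin> K')"
        by blast
    qed
  }
qed

section \<open>Regular sequences of linear forms\<close>

definition chain :: "'v set set \<Rightarrow> nat \<Rightarrow> ('v set \<Rightarrow> 'k::zero) \<Rightarrow> bool" where
  "chain K a c \<longleftrightarrow> (\<forall>A. c A \<noteq> 0 \<longrightarrow> A \<in> K \<and> card A = a)"

definition exact_at :: "'k::comm_ring_1 itself \<Rightarrow> 'v::linorder set \<Rightarrow> 'v set set \<Rightarrow> nat \<Rightarrow> bool" where
  "exact_at k U K a \<longleftrightarrow> (\<forall>c::'v set \<Rightarrow> 'k. chain K a c \<longrightarrow> (\<forall>G. bd U c G = 0) \<longrightarrow>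
     (\<exists>e. chain K (Suc a) e \<and> (\<forall>G. bd U e G = c G)))"

text \<open>Here a counts vertices, so exactness at a means vanishing homology in degree a - 1. The
  parameter d is explicit because stars and deletions are compared at a prescribed d;
  \<open>cm_pure\<close> shows that it forces faces with at least d vertices.\<close>

definition cm :: "'k::comm_ring_1 itself \<Rightarrow> 'v::linorder set \<Rightarrow> nat \<Rightarrow> 'v set set \<Rightarrow> bool" where
  "cm k U d K \<longleftrightarrow> (\<forall>F\<in>K. \<forall>a. a + card F < d \<longrightarrow> exact_at k U (link K F) a)"

definition cone :: "'v::linorder \<Rightarrow> ('v set \<Rightarrow> 'k::comm_ring_1) \<Rightarrow> 'v set \<Rightarrow> 'k" where
  "cone v c A = (if v \<in> A then sg v A * c (A - {v}) else 0)"

text \<open>The cone homotopy: boundary of the cone plus cone of the boundary is the identity.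
  \<open>cone v c\<close> uses c only on sets without v; at G containing v, the cycle condition at G
  - {v} restores the value of c.\<close>

lemma bd_cone:
  fixes c :: "'v::linorder set \<Rightarrow> 'k::comm_ring_1"
  assumes "finite U" "v \<in> U" "\<forall>A. c A \<noteq> 0 \<longrightarrow> finite A" "\<forall>G. bd U c G = 0"
  shows "bd U (cone v c) G = c G"
proof (cases "finite G")
  case False
  have z: "infinite A \<Longrightarrow> c A = 0" for A using assms(3) by blast
  have "cone v c (insert w G) = 0" for w
    using False z[of "insert w G - {v}"] by (simp add: cone_def)
  then show ?thesis using z[OF False] by (simp add: bd_def)
next
  case fin: True
  show ?thesis
  proof (cases "v \<in> G")
    case False
    have "bd U (cone v c) G = (\<Sum>w\<in>{v}. sg w G * cone v c (insert w G))"
      unfolding bd_def by (rule sum.mono_neutral_right) (use assms False in \<open>auto simp: cone_def\<close>)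
    also have "\<dots> = c G" using False fin by (simp add: cone_def sg_insert)
    finally show ?thesis .
  next
    case True
    define H where "H = G - {v}"
    have H: "G = insert v H" "v \<notin> H" "finite H" using True fin by (auto simp: H_def)
    have "bd U (cone v c) G = (\<Sum>w\<in>U - G. - sg v H * (sg w H * c (insert w H)))"
      unfolding bd_def
    proof (rule sum.cong[OF refl])
      fix w assume "w \<in> U - G"
      then have w: "w \<noteq> v" "w \<notin> H" using H by auto
      have "insert w G - {v} = insert w H" using w H by auto
      then have "sg w G * cone v c (insert w G) = (sg w (insert v H) * sg v (insert w (insert v H))) * c (insert w H)"
        using H by (simp add: cone_def mult.assoc)
      also have "sg v (insert w (insert v H)) = (sg v (insert w H) :: 'k)"
        using sg_insert[of "insert w H" v v, where 'b = 'k] w H by (simp add: insert_commute)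
      also have "sg w (insert v H) * sg v (insert w H) = - (sg v H * sg w H :: 'k)"
        using w H by (cases v w rule: linorder_cases) (auto simp: sg_insert mult.commute)
      finally show "sg w G * cone v c (insert w G) = - sg v H * (sg w H * c (insert w H))"
        by (simp add: mult.assoc)
    qed
    also have "\<dots> = - sg v H * (\<Sum>w\<in>U - G. sg w H * c (insert w H))"
      by (simp only: sum_distrib_left)
    also have "(\<Sum>w\<in>U - G. sg w H * c (insert w H)) = - (sg v H * c G)"
    proof -
      have "U - H = insert v (U - G)" using H assms(2) by auto
      then have "bd U c H = (\<Sum>w\<in>insert v (U - G). sg w H * c (insert w H))"
        by (simp only: bd_def)
      also have "\<dots> = sg v H * c (insert v H) + (\<Sum>w\<in>U - G. sg w H * c (insert w H))"
        by (rule sum.insert) (use assms(1) True in auto)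
      finally have "bd U c H = sg v H * c G + (\<Sum>w\<in>U - G. sg w H * c (insert w H))"
        by (simp only: H(1))
      then show ?thesis using assms(4) by (simp add: eq_neg_iff_add_eq_0 add.commute)
    qed
    finally show ?thesis by simp
  qed
qed

lemma bd_bd:
  fixes c :: "'v::linorder set \<Rightarrow> 'k::comm_ring_1"
  assumes "finite U" "\<forall>A. c A \<noteq> 0 \<longrightarrow> finite A"
  shows "bd U (bd U c) G = 0"
proof (cases "finite G")
  case False
  then have "c (insert v (insert w G)) = 0" for v w using assms(2) by (metis finite_insert)
  then show ?thesis by (simp add: bd_def)
next
  case True
  define f where "f = (\<lambda>(w, v). sg w G * (sg v (insert w G) * c (insert v (insert w G))))"
  define P where "P = {(w, v). w \<in> U - G \<and> v \<in> U - G \<and> w < v}"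
  define Q where "Q = {(w, v). w \<in> U - G \<and> v \<in> U - G \<and> v < w}"
  have fin: "finite P" "finite Q"
    using finite_subset[of P "U \<times> U"] finite_subset[of Q "U \<times> U"] assms(1) by (auto simp: P_def Q_def)
  have "bd U (bd U c) G = (\<Sum>w\<in>U - G. \<Sum>v\<in>U - insert w G. f (w, v))"
    by (simp add: bd_def f_def sum_distrib_left)
  also have "\<dots> = sum f (SIGMA w:U - G. U - insert w G)"
    using assms(1) by (subst sum.Sigma) auto
  also have "(SIGMA w:U - G. U - insert w G) = P \<union> Q"
    unfolding P_def Q_def by auto
  also have "sum f (P \<union> Q) = sum f P + sum f Q"
    by (rule sum.union_disjoint[OF fin]) (auto simp: P_def Q_def)
  also have "sum f Q = (\<Sum>x\<in>P. - f x)"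
  proof (rule sum.reindex_bij_witness[where i = "\<lambda>(w, v). (v, w)" and j = "\<lambda>(w, v). (v, w)"])
    fix x assume "x \<in> Q"
    then obtain w v where x: "x = (w, v)" "w \<notin> G" "v \<notin> G" "v < w" by (auto simp: Q_def)
    have "sg v G * sg w (insert v G) = - (sg w G * sg v (insert w G) :: 'k)"
      using sg_swap[OF True x(2,3)] x(4) by auto
    then have "sg v G * sg w (insert v G) * c (insert v (insert w G)) =
        - (sg w G * sg v (insert w G)) * c (insert v (insert w G))"
      by (rule arg_cong)
    then show "- f (case x of (w, v) \<Rightarrow> (v, w)) = f x"
      by (simp add: f_def x(1) insert_commute mult.assoc)
  qed (auto simp: P_def Q_def)
  also have "sum f P + (\<Sum>x\<in>P. - f x) = 0" by (simp add: sum_negf)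
  finally show ?thesis .
qed

lemma bd_diff: "bd U (\<lambda>A. c A - e A) G = bd U c G - bd U e G"
  by (simp add: bd_def sum_subtractf right_diff_distrib)

lemma exact_at_cone:
  fixes k :: "'k::comm_ring_1 itself" and U :: "'v::linorder set"
  assumes "finite U" "v \<in> U" "\<forall>F\<in>K. finite F \<and> insert v F \<in> K"
  shows "exact_at k U K a"
  unfolding exact_at_def
proof (intro allI impI)
  fix c :: "'v set \<Rightarrow> 'k"
  assume c: "chain K a c" "\<forall>G. bd U c G = 0"
  have "chain K (Suc a) (cone v c)"
    unfolding chain_def
  proof (intro allI impI)
    fix A assume "cone v c A \<noteq> 0"
    then have A: "v \<in> A" "c (A - {v}) \<noteq> 0" by (auto simp: cone_def split: if_splits)
    then have "A - {v} \<in> K" "card (A - {v}) = a" using c(1) by (auto simp: chain_def)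
    then show "A \<in> K \<and> card A = Suc a"
      using assms(3) A(1) by (metis card_Suc_Diff1 finite_Diff2 finite.emptyI finite.insertI insert_Diff)
  qed
  moreover have "\<forall>G. bd U (cone v c) G = c G"
    using bd_cone[OF assms(1,2) _ c(2)] c(1) assms(3) unfolding chain_def by blast
  ultimately show "\<exists>e. chain K (Suc a) e \<and> (\<forall>G. bd U e G = c G)" by blast
qed

section \<open>Contractions by linear forms, and stresses on cones\<close>

definition th :: "'v set \<Rightarrow> ('v \<Rightarrow> 'k::field) \<Rightarrow> ('v multiset \<Rightarrow> 'k) \<Rightarrow> 'v multiset \<Rightarrow> 'k" where
  "th U q c m = (\<Sum>v\<in>U. q v * c (add_mset v m))"

lemma th_0 [simp]: "th U q (\<lambda>_. 0) m = 0"
  by (simp add: th_def)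

lemma th_nonzeroD: "th U q c m \<noteq> 0 \<Longrightarrow> \<exists>v. c (add_mset v m) \<noteq> 0"
  by (rule ccontr) (simp add: th_def)

lemma th_diff: "th U q (\<lambda>m. c m - e m) \<nu> = th U q c \<nu> - th U q e \<nu>"
  by (simp add: th_def sum_subtractf right_diff_distrib)

lemma th_commute: "th U q (th U q' c) m = th U q' (th U q c) m"
proof -
  have "th U q (th U q' c) m = (\<Sum>v\<in>U. \<Sum>w\<in>U. q v * (q' w * c (add_mset w (add_mset v m))))"
    by (simp add: th_def sum_distrib_left)
  also have "\<dots> = (\<Sum>w\<in>U. \<Sum>v\<in>U. q v * (q' w * c (add_mset w (add_mset v m))))"
    by (rule sum.swap)
  also have "\<dots> = th U q' (th U q c) m"
    unfolding th_def sum_distrib_left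
    by (intro sum.cong refl) (simp add: add_mset_commute mult.left_commute)
  finally show ?thesis .
qed

text \<open>Monomials are multisets of vertices; \<open>th U q\<close> is the contraction by the linear form with
  coefficients \<open>q\<close>. The stresses for \<open>t\<close> linear forms are dual to the degree \<open>b\<close> part of the
  Stanley--Reisner ring modulo these forms, so surjectivity of the next contraction is dual to
  regularity of the next form.\<close>

definition stress :: "'v set \<Rightarrow> (nat \<Rightarrow> 'v \<Rightarrow> 'k::field) \<Rightarrow> nat \<Rightarrow> 'v set set \<Rightarrow> nat \<Rightarrow> ('v multiset \<Rightarrow> 'k) \<Rightarrow> bool" where
  "stress U p t K b c \<longleftrightarrow> (\<forall>m. c m \<noteq> 0 \<longrightarrow> set_mset m \<in> K \<and> size m = b) \<and> (\<forall>s<t. \<forall>m. th U (p s) c m = 0)"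

definition coregular :: "'v set \<Rightarrow> (nat \<Rightarrow> 'v \<Rightarrow> 'k::field) \<Rightarrow> nat \<Rightarrow> 'v set set \<Rightarrow> bool" where
  "coregular U p d K \<longleftrightarrow> (\<forall>t<d. \<forall>b y. stress U p t K b y \<longrightarrow>
     (\<exists>x. stress U p t K (Suc b) x \<and> (\<forall>m. th U (p t) x m = y m)))"

text \<open>The first \<open>card F\<close> forms have an invertible matrix of values on F. For a
  vertex this says that p 0 does not vanish there, so p 0 can be eliminated at any apex, and the
  condition passes to the remaining forms on the link.\<close>

definition general_position :: "(nat \<Rightarrow> 'v \<Rightarrow> 'k::field) \<Rightarrow> 'v set set \<Rightarrow> bool" where
  "general_position p K \<longleftrightarrow> (\<forall>F\<in>K. \<forall>l. (\<forall>s<card F. (\<Sum>u\<in>F. l u * p s u) = 0) \<longrightarrow> (\<forall>u\<in>F. l u = 0))"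

text \<open>For m free of v, index e gives the value of the solution x at v^e * m. It comes from
  solving \<open>th U q x = y\<close> at the monomial with one v less for the term of v, dividing by
  q v; the values c at e = 0 are free.\<close>

primrec cone_ext :: "'v set \<Rightarrow> ('v \<Rightarrow> 'k::field) \<Rightarrow> 'v \<Rightarrow> ('v multiset \<Rightarrow> 'k) \<Rightarrow> ('v multiset \<Rightarrow> 'k) \<Rightarrow> nat \<Rightarrow> 'v multiset \<Rightarrow> 'k" where
  "cone_ext U q v y c 0 = c"
| "cone_ext U q v y c (Suc e) = (\<lambda>m. (y (m + replicate_mset e v) -
     (\<Sum>u\<in>U - {v}. q u * cone_ext U q v y c e (add_mset u m))) / q v)"

lemma cone_extension:
  fixes q :: "'v \<Rightarrow> 'k::field"
  assumes "finite U" "v \<in> U" "q v \<noteq> 0" "scomplex T" "\<forall>F\<in>T. insert v F \<in> T"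
    and y: "\<forall>m. y m \<noteq> 0 \<longrightarrow> set_mset m \<in> T \<and> size m = b"
    and c: "\<forall>m. c m \<noteq> 0 \<longrightarrow> set_mset m \<in> T \<and> size m = Suc b"
  shows "\<exists>x. (\<forall>m. x m \<noteq> 0 \<longrightarrow> set_mset m \<in> T \<and> size m = Suc b) \<and>
    (\<forall>m. th U q x m = y m) \<and> (\<forall>m. v \<notin># m \<longrightarrow> x m = c m)"
proof -
  let ?X = "cone_ext U q v y c"
  define x where "x m = ?X (count m v) (filter_mset (\<lambda>u. u \<noteq> v) m)" for m
  have dec: "filter_mset (\<lambda>u. u \<noteq> v) m + replicate_mset (count m v) v = m" for m
    by (rule multiset_eqI) auto
  have supp: "set_mset m \<in> T \<and> size m + e = Suc b" if "?X e m \<noteq> 0" for e m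
    using that
  proof (induction e arbitrary: m)
    case 0
    then show ?case using c by auto
  next
    case (Suc e)
    then consider "y (m + replicate_mset e v) \<noteq> 0"
      | "(\<Sum>u\<in>U - {v}. q u * ?X e (add_mset u m)) \<noteq> 0" by (cases "y (m + replicate_mset e v) = 0") auto
    then show ?case
    proof cases
      case 1
      then have "set_mset (m + replicate_mset e v) \<in> T" "size (m + replicate_mset e v) = b" using y by blast+
      then show ?thesis using subface[OF assms(4)] by (auto simp: set_mset_union)
    next
      case 2
      then obtain u where "?X e (add_mset u m) \<noteq> 0" by (metis (no_types, lifting) mult_zero_right sum.neutral)
      from Suc.IH[OF this] show ?thesis
        using subface[OF assms(4), of "set_mset (add_mset u m)" "set_mset m"] by auto
    qed
  qed
  have "set_mset m \<in> T \<and> size m = Suc b" if "x m \<noteq> 0" for m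
  proof -
    let ?\<nu> = "filter_mset (\<lambda>u. u \<noteq> v) m"
    have *: "set_mset ?\<nu> \<in> T" "size ?\<nu> + count m v = Suc b" 
      using supp[of "count m v" ?\<nu>] that unfolding x_def by blast+
    have "size m = size ?\<nu> + count m v" using dec[of m] by (metis size_replicate_mset size_union)
    moreover have "set_mset m \<subseteq> insert v (set_mset ?\<nu>)" by auto
    ultimately show ?thesis using * assms(5) subface[OF assms(4)] by metis
  qed
  moreover have "th U q x m = y m" for m
  proof -
    let ?\<nu> = "filter_mset (\<lambda>u. u \<noteq> v) m" and ?e = "count m v"
    have "th U q x m = q v * x (add_mset v m) + (\<Sum>u\<in>U - {v}. q u * x (add_mset u m))"
      unfolding th_def by (rule sum.remove[OF assms(1,2)])
    also have "(\<Sum>u\<in>U - {v}. q u * x (add_mset u m)) = (\<Sum>u\<in>U - {v}. q u * ?X ?e (add_mset u ?\<nu>))"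
      by (rule sum.cong) (auto simp: x_def)
    also have "x (add_mset v m) = (y m - (\<Sum>u\<in>U - {v}. q u * ?X ?e (add_mset u ?\<nu>))) / q v"
      using dec[of m] by (simp add: x_def)
    finally show ?thesis using assms(3) by simp
  qed
  moreover have "x m = c m" if "v \<notin># m" for m
  proof -
    have "count m v = 0" using that by (simp add: not_in_iff)
    then show ?thesis using dec[of m] by (simp add: x_def)
  qed
  ultimately show ?thesis by blast
qed

lemma cone_unique:
  fixes q :: "'v \<Rightarrow> 'k::field"
  assumes "finite U" "v \<in> U" "q v \<noteq> 0" "\<forall>m. th U q x m = 0" "\<forall>m. v \<notin># m \<longrightarrow> x m = 0"
  shows "x m = 0"
proof (induction "count m v" arbitrary: m)
  case 0
  then show ?case using assms(5) by (simp add: not_in_iff)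
next
  case (Suc e)
  then obtain \<nu> where \<nu>: "m = add_mset v \<nu>" by (metis count_eq_zero_iff mset_add nat.distinct(1))
  have "th U q x \<nu> = q v * x (add_mset v \<nu>) + (\<Sum>u\<in>U - {v}. q u * x (add_mset u \<nu>))"
    unfolding th_def by (rule sum.remove[OF assms(1,2)])
  also have "(\<Sum>u\<in>U - {v}. q u * x (add_mset u \<nu>)) = 0"
    by (rule sum.neutral) (use Suc \<nu> in auto)
  finally show ?case using assms(3,4) \<nu> by simp
qed

definition project :: "'v \<Rightarrow> (nat \<Rightarrow> 'v \<Rightarrow> 'k::field) \<Rightarrow> nat \<Rightarrow> 'v \<Rightarrow> 'k" where
  "project v p s u = p (Suc s) u - p (Suc s) v / p 0 v * p 0 u"

text \<open>On a cone with apex \<open>v\<close>, a stress for the first form is determined by its restriction to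
  monomials without \<open>v\<close>; the other forms then act as their combinations with the first one
  that vanish at \<open>v\<close>.\<close>

lemma coregular_cone:
  fixes p :: "nat \<Rightarrow> 'v \<Rightarrow> 'k::field"
  assumes "finite U" "v \<in> U" "p 0 v \<noteq> 0" "scomplex T" "\<forall>F\<in>T. insert v F \<in> T"
    and L: "coregular U (project v p) d (deletion T {v})"
  shows "coregular U p (Suc d) T"
  unfolding coregular_def
proof (intro allI impI)
  fix t b y assume t: "t < Suc d" and y: "stress U p t T b y"
  note ext = cone_extension[of U v "p 0" T, OF assms(1,2,3,4,5)]
  have ysupp: "\<forall>m. y m \<noteq> 0 \<longrightarrow> set_mset m \<in> T \<and> size m = b" using y by (auto simp: stress_def)
  show "\<exists>x. stress U p t T (Suc b) x \<and> (\<forall>m. th U (p t) x m = y m)"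
  proof (cases t)
    case 0
    then show ?thesis using ext[OF ysupp, of "\<lambda>_. 0"] by (auto simp: stress_def)
  next
    case (Suc t')
    have p0: "p (Suc s) v / p 0 v * p 0 v = p (Suc s) v" for s using assms(3) by simp
    \<comment> \<open>The projected form vanishes at v, so it does not notice that entries divisible
      by v are set to zero; on the other monomials it acts as a combination of p (s + 1) and p
      0.\<close>
    have proj: "th U (project v p s) (\<lambda>m. if v \<in># m then 0 else z m) m =
        (if v \<in># m then 0 else th U (p (Suc s)) z m - p (Suc s) v / p 0 v * th U (p 0) z m)" for s z m
    proof (cases "v \<in># m")
      case False
      have "th U (project v p s) (\<lambda>m. if v \<in># m then 0 else z m) m =
          (\<Sum>u\<in>U. (p (Suc s) u - p (Suc s) v / p 0 v * p 0 u) * z (add_mset u m))"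
        unfolding th_def by (rule sum.cong) (use False p0 in \<open>auto simp: project_def\<close>)
      then show ?thesis using False
        by (simp add: th_def left_diff_distrib sum_subtractf sum_distrib_left mult.assoc)
    qed (simp add: th_def)
    let ?y = "\<lambda>m. if v \<in># m then 0 else y m"
    have t': "t' < d" using t Suc by simp
    have sy: "stress U (project v p) t' (deletion T {v}) b ?y"
      unfolding stress_def proj using ysupp y Suc by (auto simp: stress_def deletion_def)
    obtain x' where x': "stress U (project v p) t' (deletion T {v}) (Suc b) x'"
      "\<forall>m. th U (project v p t') x' m = ?y m"
      using L[unfolded coregular_def, rule_format, OF t' sy] by blast
    have x's: "x' m \<noteq> 0 \<Longrightarrow> v \<notin># m \<and> set_mset m \<in> T \<and> size m = Suc b" for m
      using x'(1) by (auto simp: stress_def deletion_def)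
    obtain x where x: "\<forall>m. x m \<noteq> 0 \<longrightarrow> set_mset m \<in> T \<and> size m = Suc b"
      "\<forall>m. th U (p 0) x m = 0" "\<forall>m. v \<notin># m \<longrightarrow> x m = x' m"
      using ext[of "\<lambda>_. 0" b x'] x's by auto
    have rx: "(\<lambda>m. if v \<in># m then 0 else x m) = x'"
      using x(3) x's by fastforce
    have th_th: "th U (p 0) (th U (p s) x) m = 0" for s m
    proof -
      have "th U (p 0) x = (\<lambda>_. 0)" using x(2) by auto
      then show ?thesis by (subst th_commute) simp
    qed
    have restr: "v \<notin># m \<Longrightarrow> th U (p (Suc s)) x m = th U (project v p s) x' m" for s m
      using proj[of s x m] rx x(2) by simp
    have "th U (p s) x m = 0" if "s < t" for s m
    proof (cases s)
      case 0
      then show ?thesis using x(2) by simp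
    next
      case (Suc s')
      have "\<forall>m. th U (project v p s') x' m = 0" using x'(1) that Suc \<open>t = Suc t'\<close> by (auto simp: stress_def)
      then show ?thesis
        using restr Suc by (intro cone_unique[OF assms(1,2), of "p 0"]) (use assms(3) th_th in auto)
    qed
    \<comment> \<open>Both stresses are killed by p 0 and agree on monomials without v;
      \<open>cone_unique\<close> makes them equal everywhere.\<close>
    moreover have "th U (p t) x m - y m = 0" for m
    proof (rule cone_unique[OF assms(1,2), of "p 0"])
      have "th U (p 0) y m = 0" for m using y Suc by (auto simp: stress_def)
      then show "\<forall>m. th U (p 0) (\<lambda>m. th U (p t) x m - y m) m = 0"
        using th_th[of t] by (simp add: th_diff)
      show "\<forall>m. v \<notin># m \<longrightarrow> th U (p t) x m - y m = 0"
        using restr[of _ t'] x'(2) Suc by simp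
    qed (rule assms(3))
    ultimately show ?thesis using x(1) by (auto simp: stress_def)
  qed
qed

section \<open>The partition complex\<close>

definition stress_chain :: "'v set \<Rightarrow> (nat \<Rightarrow> 'v \<Rightarrow> 'k::field) \<Rightarrow> nat \<Rightarrow> 'v set set \<Rightarrow> nat \<Rightarrow> nat \<Rightarrow>
    ('v set \<Rightarrow> 'v multiset \<Rightarrow> 'k) \<Rightarrow> bool" where
  "stress_chain U p t K a b C \<longleftrightarrow>
     (\<forall>A m. C A m \<noteq> 0 \<longrightarrow> card A = a \<and> A \<union> set_mset m \<in> K \<and> size m = b) \<and>
     (\<forall>s<t. \<forall>A m. th U (p s) (C A) m = 0)"

lemma bd_th:
  "bd U (\<lambda>A. th U q (C A) m) G = th U q (\<lambda>\<nu>. bd U (\<lambda>A. C A \<nu>) G) m"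
proof -
  have "bd U (\<lambda>A. th U q (C A) m) G =
      (\<Sum>w\<in>U - G. \<Sum>v\<in>U. sg w G * (q v * C (insert w G) (add_mset v m)))"
    by (simp add: bd_def th_def sum_distrib_left)
  also have "\<dots> = (\<Sum>v\<in>U. \<Sum>w\<in>U - G. sg w G * (q v * C (insert w G) (add_mset v m)))"
    by (rule sum.swap)
  also have "\<dots> = th U q (\<lambda>\<nu>. bd U (\<lambda>A. C A \<nu>) G) m"
    unfolding th_def bd_def sum_distrib_left
    by (intro sum.cong refl) (simp add: mult.left_commute)
  finally show ?thesis .
qed

lemma stress_chain_finite:
  assumes "scomplex K" "stress_chain U p t K a b C" "C A m \<noteq> 0"
  shows "finite A"
  using assms finite_face[OF assms(1), of "A \<union> set_mset m"] by (auto simp: stress_chain_def)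

lemma stress_chain_bd:
  assumes "scomplex K" "stress_chain U p t K (Suc a) b C"
  shows "stress_chain U p t K a b (\<lambda>G m. bd U (\<lambda>A. C A m) G)"
  unfolding stress_chain_def
proof (intro conjI allI impI)
  fix G m assume "bd U (\<lambda>A. C A m) G \<noteq> 0"
  then obtain w where w: "w \<in> U - G" "C (insert w G) m \<noteq> 0"
    unfolding bd_def by (metis (no_types, lifting) mult_zero_right sum.neutral)
  then have *: "card (insert w G) = Suc a" "insert w G \<union> set_mset m \<in> K" "size m = b"
    using assms(2) unfolding stress_chain_def by blast+
  have "finite G" using stress_chain_finite[OF assms w(2)] by simp
  then show "card G = a" using *(1) w(1) by simp
  show "G \<union> set_mset m \<in> K" using subface[OF assms(1) *(2)] by blast
  show "size m = b" by fact
next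
  fix s A m assume "s < t"
  then have "th U (p s) (C B) = (\<lambda>_. 0)" for B using assms(2) by (auto simp: stress_chain_def)
  then show "th U (p s) (\<lambda>m. bd U (\<lambda>A. C A m) A) m = 0"
    unfolding bd_th[symmetric] by (simp add: bd_def)
qed

lemma stress_chain_exact_0:
  fixes C :: "'v::linorder set \<Rightarrow> 'v multiset \<Rightarrow> 'k::field"
  assumes "finite U" "scomplex K" "\<Union>K \<subseteq> U" "cm TYPE('k) U d K" "a < d"
    and C: "stress_chain U p 0 K a b C" "\<forall>G m. bd U (\<lambda>A. C A m) G = 0"
  shows "\<exists>E. stress_chain U p 0 K (Suc a) b E \<and> (\<forall>G m. bd U (\<lambda>A. E A m) G = C G m)"
proof -
  have "\<exists>e::'v set \<Rightarrow> 'k. (\<forall>A. e A \<noteq> 0 \<longrightarrow> card A = Suc a \<and> A \<union> set_mset m \<in> K \<and> size m = b) \<and>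
      (\<forall>G. bd U e G = C G m)" for m
  proof (cases "\<exists>A. C A m \<noteq> 0")
    case False
    then show ?thesis by (intro exI[of _ "\<lambda>_. 0"]) (simp add: bd_def)
  next
    case True
    then obtain B where B: "C B m \<noteq> 0" by blast
    then have *: "B \<union> set_mset m \<in> K" "size m = b" using C(1) by (auto simp: stress_chain_def)
    \<comment> \<open>The closed star of the support of m: a cone with any vertex of m as apex,
      unless m is the empty monomial, when it is K.\<close>
    let ?T = "{A. A \<union> set_mset m \<in> K}"
    have "exact_at TYPE('k) U ?T a"
    proof (cases "m = {#}")
      case True
      then show ?thesis using assms(4,5) scomplex_empty[OF assms(2)] by (fastforce simp: cm_def)
    next
      case False
      then obtain v where v: "v \<in># m" by blast
      then have "v \<in> U" using * assms(3) by blast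
      then show ?thesis
        using v finite_face[OF assms(2)]
        by (intro exact_at_cone[OF assms(1)]) (auto simp: insert_absorb)
    qed
    moreover have "chain ?T a (\<lambda>A. C A m)" using C(1) by (auto simp: chain_def stress_chain_def)
    ultimately obtain e where "chain ?T (Suc a) e" "\<forall>G. bd U e G = C G m"
      using C(2) unfolding exact_at_def by blast
    then show ?thesis using *(2) unfolding chain_def by blast
  qed
  then obtain e where e: "\<And>m. (\<forall>A. e m A \<noteq> 0 \<longrightarrow> card A = Suc a \<and> A \<union> set_mset m \<in> K \<and> size m = b) \<and>
      (\<forall>G. bd U (e m) G = C G m)" by metis
  then show ?thesis
    by (intro exI[of _ "\<lambda>A m. e m A"]) (auto simp: stress_chain_def)
qed

text \<open>Lifting is done separately on the star of each A, with zero where W A vanishes. Chains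
  on the empty set are excluded: its star is K, whose coregularity is the aim of the
  induction.\<close>

lemma stress_chain_lift:
  fixes W :: "'v::linorder set \<Rightarrow> 'v multiset \<Rightarrow> 'k::field"
  assumes sc: "scomplex K" and W: "stress_chain U p t K (Suc a) b W" and "t < d"
    and star: "\<And>A. A \<in> K \<Longrightarrow> A \<noteq> {} \<Longrightarrow> coregular U p d (closed_star K A)"
  obtains X where "stress_chain U p t K (Suc a) (Suc b) X" "\<And>A m. th U (p t) (X A) m = W A m"
proof -
  have "\<exists>x. stress U p t (closed_star K A) (Suc b) x \<and> (\<forall>m. th U (p t) x m = W A m) \<and>
      ((\<exists>m. x m \<noteq> 0) \<longrightarrow> card A = Suc a)" for A
  proof (cases "\<exists>m. W A m \<noteq> 0")
    case False
    then show ?thesis by (intro exI[of _ "\<lambda>_. 0"]) (simp add: stress_def)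
  next
    case True
    then obtain m where m: "W A m \<noteq> 0" by blast
    then have *: "card A = Suc a" "A \<union> set_mset m \<in> K" using W unfolding stress_chain_def by blast+
    then have "A \<in> K" "A \<noteq> {}" using subface[OF sc *(2)] by auto
    moreover have "stress U p t (closed_star K A) b (W A)"
      using W by (auto simp: stress_def stress_chain_def closed_star_iff[OF sc] Un_commute)
    ultimately show ?thesis
      using star[of A, unfolded coregular_def, rule_format, of t b "W A"] \<open>t < d\<close> *(1) by auto
  qed
  then obtain X where X: "\<And>A. stress U p t (closed_star K A) (Suc b) (X A)" "\<And>A m. th U (p t) (X A) m = W A m"
    "\<And>A m. X A m \<noteq> 0 \<Longrightarrow> card A = Suc a" by metis
  have "stress_chain U p t K (Suc a) (Suc b) X"
    using X(1,3) by (auto simp: stress_def stress_chain_def closed_star_iff[OF sc] Un_commute)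
  then show ?thesis using X(2) that by blast
qed

text \<open>The partition complex: stresses on the closed stars of the faces \<open>A\<close> with \<open>a\<close> vertices, with
  the simplicial boundary acting on \<open>A\<close>. Without linear forms its rows are chain complexes of
  cones, except in degree 0, where acyclicity of \<open>K\<close> enters. Each linear form is surjective on
  stars, and the long exact sequence costs one step of exactness; exactness at \<open>a = 0\<close> lifts
  surjectivity from the stars to \<open>K\<close>.\<close>

lemma stress_chain_exact:
  fixes C :: "'v::linorder set \<Rightarrow> 'v multiset \<Rightarrow> 'k::field"
  assumes "finite U" "scomplex K" "\<Union>K \<subseteq> U" "cm TYPE('k) U d K"
    and star: "\<And>A. A \<in> K \<Longrightarrow> A \<noteq> {} \<Longrightarrow> coregular U p d (closed_star K A)"
    and "a + t < d" and "stress_chain U p t K a b C" "\<forall>G m. bd U (\<lambda>A. C A m) G = 0"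
  shows "\<exists>E. stress_chain U p t K (Suc a) b E \<and> (\<forall>G m. bd U (\<lambda>A. E A m) G = C G m)"
  using assms(6-8)
proof (induction t arbitrary: a b C)
  case 0
  then show ?case using stress_chain_exact_0[OF assms(1-4), of a p b C] by simp
next
  case (Suc t)
  show ?case
  \<comment> \<open>In degree 0 all contractions vanish and the forms impose no condition; the case
    is separate because D below has degree b - 1.\<close>
  proof (cases b)
    case 0
    have "th U q (E A) m = 0" if "stress_chain U p t K a' 0 E" for q E A m a' and t :: nat
    proof -
      have "E A (add_mset v m) = 0" for v
        using that unfolding stress_chain_def by (metis Zero_not_Suc size_add_mset)
      then show ?thesis by (simp add: th_def)
    qed
    then have eq: "stress_chain U p t K a' 0 E \<longleftrightarrow> stress_chain U p 0 K a' 0 E" for a' E and t :: nat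
      unfolding stress_chain_def by (metis not_less_zero)
    show ?thesis
      using stress_chain_exact_0[OF assms(1-4), of a p b C] Suc.prems unfolding 0 eq[of "Suc t"] by simp
  next
    case b: (Suc b')
    have mono: "stress_chain U p t K a b C" using Suc.prems(2) by (auto simp: stress_chain_def)
    obtain E where E: "stress_chain U p t K (Suc a) b E" "\<forall>G m. bd U (\<lambda>A. E A m) G = C G m"
      using Suc.IH[OF _ mono Suc.prems(3)] Suc.prems(1) by auto
    \<comment> \<open>The diagram chase: D is a cycle because p t kills C, so it bounds some W one
      step up. W lifts through p t to X on the stars, and E minus the boundary of X still has
      boundary C but is killed by p t.\<close>
    define D where "D A = th U (p t) (E A)" for A
    have "stress_chain U p t K (Suc a) b' D"
      unfolding stress_chain_def
    proof (intro conjI allI impI)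
      fix A m assume "D A m \<noteq> 0"
      then obtain v where "E A (add_mset v m) \<noteq> 0"
        unfolding D_def by (blast dest: th_nonzeroD)
      then have *: "card A = Suc a" "A \<union> set_mset (add_mset v m) \<in> K" "size (add_mset v m) = b"
        using E(1) unfolding stress_chain_def by blast+
      show "card A = Suc a" by fact
      show "A \<union> set_mset m \<in> K" using subface[OF assms(2) *(2)] by auto
      show "size m = b'" using *(3) b by simp
    next
      fix s A m assume "s < t"
      then have "th U (p s) (E A) = (\<lambda>_. 0)" using E(1) by (auto simp: stress_chain_def)
      then show "th U (p s) (D A) m = 0" unfolding D_def by (subst th_commute) simp
    qed
    moreover have "\<forall>G m. bd U (\<lambda>A. D A m) G = 0"
      unfolding D_def bd_th using E(2) Suc.prems(2) by (simp add: stress_chain_def)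
    ultimately obtain W where W: "stress_chain U p t K (Suc (Suc a)) b' W" "\<forall>G m. bd U (\<lambda>A. W A m) G = D G m"
      using Suc.IH[of "Suc a" b' D] Suc.prems(1) by auto
    obtain X where Xs: "stress_chain U p t K (Suc (Suc a)) b X" and X: "\<And>A m. th U (p t) (X A) m = W A m"
      using stress_chain_lift[OF assms(2) W(1) _ star] Suc.prems(1) b by auto
    note bX = stress_chain_bd[OF assms(2) Xs]
    define Y where "Y A m = E A m - bd U (\<lambda>B. X B m) A" for A m
    have thY: "th U q (Y A) m = th U q (E A) m - th U q (\<lambda>m. bd U (\<lambda>B. X B m) A) m" for q A m
      unfolding Y_def th_diff ..
    have "stress_chain U p (Suc t) K (Suc a) b Y"
      unfolding stress_chain_def
    proof (intro conjI allI impI)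
      fix A m assume "Y A m \<noteq> 0"
      then have "E A m \<noteq> 0 \<or> bd U (\<lambda>B. X B m) A \<noteq> 0" by (auto simp: Y_def)
      then have "card A = Suc a \<and> A \<union> set_mset m \<in> K \<and> size m = b"
        using E(1) bX unfolding stress_chain_def by blast
      then show "card A = Suc a" "A \<union> set_mset m \<in> K" "size m = b" by blast+
    next
      fix s A m assume "s < Suc t"
      then consider "s < t" | "s = t" by linarith
      then show "th U (p s) (Y A) m = 0"
      proof cases
        case 1
        then show ?thesis using E(1) bX unfolding thY stress_chain_def by simp
      next
        case 2
        have "th U (p t) (\<lambda>m. bd U (\<lambda>B. X B m) A) m = D A m"
          unfolding bd_th[symmetric] using X W(2) by simp
        then show ?thesis unfolding thY 2 D_def by simp
      qed
    qed
    moreover have "bd U (\<lambda>A. Y A m) G = C G m" for G m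
    proof -
      have "bd U (bd U (\<lambda>B. X B m)) G = 0"
        using stress_chain_finite[OF assms(2) Xs] by (intro bd_bd[OF assms(1)]) blast
      then show ?thesis using E(2) unfolding Y_def bd_diff by simp
    qed
    ultimately show ?thesis by blast
  qed
qed

section \<open>General position and the induction on the dimension\<close>

lemma general_position_vertex:
  assumes "general_position p K" "{v} \<in> K"
  shows "p 0 v \<noteq> 0"
proof
  assume "p 0 v = 0"
  then have "\<forall>s<card {v}. (\<Sum>u\<in>{v}. 1 * p s u) = 0" by simp
  then have "\<forall>u\<in>{v}. (1::'b) = 0"
    using assms unfolding general_position_def by (elim ballE[of _ _ "{v}"] allE[of _ "\<lambda>_. 1"]) auto
  then show False by simp
qed

text \<open>A linear relation for the projected forms on F extends to one for the original forms on
  \<open>insert v F\<close>, the coefficient at v being chosen so that p 0 is annihilated.\<close>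

lemma general_position_project:
  fixes p :: "nat \<Rightarrow> 'v \<Rightarrow> 'k::field"
  assumes "general_position p K" "p 0 v \<noteq> 0"
    and L: "\<forall>F\<in>L. finite F \<and> v \<notin> F \<and> insert v F \<in> K"
  shows "general_position (project v p) L"
  unfolding general_position_def
proof (intro ballI allI impI)
  fix F l u assume F: "F \<in> L" and l: "\<forall>s<card F. (\<Sum>u\<in>F. l u * project v p s u) = 0" and u: "u \<in> F"
  have F': "finite F" "v \<notin> F" "insert v F \<in> K" using L F by auto
  define l' where "l' = l(v := - (\<Sum>u\<in>F. l u * p 0 u) / p 0 v)"
  have s: "(\<Sum>u\<in>insert v F. l' u * p s u) = (\<Sum>u\<in>F. l u * p s u) - (\<Sum>u\<in>F. l u * p 0 u) / p 0 v * p s v" for s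
  proof -
    have "(\<Sum>u\<in>F. l' u * p s u) = (\<Sum>u\<in>F. l u * p s u)"
      using F'(2) by (intro sum.cong) (auto simp: l'_def)
    then show ?thesis using F' by (simp add: l'_def)
  qed
  have "(\<Sum>u\<in>insert v F. l' u * p s u) = 0" if "s < card (insert v F)" for s
  proof (cases s)
    case 0
    then show ?thesis unfolding s using assms(2) by simp
  next
    case (Suc s')
    have "(\<Sum>u\<in>F. l u * project v p s' u) = (\<Sum>u\<in>F. l u * p s u - l u * p 0 u * (p s v / p 0 v))"
      using Suc by (intro sum.cong) (auto simp: project_def algebra_simps)
    also have "\<dots> = (\<Sum>u\<in>F. l u * p s u) - (\<Sum>u\<in>F. l u * p 0 u) * (p s v / p 0 v)"
      by (simp only: sum_subtractf sum_distrib_right)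
    finally show ?thesis unfolding s using l that Suc F' by simp
  qed
  then have "\<forall>u\<in>insert v F. l' u = 0" using assms(1) F'(3) unfolding general_position_def by blast
  then show "l u = 0" using u F'(2) by (auto simp: l'_def split: if_splits)
qed

lemma cm_link:
  assumes "scomplex K" "A \<in> K" "cm k U d K"
  shows "cm k U (d - card A) (link K A)"
  unfolding cm_def
proof (intro ballI allI impI)
  fix F a assume F: "F \<in> link K A" "a + card F < d - card A"
  then have F': "A \<union> F \<in> K" "A \<inter> F = {}" by (auto simp: link_def)
  then have "card (A \<union> F) = card A + card F"
    using finite_face[OF assms(1)] by (metis card_Un_disjoint finite_Un)
  then show "exact_at k U (link (link K A) F) a"
    using assms(3) F' F(2) link_link[OF assms(1) F'(2)] unfolding cm_def by simp
qed

text \<open>If A \<subseteq> F, the link of F is the same in the star as in K. Otherwise any vertex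
  of A outside F is an apex of that link, which is then exact everywhere.\<close>

lemma cm_closed_star:
  assumes "finite U" "scomplex K" "\<Union>K \<subseteq> U" "A \<in> K" "cm k U d K"
  shows "cm k U d (closed_star K A)"
  unfolding cm_def
proof (intro ballI allI impI)
  fix F a assume F: "F \<in> closed_star K A" "a + card F < d"
  note iff = closed_star_iff[OF assms(2)]
  show "exact_at k U (link (closed_star K A) F) a"
  proof (cases "A \<subseteq> F")
    case True
    have "link (closed_star K A) F = link K F"
    proof (rule Set.set_eqI)
      fix G
      have *: "F \<union> G \<union> A = F \<union> G" using True by auto
      then have "F \<union> G \<in> K \<Longrightarrow> G \<union> A \<in> K \<and> G \<in> K"
        using subface[OF assms(2), of "F \<union> G"] True by (metis Un_commute Un_mono order_refl sup_ge2)
      with * show "G \<in> link (closed_star K A) F \<longleftrightarrow> G \<in> link K F"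
        unfolding link_def mem_Collect_eq iff by auto
    qed
    moreover have "F \<in> K" using F(1) by (simp add: closed_star_def)
    ultimately show ?thesis using assms(5) F(2) unfolding cm_def by simp
  next
    case False
    then obtain w where w: "w \<in> A" "w \<notin> F" by blast
    have wU: "w \<in> U" using w(1) assms(3,4) by blast
    show ?thesis
    proof (rule exact_at_cone[OF assms(1) wU], intro ballI conjI)
      fix G assume "G \<in> link (closed_star K A) F"
      then have G: "G \<in> closed_star K A" "F \<union> G \<in> closed_star K A" "F \<inter> G = {}" by (auto simp: link_def)
      show "finite G" using G(1) finite_face[OF assms(2)] by (auto simp: closed_star_def)
      have "insert w G \<union> A = G \<union> A" "F \<union> insert w G \<union> A = F \<union> G \<union> A" using w by auto
      then have "insert w G \<in> closed_star K A" "F \<union> insert w G \<in> closed_star K A"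
        using G unfolding iff by auto
      then show "insert w G \<in> link (closed_star K A) F" using G w by (auto simp: link_def)
    qed
  qed
qed

text \<open>The star of a nonempty A is a cone over a star in the link of a vertex v of A; induction
  applies there to the projected forms, and \<open>coregular_cone\<close> returns to the star of A.
  The partition complex then passes from stars to K.\<close>

theorem cm_coregular:
  fixes p :: "nat \<Rightarrow> 'v::linorder \<Rightarrow> 'k::field"
  assumes "finite U" "scomplex K" "\<Union>K \<subseteq> U" "cm TYPE('k) U d K" "general_position p K"
  shows "coregular U p d K"
  using assms(2-5)
proof (induction d arbitrary: K p)
  case 0
  then show ?case by (simp add: coregular_def)
next
  case (Suc d)
  note sc = \<open>scomplex K\<close>
  have star: "coregular U p (Suc d) (closed_star K A)" if A: "A \<in> K" "A \<noteq> {}" for A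
  proof -
    obtain v where v: "v \<in> A" using A by blast
    have vU: "v \<in> U" and vD: "{v} \<in> K" using v A Suc.prems(2) subface[OF sc A(1), of "{v}"] by auto
    have p0: "p 0 v \<noteq> 0" using general_position_vertex[OF Suc.prems(4) vD] .
    let ?L = "closed_star (link K {v}) (A - {v})"
    have sl: "scomplex (link K {v})" using sc vD by (rule scomplex_link)
    have vA: "insert v (A - {v}) = A" using v by auto
    have Av: "A - {v} \<in> link K {v}"
      using A(1) subface[OF sc A(1), of "A - {v}"] vA by (simp add: link_def)
    have L: "F \<in> ?L \<longleftrightarrow> v \<notin> F \<and> F \<union> A \<in> K" for F
    proof -
      have "{v} \<union> (F \<union> (A - {v})) = F \<union> A" using v by auto
      then show ?thesis
        using closed_star_iff[OF sl] subface[OF sc, of "F \<union> A" "F \<union> (A - {v})"]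
        by (auto simp: link_def)
    qed
    have eqL: "deletion (closed_star K A) {v} = ?L"
      using L closed_star_iff[OF sc] by (auto simp: deletion_def)
    have cL: "coregular U (project v p) d ?L"
    proof (rule Suc.IH)
      show sL: "scomplex ?L" using sl Av by (rule scomplex_closed_star)
      show "\<Union>?L \<subseteq> U" using Suc.prems(2) by (auto simp: link_def closed_star_def)
      show "general_position (project v p) ?L"
      proof (rule general_position_project[OF Suc.prems(4) p0], intro ballI conjI)
        fix F assume F: "F \<in> ?L"
        show "finite F" using sL F by (rule finite_face)
        show "v \<notin> F" using F L by blast
        have "insert v F \<subseteq> F \<union> A" using v by auto
        then show "insert v F \<in> K" using F L subface[OF sc] by blast
      qed
      have "cm TYPE('k) U d (link K {v})"
        using cm_link[OF sc vD Suc.prems(3)] by simp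
      then show "cm TYPE('k) U d ?L"
        using Suc.prems(2) by (intro cm_closed_star[OF assms(1) sl _ Av]) (auto simp: link_def)
    qed
    show ?thesis
    proof (rule coregular_cone[of U v p, OF assms(1) vU p0 _ _ cL[folded eqL]])
      show "scomplex (closed_star K A)" using sc A(1) by (rule scomplex_closed_star)
      show "\<forall>F\<in>closed_star K A. insert v F \<in> closed_star K A"
      proof
        fix F assume "F \<in> closed_star K A"
        moreover have "insert v F \<union> A = F \<union> A" using v by auto
        ultimately show "insert v F \<in> closed_star K A" by (simp only: closed_star_iff[OF sc])
      qed
    qed
  qed
  show ?case
    unfolding coregular_def
  proof (intro allI impI)
    fix t b y assume t: "t < Suc d" and y: "stress U p t K b y"
    \<comment> \<open>A stress on K is a chain concentrated at the empty set, hence a cycle. It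
      bounds a family E on the vertex stars; lifting E to X and taking the boundary at the empty set
      yields the preimage.\<close>
    define C where "C A m = (if A = {} then y m else 0)" for A :: "'v set" and m
    have CA: "C A = (if A = {} then y else (\<lambda>_. 0))" for A by (auto simp: C_def)
    have C: "stress_chain U p t K 0 b C"
      using y by (auto simp: stress_chain_def stress_def CA split: if_splits)
    have "\<forall>G m. bd U (\<lambda>A. C A m) G = 0" by (simp add: bd_def C_def)
    then obtain E where E: "stress_chain U p t K (Suc 0) b E" "\<forall>G m. bd U (\<lambda>A. E A m) G = C G m"
      using stress_chain_exact[OF assms(1) sc Suc.prems(2,3) star _ C] t by auto
    obtain X where Xs: "stress_chain U p t K (Suc 0) (Suc b) X" and X: "\<And>A m. th U (p t) (X A) m = E A m"
      using stress_chain_lift[OF sc E(1) t star] by blast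
    have "stress U p t K (Suc b) (\<lambda>m. bd U (\<lambda>A. X A m) {})"
      using stress_chain_bd[OF sc Xs] unfolding stress_chain_def stress_def by (metis sup_bot_left)
    moreover have "th U (p t) (\<lambda>m. bd U (\<lambda>A. X A m) {}) m = y m" for m
      unfolding bd_th[symmetric] using X E(2) by (simp add: C_def)
    ultimately show "\<exists>x. stress U p t K (Suc b) x \<and> (\<forall>m. th U (p t) x m = y m)" by blast
  qed
qed

section \<open>Stress spaces and h-numbers\<close>

context vector_space
begin

lemma dim_mono_finite:
  assumes "V \<subseteq> W" "W \<subseteq> span T" "finite T"
  shows "dim V \<le> dim W"
proof -
  obtain B where B: "B \<subseteq> V" "independent B" "V \<subseteq> span B" "card B = dim V" by (rule basis_exists)
  obtain C where C: "C \<subseteq> W" "independent C" "W \<subseteq> span C" "card C = dim W" by (rule basis_exists)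
  have "finite C" using independent_span_bound[OF assms(3) C(2)] C(1) assms(2) by auto
  then show ?thesis using independent_span_bound[OF _ B(2), of C] B C assms(1) by auto
qed

lemma span_Int_disjoint:
  assumes "independent B" "B1 \<subseteq> B" "B2 \<subseteq> B" "B1 \<inter> B2 = {}" "x \<in> span B1" "x \<in> span B2"
  shows "x = 0"
proof -
  have "representation B x b = 0" for b
  proof (rule ccontr)
    assume "representation B x b \<noteq> 0"
    then have "b \<in> B1" "b \<in> B2"
      using representation_extend[OF assms(1,5,2)] representation_extend[OF assms(1,6,3)]
        representation_ne_zero by metis+
    then show False using assms(4) by blast
  qed
  then show ?thesis
    using sum_nonzero_representation_eq[OF assms(1), of x] span_mono[OF assms(2)] assms(5) by auto
qed

text \<open>A basis of the kernel is extended to one of V; f is injective on the span of the added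
  vectors, and their images form a basis of the image.\<close>

lemma dim_kernel_image:
  assumes f: "Vector_Spaces.linear scale scale f" and V: "subspace V" "V \<subseteq> span T" "finite T"
  shows "dim V = dim {x \<in> V. f x = 0} + dim (f ` V)"
proof -
  interpret vector_space_pair scale scale ..
  define K where "K = {x \<in> V. f x = 0}"
  obtain B1 where B1: "B1 \<subseteq> K" "independent B1" "K \<subseteq> span B1" "card B1 = dim K" by (rule basis_exists)
  have "B1 \<subseteq> V" using B1(1) by (auto simp: K_def)
  then obtain B where B: "B1 \<subseteq> B" "B \<subseteq> V" "independent B" "V \<subseteq> span B"
    using B1(2) by (rule maximal_independent_subset_extend)
  have fin: "finite B" using independent_span_bound[OF V(3) B(3)] B(2) V(2) by auto
  let ?C = "B - B1"
  have spV: "span B \<subseteq> V" using B(2) V(1) by (rule span_minimal)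
  have ker: "x = 0" if x: "x \<in> span ?C" "f x = 0" for x
  proof -
    have "x \<in> V" using x(1) span_mono[of ?C B] spV by auto
    then have "x \<in> span B1" using x(2) B1(3) by (auto simp: K_def)
    then show "x = 0" using span_Int_disjoint[OF B(3) B(1), of ?C x] x(1) by auto
  qed
  have inj: "inj_on f (span ?C)"
    using ker linear_inj_on_iff_eq_0[OF f subspace_span] by blast
  have "independent (f ` ?C)"
    using linear_independent_injective_image[OF f _ inj] B(3) independent_mono by blast
  moreover have "f ` V \<subseteq> span (f ` ?C)"
  proof -
    have "f ` V \<subseteq> span (f ` B)" using B(4) by (auto simp: linear_span_image[OF f])
    also have "f ` B \<subseteq> insert 0 (f ` ?C)" using B1(1) by (auto simp: K_def)
    then have "span (f ` B) \<subseteq> span (f ` ?C)" using span_mono span_insert_0 by metis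
    finally show ?thesis .
  qed
  moreover have "f ` ?C \<subseteq> f ` V" using B(2) by auto
  ultimately have "card (f ` ?C) = dim (f ` V)" by (metis basis_card_eq_dim)
  moreover have "card (f ` ?C) = card ?C"
    by (intro card_image inj_on_subset[OF inj span_superset])
  moreover have "card B = dim V" using B by (intro basis_card_eq_dim) auto
  moreover have "card B = card B1 + card ?C"
    using fin B(1) by (metis card_Diff_subset card_mono finite_subset le_add_diff_inverse)
  ultimately show ?thesis using B1(4) by (simp add: K_def)
qed

end

definition fscale :: "'k::field \<Rightarrow> ('x \<Rightarrow> 'k) \<Rightarrow> 'x \<Rightarrow> 'k" where
  "fscale a f = (\<lambda>x. a * f x)"

interpretation fun_space: vector_space fscale
  by unfold_locales (auto simp: fscale_def fun_eq_iff algebra_simps)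

lemma
  fixes S :: "'x set"
  assumes "finite S"
  defines "V \<equiv> {c :: 'x \<Rightarrow> 'k::field. \<forall>x. c x \<noteq> 0 \<longrightarrow> x \<in> S}"
  shows dim_supported: "fun_space.dim V = card S"
    and supported_span: "\<exists>T. finite T \<and> V \<subseteq> fun_space.span T"
proof -
  define \<delta> where "\<delta> s = (\<lambda>x. if x = s then (1::'k) else 0)" for s :: 'x
  have inj: "inj_on \<delta> S" by (rule inj_onI) (metis \<delta>_def one_neq_zero)
  have ev: "(\<Sum>s\<in>S. fscale (l s) (\<delta> s)) x = (if x \<in> S then l x else 0)" for l x
  proof -
    have "(\<Sum>s\<in>S. fscale (l s) (\<delta> s)) x = (\<Sum>s\<in>S. if x = s then l s else 0)"
      unfolding \<delta>_def fscale_def by (induction S rule: infinite_finite_induct) auto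
    then show ?thesis using assms(1) by simp
  qed
  have sp: "V \<subseteq> fun_space.span (\<delta> ` S)"
  proof
    fix c assume "c \<in> V"
    then have "c = (\<Sum>s\<in>S. fscale (c s) (\<delta> s))" using ev by (auto simp: V_def fun_eq_iff)
    also have "\<dots> \<in> fun_space.span (\<delta> ` S)"
      by (intro fun_space.span_sum fun_space.span_scale fun_space.span_base) auto
    finally show "c \<in> fun_space.span (\<delta> ` S)" .
  qed
  then show "\<exists>T. finite T \<and> V \<subseteq> fun_space.span T" using assms(1) by blast
  have "fun_space.independent (\<delta> ` S)"
  proof (rule fun_space.independent_if_scalars_zero)
    fix g e assume g: "(\<Sum>x\<in>\<delta> ` S. fscale (g x) x) = 0" and "e \<in> \<delta> ` S"
    then obtain s where s: "s \<in> S" "e = \<delta> s" by blast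
    have "(\<Sum>t\<in>S. fscale (g (\<delta> t)) (\<delta> t)) = 0" using g by (simp add: sum.reindex[OF inj])
    then have "(\<Sum>t\<in>S. fscale (g (\<delta> t)) (\<delta> t)) s = 0" by simp
    then show "g e = 0" using s ev[of "\<lambda>t. g (\<delta> t)" s] by simp
  qed (use assms(1) in simp)
  moreover have "\<delta> ` S \<subseteq> V" by (auto simp: V_def \<delta>_def split: if_splits)
  ultimately show "fun_space.dim V = card S"
    using sp card_image[OF inj] by (intro fun_space.dim_unique) auto
qed

section \<open>Hilbert series of the stress spaces\<close>

lemma finite_monomials:
  assumes "finite U"
  shows "finite {m. set_mset m \<subseteq> U \<and> size m = b}"
proof (induction b)
  case 0
  have "{m. set_mset m \<subseteq> U \<and> size m = 0} \<subseteq> {{#}}" by auto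
  then show ?case by (rule finite_subset) simp
next
  case (Suc b)
  have "{m. set_mset m \<subseteq> U \<and> size m = Suc b} \<subseteq>
      (\<lambda>(u, m). add_mset u m) ` (U \<times> {m. set_mset m \<subseteq> U \<and> size m = b})"
  proof
    fix m assume m: "m \<in> {m. set_mset m \<subseteq> U \<and> size m = Suc b}"
    then obtain u \<nu> where "m = add_mset u \<nu>" by (metis (mono_tags) mem_Collect_eq size_eq_Suc_imp_eq_union)
    with m show "m \<in> (\<lambda>(u, m). add_mset u m) ` (U \<times> {m. set_mset m \<subseteq> U \<and> size m = b})"
      by auto
  qed
  then show ?case using Suc assms by (elim finite_subset) auto
qed

definition stresses :: "'v set \<Rightarrow> (nat \<Rightarrow> 'v \<Rightarrow> 'k::field) \<Rightarrow> nat \<Rightarrow> 'v set set \<Rightarrow> nat \<Rightarrow> ('v multiset \<Rightarrow> 'k) set" where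
  "stresses U p t K b = {c. stress U p t K b c}"

lemma th_linear: "Vector_Spaces.linear fscale fscale (th U q)"
  by unfold_locales (auto simp: fscale_def th_def fun_eq_iff algebra_simps sum.distrib sum_distrib_left)

lemma subspace_stresses: "fun_space.subspace (stresses U p t K b)"
proof (rule fun_space.subspaceI)
  show "0 \<in> stresses U p t K b"
    by (simp add: stresses_def stress_def th_def)
next
  fix c e assume ce: "c \<in> stresses U p t K b" "e \<in> stresses U p t K b"
  have "th U q (c + e) m = th U q c m + th U q e m" for q m
    by (simp add: th_def sum.distrib algebra_simps)
  moreover have "(c + e) m \<noteq> 0 \<Longrightarrow> c m \<noteq> 0 \<or> e m \<noteq> 0" for m by auto
  ultimately show "c + e \<in> stresses U p t K b"
    using ce unfolding stresses_def stress_def mem_Collect_eq by (metis add.right_neutral)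
next
  fix l c assume c: "c \<in> stresses U p t K b"
  have "th U q (fscale l c) m = l * th U q c m" for q m
    by (simp add: th_def fscale_def sum_distrib_left algebra_simps)
  then show "fscale l c \<in> stresses U p t K b"
    using c by (auto simp: stresses_def stress_def fscale_def)
qed

lemma stresses_0: "stresses U p 0 K b = {c. \<forall>m. c m \<noteq> 0 \<longrightarrow> m \<in> {m. set_mset m \<in> K \<and> size m = b}}"
  by (auto simp: stresses_def stress_def)

lemma stresses_decreasing: "stresses U p t K b \<subseteq> stresses U p 0 K b"
  by (auto simp: stresses_def stress_def)

lemma finite_face_monomials:
  assumes "scomplex K"
  shows "finite {m. set_mset m \<in> K \<and> size m = b}"
  by (rule finite_subset[OF _ finite_monomials[OF finite_Union_scomplex[OF assms], of b]]) auto

lemma stresses_span: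
  assumes "scomplex K"
  obtains T where "finite T" "stresses U p t K b \<subseteq> fun_space.span T"
  using supported_span[OF finite_face_monomials[OF assms]] stresses_decreasing
  unfolding stresses_0 by (metis (mono_tags, lifting) subset_trans)

text \<open>By coregularity, contraction by p t maps the stresses for t forms in degree b + 1 onto
  those in degree b; its kernel is the space for t + 1 forms.\<close>

lemma dim_stresses_Suc:
  fixes p :: "nat \<Rightarrow> 'v \<Rightarrow> 'k::field"
  assumes "scomplex K" "coregular U p d K" "t < d"
  shows "fun_space.dim (stresses U p t K (Suc b)) =
    fun_space.dim (stresses U p (Suc t) K (Suc b)) + fun_space.dim (stresses U p t K b)"
proof -
  obtain T where T: "finite T" "stresses U p t K (Suc b) \<subseteq> fun_space.span T"
    using stresses_span[OF assms(1)] .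
  have "{c \<in> stresses U p t K (Suc b). th U (p t) c = 0} = stresses U p (Suc t) K (Suc b)"
    by (auto simp: stresses_def stress_def less_Suc_eq fun_eq_iff)
  moreover have "th U (p t) ` stresses U p t K (Suc b) = stresses U p t K b"
  proof (intro subset_antisym subsetI)
    fix y assume "y \<in> stresses U p t K b"
    then obtain x where x: "stress U p t K (Suc b) x" "\<forall>m. th U (p t) x m = y m"
      using assms(2,3) unfolding coregular_def stresses_def by blast
    show "y \<in> th U (p t) ` stresses U p t K (Suc b)"
    proof (rule image_eqI[where f = "th U (p t)" and x = x])
      show "y = th U (p t) x" using x(2) by (intro ext) simp
      show "x \<in> stresses U p t K (Suc b)" using x(1) by (simp add: stresses_def)
    qed
  next
    fix y assume "y \<in> th U (p t) ` stresses U p t K (Suc b)"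
    then obtain x where x': "y = th U (p t) x" "x \<in> stresses U p t K (Suc b)" by (rule imageE)
    note x = x'(2)[unfolded stresses_def mem_Collect_eq] x'(1)
    have "set_mset m \<in> K \<and> size m = b" if nz: "y m \<noteq> 0" for m
    proof -
      obtain v where "x (add_mset v m) \<noteq> 0"
        using th_nonzeroD[OF nz[unfolded x(2)]] by blast
      then have "set_mset (add_mset v m) \<in> K" "size (add_mset v m) = Suc b"
        using x(1) unfolding stress_def by blast+
      then show ?thesis using subface[OF assms(1), of "set_mset (add_mset v m)" "set_mset m"] by auto
    qed
    moreover have "th U (p s) y m = 0" if "s < t" for s m
    proof -
      have "th U (p s) x = (\<lambda>_. 0)" using x(1) that by (auto simp: stress_def)
      then show ?thesis unfolding x(2) by (subst th_commute) simp
    qed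
    ultimately show "y \<in> stresses U p t K b" by (auto simp: stresses_def stress_def)
  qed
  ultimately show ?thesis
    using fun_space.dim_kernel_image[OF th_linear subspace_stresses T(2,1), of U "p t"] by simp
qed

lemma stresses_degree_0: "stresses U p t K 0 = stresses U p 0 K 0"
proof -
  have "th U q c m = 0" if "\<forall>m. c m \<noteq> 0 \<longrightarrow> set_mset m \<in> K \<and> size m = 0" for q c m
  proof -
    have "c (add_mset v m) = 0" for v using that by (metis Zero_not_Suc size_add_mset)
    then show ?thesis by (simp add: th_def)
  qed
  then show ?thesis by (auto simp: stresses_def stress_def)
qed

definition monomial_fps :: "'v set \<Rightarrow> int fps" where
  "monomial_fps F = Abs_fps (\<lambda>b. int (card {m. set_mset m = F \<and> size m = b}))"

text \<open>The series is (x / (1 - x))^card F. Dividing a monomial by the new vertex v leaves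
  support \<open>insert v F\<close> or F, which gives the recursion.\<close>

lemma monomial_fps:
  assumes "finite F"
  shows "(1 - fps_X) ^ card F * monomial_fps F = fps_X ^ card F"
  using assms
proof (induction F rule: finite_induct)
  case empty
  have "{m. set_mset m = {} \<and> size m = b} = (if b = 0 then {{#}} else {})" for b :: nat
    by auto
  then have "monomial_fps ({} :: 'v set) = 1" by (auto simp: monomial_fps_def fps_eq_iff)
  then show ?case by simp
next
  case (insert v F)
  let ?N = "\<lambda>F b. {m. set_mset m = F \<and> size m = b}"
  have fin: "finite (?N G b)" if "finite G" for G :: "'v set" and b
    using finite_subset[OF _ finite_monomials[OF that, of b], of "?N G b"] by auto
  have step: "card (?N (insert v F) (Suc b)) = card (?N (insert v F) b) + card (?N F b)" for b
  proof -
    have "?N (insert v F) (Suc b) = add_mset v ` (?N (insert v F) b \<union> ?N F b)"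
    proof (intro subset_antisym subsetI)
      fix m assume m: "m \<in> ?N (insert v F) (Suc b)"
      then obtain \<nu> where \<nu>: "m = add_mset v \<nu>" by (auto dest!: multi_member_split)
      then have "set_mset \<nu> = insert v F \<or> set_mset \<nu> = F"
        using m insert.hyps(2) by (cases "v \<in># \<nu>") auto
      moreover have "size \<nu> = b" using m \<nu> by simp
      ultimately have "\<nu> \<in> ?N (insert v F) b \<union> ?N F b" by blast
      then show "m \<in> add_mset v ` (?N (insert v F) b \<union> ?N F b)" unfolding \<nu> by (rule imageI)
    next
      fix m assume "m \<in> add_mset v ` (?N (insert v F) b \<union> ?N F b)"
      then obtain \<nu> where \<nu>: "m = add_mset v \<nu>" "set_mset \<nu> = insert v F \<or> set_mset \<nu> = F" "size \<nu> = b"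
        by blast
      then have "set_mset m = insert v F" "size m = Suc b" by auto
      then show "m \<in> ?N (insert v F) (Suc b)" by blast
    qed
    moreover have "inj_on (add_mset v) (?N (insert v F) b \<union> ?N F b)" by (rule inj_onI) simp
    ultimately have "card (?N (insert v F) (Suc b)) = card (?N (insert v F) b \<union> ?N F b)"
      by (simp only: card_image)
    also have "\<dots> = card (?N (insert v F) b) + card (?N F b)"
      using insert.hyps by (intro card_Un_disjoint fin) auto
    finally show ?thesis .
  qed
  have "(1 - fps_X) * monomial_fps (insert v F) = fps_X * monomial_fps F"
  proof (rule fps_ext)
    fix b
    show "fps_nth ((1 - fps_X) * monomial_fps (insert v F)) b = fps_nth (fps_X * monomial_fps F) b"
    proof (cases b)
      case 0
      have "?N (insert v F) 0 = {}" by auto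
      then show ?thesis using 0 by (simp add: monomial_fps_def left_diff_distrib)
    next
      case (Suc b')
      then show ?thesis using step[of b'] by (simp add: monomial_fps_def left_diff_distrib)
    qed
  qed
  then have "(1 - fps_X) ^ card (insert v F) * monomial_fps (insert v F) =
      fps_X * ((1 - fps_X) ^ card F * monomial_fps F)"
    using insert.hyps by (simp add: mult.assoc mult.left_commute)
  then show ?case using insert by simp
qed

text \<open>Without forms, the dimensions count all monomials supported on faces. Each form
  multiplies the series by 1 - x, and a face with k vertices ends up contributing x^k (1 - x)^(d -
  k).\<close>

theorem coeff_weight_stresses:
  fixes p :: "nat \<Rightarrow> 'v \<Rightarrow> 'k::field"
  assumes "scomplex K" "coregular U p d K" "\<forall>F\<in>K. card F \<le> d"
  shows "coeff (weight (1 - [:0, 1:]) d K) j = int (fun_space.dim (stresses U p d K j))"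
proof -
  define H where "H t = Abs_fps (\<lambda>b. int (fun_space.dim (stresses U p t K b)))" for t
  have Suc: "H (Suc t) = (1 - fps_X) * H t" if "t < d" for t
  proof (rule fps_ext)
    fix b
    show "fps_nth (H (Suc t)) b = fps_nth ((1 - fps_X) * H t) b"
    proof (cases b)
      case 0
      then show ?thesis
        using stresses_degree_0[of U p t K] stresses_degree_0[of U p "Suc t" K]
        by (simp add: H_def left_diff_distrib)
    next
      case (Suc b')
      then show ?thesis
        using dim_stresses_Suc[OF assms(1,2) that, of b'] by (simp add: H_def left_diff_distrib)
    qed
  qed
  have Hd: "H t = (1 - fps_X) ^ t * H 0" if "t \<le> d" for t
    using that by (induction t) (auto simp: Suc mult.assoc)
  have "H 0 = (\<Sum>F\<in>K. monomial_fps F)"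
  proof (rule fps_ext)
    fix b
    have "fun_space.dim (stresses U p 0 K b) = card {m. set_mset m \<in> K \<and> size m = b}"
      unfolding stresses_0 by (rule dim_supported[OF finite_face_monomials[OF assms(1)]])
    also have "{m. set_mset m \<in> K \<and> size m = b} = (\<Union>F\<in>K. {m. set_mset m = F \<and> size m = b})"
      by auto
    also have "card \<dots> = (\<Sum>F\<in>K. card {m. set_mset m = F \<and> size m = b})"
    proof (rule card_UN_disjoint)
      show "\<forall>F\<in>K. finite {m. set_mset m = F \<and> size m = b}"
        by (intro ballI finite_subset[OF _ finite_face_monomials[OF assms(1), of b]]) auto
    qed (use scomplex_finite[OF assms(1)] in auto)
    finally show "fps_nth (H 0) b = fps_nth (\<Sum>F\<in>K. monomial_fps F) b"
      by (simp add: H_def monomial_fps_def fps_sum_nth)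
  qed
  then have "H d = (\<Sum>F\<in>K. (1 - fps_X) ^ d * monomial_fps F)"
    using Hd[of d] by (simp add: sum_distrib_left)
  also have "\<dots> = (\<Sum>F\<in>K. fps_X ^ card F * (1 - fps_X) ^ (d - card F))"
  proof (rule sum.cong[OF refl])
    fix F assume F: "F \<in> K"
    then have e: "(1 - fps_X :: int fps) ^ d = (1 - fps_X) ^ (d - card F) * (1 - fps_X :: int fps) ^ card F"
      using assms(3) by (simp flip: power_add)
    show "(1 - fps_X) ^ d * monomial_fps F = fps_X ^ card F * (1 - fps_X) ^ (d - card F)"
      unfolding e mult.assoc monomial_fps[OF finite_face[OF assms(1) F]] by (rule mult.commute)
  qed
  also have "\<dots> = fps_of_poly (weight (1 - [:0, 1:]) d K)"
  proof -
    have "fps_of_poly [:0, 1:] = (fps_X :: int fps)" by (simp add: fps_of_poly_pCons)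
    then show ?thesis
      by (simp add: weight_def fps_of_poly_sum fps_of_poly_mult fps_of_poly_power fps_of_poly_diff)
  qed
  finally have "fps_nth (H d) j = coeff (weight (1 - [:0, 1:]) d K) j" by simp
  then show ?thesis by (simp add: H_def)
qed

text \<open>Points on the moment curve: a polynomial vanishing at the parameters of all vertices of
  F except u has degree below \<open>card F\<close>, and combining the relations with its
  coefficients isolates l u.\<close>

lemma general_position_vandermonde:
  fixes x :: "'v \<Rightarrow> 'k::field"
  assumes "inj_on x (\<Union>K)" "scomplex K"
  shows "general_position (\<lambda>s v. x v ^ s) K"
  unfolding general_position_def
proof (intro ballI allI impI)
  fix F l u assume F: "F \<in> K" and l: "\<forall>s<card F. (\<Sum>v\<in>F. l v * x v ^ s) = 0" and u: "u \<in> F"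
  have fF: "finite F" using finite_face[OF assms(2) F] .
  define P where "P = (\<Prod>w\<in>F - {u}. [:- x w, 1:])"
  have deg: "degree P \<le> card F - 1"
    unfolding P_def using degree_prod_sum_le[of "F - {u}" "\<lambda>w. [:- x w, 1:]"] fF u by simp
  have P: "poly P (x v) = (\<Prod>w\<in>F - {u}. x v - x w)" for v
    by (simp add: P_def poly_prod)
  have "(\<Sum>v\<in>F. l v * poly P (x v)) = (\<Sum>v\<in>F. \<Sum>s\<le>degree P. coeff P s * (l v * x v ^ s))"
    by (simp add: poly_altdef sum_distrib_left mult.left_commute)
  also have "\<dots> = (\<Sum>s\<le>degree P. coeff P s * (\<Sum>v\<in>F. l v * x v ^ s))"
    by (subst sum.swap) (simp add: sum_distrib_left)
  also have "\<dots> = 0"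
  proof (rule sum.neutral, intro ballI)
    fix s assume "s \<in> {..degree P}"
    moreover have "0 < card F" using fF u card_gt_0_iff by blast
    ultimately have "s < card F" using deg by auto
    then show "coeff P s * (\<Sum>v\<in>F. l v * x v ^ s) = 0" using l by simp
  qed
  also have "(\<Sum>v\<in>F. l v * poly P (x v)) = (\<Sum>v\<in>{u}. l v * poly P (x v))"
  proof (rule sum.mono_neutral_right)
    show "\<forall>v\<in>F - {u}. l v * poly P (x v) = 0"
      unfolding P using fF by (auto intro!: prod_zero)
  qed (use fF u in auto)
  finally have "l u * poly P (x u) = 0" by simp
  moreover have "poly P (x u) \<noteq> 0"
    unfolding P using assms(1) F u fF by (auto simp: inj_on_def)
  ultimately show "l u = 0" by simp
qed

theorem weight_link_le:
  fixes K :: "'v::linorder set set"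
  assumes "finite U" "scomplex K" "\<Union>K \<subseteq> U" "cm TYPE('k::field) U d K" "\<forall>F\<in>K. card F \<le> d"
    and "A \<in> K" "infinite (UNIV :: 'k set)"
  shows "weight (1 - [:0, 1:]) (d - card A) (link K A) \<preceq> weight (1 - [:0, 1:]) d K"
proof -
  let ?S = "closed_star K A"
  \<comment> \<open>Distinct parameters for all vertices exist because the field is infinite. The
    same forms are used for K and for the star.\<close>
  obtain x :: "'v \<Rightarrow> 'k" where x: "inj_on x (\<Union>K)"
    using finite_Union_scomplex[OF assms(2)] assms(7) by (metis infinite_arbitrarily_large inj_on_iff_card_le finite_subset order_refl)
  have sS: "scomplex ?S" using assms(2,6) by (rule scomplex_closed_star)
  have sub: "?S \<subseteq> K" by (auto simp: closed_star_def)
  let ?p = "\<lambda>s v. x v ^ s"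
  have cS: "coregular U ?p d ?S"
    using x sub assms(3) inj_on_subset[OF x, of "\<Union>?S"]
    by (intro cm_coregular assms(1) sS cm_closed_star assms general_position_vandermonde) auto
  have cD: "coregular U ?p d K"
    using x by (intro cm_coregular assms general_position_vandermonde)
  have "weight (1 - [:0, 1:]) d ?S \<preceq> weight (1 - [:0, 1:]) d K"
    unfolding coeff_le_def
  proof
    fix j
    obtain T where T: "finite T" "stresses U ?p d K j \<subseteq> fun_space.span T"
      using stresses_span[OF assms(2)] .
    \<comment> \<open>With the same forms, only the support condition mentions the complex.\<close>
    have "stresses U ?p d ?S j \<subseteq> stresses U ?p d K j"
      using sub by (auto simp: stresses_def stress_def)
    then have "fun_space.dim (stresses U ?p d ?S j) \<le> fun_space.dim (stresses U ?p d K j)"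
      using T by (intro fun_space.dim_mono_finite)
    then show "coeff (weight (1 - [:0, 1:]) d ?S) j \<le> coeff (weight (1 - [:0, 1:]) d K) j"
      using coeff_weight_stresses[OF assms(2) cD assms(5)] coeff_weight_stresses[OF sS cS] sub assms(5)
      by (simp add: subset_iff)
  qed
  then show ?thesis by (simp add: weight_closed_star[OF assms(2,6,5)])
qed

section \<open>Coefficient fields\<close>

definition all_units :: "'k::comm_ring_1 itself \<Rightarrow> bool" where
  "all_units k \<longleftrightarrow> (\<forall>x::'k. x \<noteq> 0 \<longrightarrow> (\<exists>y. x * y = 1))"

text \<open>An integral domain attached to every commutative ring: the ring itself if it is a field, and the
  integers otherwise. It is needed because \<open>'k\<close> has no suitable type class, while polynomials and
  fractions over the domain provide an infinite field.\<close>

typedef (overloaded) 'k::comm_ring_1 coeff_domain =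
  "if all_units TYPE('k) then range Inl else (range Inr :: ('k + int) set)"
  by auto

definition dom_inl :: "'k::comm_ring_1 \<Rightarrow> 'k coeff_domain" where
  "dom_inl a = Abs_coeff_domain (Inl a)"

definition dom_inr :: "int \<Rightarrow> 'k::comm_ring_1 coeff_domain" where
  "dom_inr a = Abs_coeff_domain (Inr a)"

text \<open>All elements of the type lie in the same summand, so the projection of y is
  legitimate.\<close>

definition dom_lift :: "('k \<Rightarrow> 'k \<Rightarrow> 'k) \<Rightarrow> (int \<Rightarrow> int \<Rightarrow> int) \<Rightarrow>
    'k::comm_ring_1 coeff_domain \<Rightarrow> 'k coeff_domain \<Rightarrow> 'k coeff_domain" where
  "dom_lift f g x y = (case Rep_coeff_domain x of
     Inl a \<Rightarrow> dom_inl (f a (projl (Rep_coeff_domain y)))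
   | Inr a \<Rightarrow> dom_inr (g a (projr (Rep_coeff_domain y))))"

lemma
  assumes "all_units TYPE('k::comm_ring_1)"
  shows dom_inl_inj: "dom_inl (a::'k) = dom_inl b \<longleftrightarrow> a = b"
    and dom_inl_cases: "\<exists>a. (x::'k coeff_domain) = dom_inl a"
    and dom_lift_inl: "dom_lift f g (dom_inl (a::'k)) (dom_inl b) = dom_inl (f a b)"
proof -
  have mem: "Inl a \<in> (if all_units TYPE('k) then range Inl else (range Inr :: ('k + int) set))" for a
    using assms by simp
  have Rep: "Rep_coeff_domain (dom_inl a) = Inl a" for a :: 'k
    unfolding dom_inl_def by (rule Abs_coeff_domain_inverse[OF mem])
  show "dom_inl a = dom_inl b \<longleftrightarrow> a = b" using Rep by (metis sum.inject(1))
  show "\<exists>a. x = dom_inl a"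
    using Rep_coeff_domain[of x] assms Rep_coeff_domain_inverse[of x]
    by (auto simp: dom_inl_def)
  show "dom_lift f g (dom_inl a) (dom_inl b) = dom_inl (f a b)"
    by (simp add: dom_lift_def Rep)
qed

lemma
  assumes "\<not> all_units TYPE('k::comm_ring_1)"
  shows dom_inr_inj: "dom_inr a = (dom_inr b :: 'k coeff_domain) \<longleftrightarrow> a = b"
    and dom_inr_cases: "\<exists>a. (x::'k coeff_domain) = dom_inr a"
    and dom_lift_inr: "dom_lift f g (dom_inr a) (dom_inr b) = (dom_inr (g a b) :: 'k coeff_domain)"
proof -
  have mem: "Inr a \<in> (if all_units TYPE('k) then range Inl else (range Inr :: ('k + int) set))" for a
    using assms by simp
  have Rep: "Rep_coeff_domain (dom_inr a :: 'k coeff_domain) = Inr a" for a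
    unfolding dom_inr_def by (rule Abs_coeff_domain_inverse[OF mem])
  show "dom_inr a = (dom_inr b :: 'k coeff_domain) \<longleftrightarrow> a = b" using Rep by (metis sum.inject(2))
  show "\<exists>a. x = dom_inr a"
    using Rep_coeff_domain[of x] assms Rep_coeff_domain_inverse[of x]
    by (auto simp: dom_inr_def)
  show "dom_lift f g (dom_inr a) (dom_inr b) = (dom_inr (g a b) :: 'k coeff_domain)"
    by (simp add: dom_lift_def Rep)
qed

instantiation coeff_domain :: (comm_ring_1) idom
begin

definition "0 = (if all_units TYPE('a) then dom_inl 0 else dom_inr 0 :: 'a coeff_domain)"
definition "1 = (if all_units TYPE('a) then dom_inl 1 else dom_inr 1 :: 'a coeff_domain)"
definition "(x :: 'a coeff_domain) + y = dom_lift (+) (+) x y"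
definition "(x :: 'a coeff_domain) * y = dom_lift (*) (*) x y"
definition "(x :: 'a coeff_domain) - y = dom_lift (-) (-) x y"
definition "- (x :: 'a coeff_domain) = 0 - x"

lemmas coeff_domain_defs = zero_coeff_domain_def one_coeff_domain_def
  plus_coeff_domain_def times_coeff_domain_def minus_coeff_domain_def uminus_coeff_domain_def

instance
proof
  fix a b c :: "'a coeff_domain"
  have no_zero_div: "a \<noteq> 0 \<Longrightarrow> b \<noteq> 0 \<Longrightarrow> a * b \<noteq> 0" if "all_units TYPE('a)" for a b :: 'a
    using that unfolding all_units_def by (metis mult.assoc mult.commute mult_1 mult_zero_left)
  show "a + b + c = a + (b + c)" "a + b = b + a" "0 + a = a" "- a + a = 0" "a - b = a + - b"
    "a * b * c = a * (b * c)" "a * b = b * a" "1 * a = a" "(a + b) * c = a * c + b * c"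
    "0 * a = 0" "a * 0 = 0" "a * (b + c) = a * b + a * c"
    "(0::'a coeff_domain) \<noteq> 1" "a \<noteq> 0 \<Longrightarrow> b \<noteq> 0 \<Longrightarrow> a * b \<noteq> 0"
    using dom_inl_cases[of a] dom_inl_cases[of b] dom_inl_cases[of c] no_zero_div
      dom_inr_cases[of a] dom_inr_cases[of b] dom_inr_cases[of c]
    by (cases "all_units TYPE('a)";
        auto simp: coeff_domain_defs dom_inl_inj dom_inr_inj dom_lift_inl dom_lift_inr algebra_simps)+
qed

end

lemma coeff_domain_iso:
  assumes "field_or_integers TYPE('k::comm_ring_1)"
  obtains \<phi> :: "'k::comm_ring_1 \<Rightarrow> 'k coeff_domain"
  where "bij \<phi>" "\<And>x y. \<phi> (x + y) = \<phi> x + \<phi> y" "\<And>x y. \<phi> (x * y) = \<phi> x * \<phi> y" "\<phi> 1 = 1"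
proof (cases "all_units TYPE('k)")
  case True
  show ?thesis
  proof (rule that[of dom_inl])
    show "bij (dom_inl :: 'k \<Rightarrow> _)"
      using dom_inl_inj[OF True] dom_inl_cases[OF True] by (auto simp: bij_def inj_def surj_def)
  qed (simp_all add: coeff_domain_defs True dom_lift_inl[OF True])
next
  case False
  then have b: "bij (of_int :: int \<Rightarrow> 'k)"
    using assms by (auto simp: field_or_integers_def all_units_def)
  define j where "j = inv_into UNIV (of_int :: int \<Rightarrow> 'k)"
  have j: "j (of_int a) = a" for a using b by (simp add: j_def bij_def inv_f_f)
  have bj: "bij j" using b by (simp add: j_def bij_imp_bij_inv)
  have s: "\<exists>a. x = of_int a" for x :: 'k using b by (auto simp: bij_def surj_def)
  show ?thesis
  proof (rule that[of "\<lambda>x. dom_inr (j x)"])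
    have "bij (dom_inr :: int \<Rightarrow> 'k coeff_domain)"
      using dom_inr_inj[OF False] dom_inr_cases[OF False] by (auto simp: bij_def inj_def surj_def)
    then show "bij (\<lambda>x. dom_inr (j x) :: 'k coeff_domain)" using bij_comp[OF bj] by (simp add: comp_def)
    fix x y :: 'k
    obtain a b where "x = of_int a" "y = of_int b" using s by metis
    then show "dom_inr (j (x + y)) = (dom_inr (j x) + dom_inr (j y) :: 'k coeff_domain)"
      "dom_inr (j (x * y)) = (dom_inr (j x) * dom_inr (j y) :: 'k coeff_domain)"
      by (simp_all add: coeff_domain_defs dom_lift_inr[OF False] j flip: of_int_add of_int_mult)
    show "dom_inr (j 1) = (1 :: 'k coeff_domain)"
      using j[of 1] by (simp add: coeff_domain_defs False)
  qed
qed

section \<open>Transfer of exactness to larger coefficient rings\<close>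

lemma bd_hom:
  fixes \<phi> :: "'a::comm_ring_1 \<Rightarrow> 'b::comm_ring_1"
  assumes "\<And>x y. \<phi> (x + y) = \<phi> x + \<phi> y" "\<And>x y. \<phi> (x * y) = \<phi> x * \<phi> y" "\<phi> 1 = 1"
  shows "\<phi> (bd U c G) = bd U (\<lambda>A. \<phi> (c A)) G"
proof -
  have 0: "\<phi> 0 = 0" using assms(1)[of 0 0] by simp
  have "\<phi> (-1) = -1" using assms(1)[of "-1" 1] 0 assms(3) by (simp add: eq_neg_iff_add_eq_0)
  then have "\<phi> ((-1) ^ n) = (-1) ^ n" for n
    by (induction n) (simp_all only: power_0 power_Suc assms(2,3))
  then have sg: "\<phi> (sg v G) = sg v G" for v and G :: "'c set" by (simp add: sg_def)
  have "\<phi> (sum f S) = (\<Sum>x\<in>S. \<phi> (f x))" for f and S :: "'c set"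
    by (induction S rule: infinite_finite_induct) (auto simp: 0 assms(1))
  then show ?thesis by (simp add: bd_def assms(2) sg)
qed

lemma exact_at_iso:
  fixes K :: "'c::linorder set set" and \<phi> :: "'a::comm_ring_1 \<Rightarrow> 'b::comm_ring_1"
  assumes "bij \<phi>" and hom: "\<And>x y. \<phi> (x + y) = \<phi> x + \<phi> y" "\<And>x y. \<phi> (x * y) = \<phi> x * \<phi> y" "\<phi> 1 = 1"
    and "exact_at TYPE('a) U K a"
  shows "exact_at TYPE('b) U K a"
  unfolding exact_at_def
proof (intro allI impI)
  fix c :: "'c set \<Rightarrow> 'b"
  assume c: "chain K a c" "\<forall>G. bd U c G = 0"
  have 0: "\<phi> 0 = 0" using hom(1)[of 0 0] by simp
  have inj: "\<phi> x = \<phi> y \<longleftrightarrow> x = y" for x y using assms(1) by (auto simp: bij_def inj_def)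
  have "\<forall>A. \<exists>x. c A = \<phi> x" using assms(1) by (auto simp: bij_def surj_def)
  then obtain c' where c': "\<And>A. c A = \<phi> (c' A)" by metis
  have "chain K a c'" using c(1) c' inj 0 by (metis chain_def)
  moreover have "\<forall>G. bd U c' G = 0"
    using c(2) bd_hom[of \<phi> U c', OF hom] unfolding c'[symmetric] by (metis 0 inj)
  ultimately obtain e where e: "chain K (Suc a) e" "\<forall>G. bd U e G = c' G"
    using assms(5) unfolding exact_at_def by blast
  have "chain K (Suc a) (\<lambda>A. \<phi> (e A))" using e(1) 0 unfolding chain_def by metis
  moreover have "\<forall>G. bd U (\<lambda>A. \<phi> (e A)) G = c G"
    using e(2) bd_hom[of \<phi> U e, OF hom] c' by simp
  ultimately show "\<exists>e. chain K (Suc a) e \<and> (\<forall>G. bd U e G = c G)" by blast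
qed

lemma coeff_bd: "coeff (bd U c G) j = bd U (\<lambda>A. coeff (c A) j) G"
proof -
  have "coeff ((-1) ^ n * p) j = (-1) ^ n * coeff p j" for n and p :: "'a poly"
    by (induction n) auto
  then show ?thesis by (simp add: bd_def coeff_sum sg_def)
qed

text \<open>The boundary acts on each coefficient separately. Finiteness of K bounds the degrees in
  c, so finitely many fillings assemble to a polynomial.\<close>

lemma exact_at_poly:
  fixes K :: "'c::linorder set set"
  assumes "finite K" "exact_at TYPE('a::comm_ring_1) U K a"
  shows "exact_at TYPE('a poly) U K a"
  unfolding exact_at_def
proof (intro allI impI)
  fix c :: "'c set \<Rightarrow> 'a poly"
  assume c: "chain K a c" "\<forall>G. bd U c G = 0"
  have "\<exists>e. chain K (Suc a) e \<and> (\<forall>G. bd U e G = coeff (c G) j)" for j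
  proof -
    have "chain K a (\<lambda>A. coeff (c A) j)" using c(1) unfolding chain_def by (metis coeff_0)
    moreover have "\<forall>G. bd U (\<lambda>A. coeff (c A) j) G = 0" using c(2) by (simp flip: coeff_bd)
    ultimately show ?thesis using assms(2) unfolding exact_at_def by blast
  qed
  then obtain e where e: "\<And>j. chain K (Suc a) (e j)" "\<And>j G. bd U (e j) G = coeff (c G) j" by metis
  obtain N where N: "\<forall>A\<in>K. degree (c A) \<le> N"
    using assms(1) finite_nat_set_iff_bounded_le[of "(\<lambda>A. degree (c A)) ` K"] by auto
  define E where "E A = (\<Sum>j\<le>N. monom (e j A) j)" for A
  have coeffE: "coeff (E A) j = (if j \<le> N then e j A else 0)" for A j
    by (simp add: E_def coeff_sum)
  have "chain K (Suc a) E"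
    unfolding chain_def
  proof (intro allI impI)
    fix A assume "E A \<noteq> 0"
    then obtain j where "e j A \<noteq> 0" using coeffE by (metis poly_eqI coeff_0)
    then show "A \<in> K \<and> card A = Suc a" using e(1) by (auto simp: chain_def)
  qed
  moreover have "bd U E G = c G" for G
  proof (rule poly_eqI)
    fix j
    have "coeff (c G) j = 0" if "\<not> j \<le> N"
    proof (cases "c G = 0")
      case False
      then have "degree (c G) < j" using N c(1) that by (fastforce simp: chain_def)
      then show ?thesis by (rule coeff_eq_0)
    qed simp
    then show "coeff (bd U E G) j = coeff (c G) j"
      using e(2)[of j G] by (cases "j \<le> N") (simp_all add: coeff_bd coeffE, simp add: bd_def)
  qed
  ultimately show "\<exists>e. chain K (Suc a) e \<and> (\<forall>G. bd U e G = c G)" by blast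
qed

lemma common_denominator:
  fixes c :: "'x \<Rightarrow> 'a::idom fract"
  assumes "finite S"
  shows "\<exists>D. D \<noteq> 0 \<and> (\<forall>x\<in>S. \<exists>a. c x * to_fract D = to_fract a)"
  using assms
proof (induction S rule: finite_induct)
  case empty
  show ?case by (intro exI[of _ 1]) simp
next
  case (insert x S)
  then obtain D where D: "D \<noteq> 0" "\<forall>x\<in>S. \<exists>a. c x * to_fract D = to_fract a" by blast
  obtain a b where ab: "c x = Fract a b" "b \<noteq> 0" by (cases "c x") auto
  have x: "c x * to_fract b = to_fract a"
    using ab by (simp add: to_fract_def eq_fract)
  have "D * b \<noteq> 0" using D ab by simp
  moreover have "\<exists>a. c y * to_fract (D * b) = to_fract a" if "y \<in> insert x S" for y
  proof -
    from that consider "y = x" | "y \<in> S" by blast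
    then show "\<exists>a. c y * to_fract (D * b) = to_fract a"
    proof cases
      case 1
      have "c y * to_fract (D * b) = to_fract (D * a)"
        using x 1 by (metis mult.left_commute to_fract_mult)
      then show ?thesis by blast
    next
      case 2
      then obtain a' where "c y * to_fract D = to_fract a'" using D(2) by blast
      then have "c y * to_fract (D * b) = to_fract (a' * b)" by (metis mult.assoc to_fract_mult)
      then show ?thesis by blast
    qed
  qed
  ultimately show ?case by blast
qed

lemma bd_scale: "bd U (\<lambda>A. l * c A) G = l * bd U c G"
  by (simp add: bd_def sum_distrib_left mult.left_commute)

text \<open>A common denominator turns c into a cycle over the domain; its filling is divided by
  that denominator.\<close>

lemma exact_at_fract:
  fixes K :: "'c::linorder set set"
  assumes "finite K" "exact_at TYPE('a::idom) U K a"
  shows "exact_at TYPE('a fract) U K a"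
  unfolding exact_at_def
proof (intro allI impI)
  fix c :: "'c set \<Rightarrow> 'a fract"
  assume c: "chain K a c" "\<forall>G. bd U c G = 0"
  note hom = bd_hom[of "to_fract :: 'a \<Rightarrow> 'a fract", OF to_fract_add to_fract_mult to_fract_1]
  obtain D :: 'a where D: "D \<noteq> 0" "\<forall>A\<in>K. \<exists>b. c A * to_fract D = to_fract b"
    using common_denominator[OF assms(1)] by blast
  have "\<exists>b. c A * to_fract D = to_fract b" for A
  proof (cases "A \<in> K")
    case False
    then have "c A * to_fract D = to_fract 0" using c(1) by (auto simp: chain_def)
    then show ?thesis by blast
  qed (use D in blast)
  then obtain c' where c': "\<And>A. c A * to_fract D = to_fract (c' A)" by metis
  have D0: "to_fract D \<noteq> 0" using D(1) by simp
  have "chain K a c'"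
    unfolding chain_def
  proof (intro allI impI)
    fix A assume "c' A \<noteq> 0"
    then have "c A * to_fract D \<noteq> 0" using c' by simp
    then have "c A \<noteq> 0" by auto
    then show "A \<in> K \<and> card A = a" using c(1) by (simp add: chain_def)
  qed
  moreover have "bd U c' G = 0" for G
  proof -
    have "to_fract (bd U c' G) = bd U (\<lambda>A. to_fract D * c A) G"
      unfolding hom by (simp add: c'[symmetric] mult.commute)
    also have "\<dots> = 0" unfolding bd_scale using c(2) by simp
    finally show ?thesis by simp
  qed
  ultimately obtain e where e: "chain K (Suc a) e" "\<forall>G. bd U e G = c' G"
    using assms(2) unfolding exact_at_def by blast
  have "chain K (Suc a) (\<lambda>A. inverse (to_fract D) * to_fract (e A))"
    using e(1) D0 by (auto simp: chain_def)
  moreover have "bd U (\<lambda>A. inverse (to_fract D) * to_fract (e A)) G = c G" for G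
    unfolding bd_scale hom[symmetric] using e(2) c'[of G] D0
    by (metis mult.assoc mult.commute mult.right_neutral right_inverse)
  ultimately show "\<exists>e. chain K (Suc a) e \<and> (\<forall>G. bd U e G = c G)" by blast
qed

text \<open>Polynomials provide infinitely many elements and fractions make them a field, so
  stresses are available even over a finite field or the integers.\<close>

lemma cm_extend:
  assumes "field_or_integers TYPE('k::comm_ring_1)" "finite K" "cm TYPE('k) U d K"
  shows "cm TYPE('k coeff_domain poly fract) U d K"
  unfolding cm_def
proof (intro ballI allI impI)
  fix F a assume F: "F \<in> K" "a + card F < d"
  obtain \<phi> :: "'k \<Rightarrow> 'k coeff_domain" where
    "bij \<phi>" "\<And>x y. \<phi> (x + y) = \<phi> x + \<phi> y" "\<And>x y. \<phi> (x * y) = \<phi> x * \<phi> y" "\<phi> 1 = 1"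
    using coeff_domain_iso[OF assms(1)] by blast
  moreover have "exact_at TYPE('k) U (link K F) a" using assms(3) F by (simp add: cm_def)
  ultimately have "exact_at TYPE('k coeff_domain) U (link K F) a" by (rule exact_at_iso)
  moreover have "finite (link K F)" using assms(2) by (simp add: link_def)
  ultimately show "exact_at TYPE('k coeff_domain poly fract) U (link K F) a"
    by (intro exact_at_fract exact_at_poly)
qed

lemma infinite_poly_fract: "infinite (UNIV :: 'a::idom poly fract set)"
proof -
  have "inj (\<lambda>n. to_fract (monom (1::'a) n))"
    by (rule injI) (metis degree_monom_eq one_neq_zero to_fract_eq_iff)
  then show ?thesis using finite_imageD infinite_UNIV_nat finite_subset subset_UNIV by metis
qed

section \<open>Doubly Cohen--Macaulay complexes\<close>

text \<open>All deletions use the same d, so by \<open>cm_pure\<close> each still has a face with at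
  least d vertices.\<close>

definition doubly_cm :: "'k::comm_ring_1 itself \<Rightarrow> 'v::linorder set \<Rightarrow> nat \<Rightarrow> 'v set set \<Rightarrow> bool" where
  "doubly_cm k U d K \<longleftrightarrow> cm k U d K \<and> (\<forall>v. cm k U d (deletion K {v}))"

text \<open>Exactness at size 0 in the link of a face with fewer than d vertices says that the empty
  face is a boundary. So the link has a vertex, and the face can be enlarged.\<close>

lemma cm_pure:
  fixes k :: "'k::comm_ring_1 itself"
  assumes "scomplex K" "cm k U d K" "F \<in> K"
  shows "\<exists>F'\<in>K. F \<subseteq> F' \<and> d \<le> card F'"
  using assms(3)
proof (induction "d - card F" arbitrary: F)
  case 0
  then show ?case by auto
next
  case (Suc m)
  have ex: "exact_at k U (link K F) 0" using assms(2) Suc.prems Suc.hyps(2) by (auto simp: cm_def)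
  define c :: "'a set \<Rightarrow> 'k" where "c A = (if A = {} then 1 else 0)" for A
  have "chain (link K F) 0 c"
    using Suc.prems scomplex_empty[OF assms(1)] by (auto simp: chain_def c_def link_def)
  moreover have "\<forall>G. bd U c G = 0" by (simp add: bd_def c_def)
  ultimately obtain e where e: "chain (link K F) (Suc 0) e" "\<forall>G. bd U e G = c G"
    using ex unfolding exact_at_def by blast
  have "\<exists>v. e {v} \<noteq> 0"
  proof (rule ccontr)
    assume "\<not> (\<exists>v. e {v} \<noteq> 0)"
    then have "bd U e {} = 0" by (simp add: bd_def)
    then show False using e(2) by (simp add: c_def)
  qed
  then obtain v where "{v} \<in> link K F" using e(1) by (auto simp: chain_def)
  then have v: "insert v F \<in> K" "v \<notin> F" by (auto simp: link_def)
  have "card (insert v F) = Suc (card F)" using v finite_face[OF assms(1) Suc.prems] by simp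
  then have "m = d - card (insert v F)" using Suc.hyps(2) by simp
  from Suc.hyps(1)[OF this v(1)] show ?case by blast
qed

lemma doubly_cm_link:
  assumes "scomplex K" "A \<in> K" "doubly_cm k U d K"
  shows "doubly_cm k U (d - card A) (link K A)"
  unfolding doubly_cm_def
proof (intro conjI allI)
  show l: "cm k U (d - card A) (link K A)"
    by (rule cm_link[OF assms(1,2)]) (use assms(3) in \<open>simp add: doubly_cm_def\<close>)
  fix v
  show "cm k U (d - card A) (deletion (link K A) {v})"
  proof (cases "v \<in> A")
    case True
    then have "deletion (link K A) {v} = link K A" by (intro deletion_link_self) auto
    then show ?thesis using l by simp
  next
    case False
    then have "deletion (link K A) {v} = link (deletion K {v}) A" by (simp add: link_deletion)
    moreover have "A \<in> deletion K {v}" using assms(2) False by (simp add: deletion_def)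
    moreover have "cm k U d (deletion K {v})" using assms(3) by (simp add: doubly_cm_def)
    ultimately show ?thesis
      using cm_link[OF scomplex_deletion[OF assms(1)], of A "{v}" k U d] by simp
  qed
qed

text \<open>By induction the link of a vertex v has a top cycle. It is the boundary of its cone with
  apex v, and also of a chain w in the deletion of v, which is still exact in that degree. The
  difference is a cycle, nonzero on faces through v because w has none.\<close>

lemma doubly_cm_top_cycle:
  assumes "finite U" "scomplex K" "\<Union>K \<subseteq> U" "\<forall>F\<in>K. card F \<le> d" "doubly_cm TYPE('k::comm_ring_1) U d K"
  shows "\<exists>z::'v::linorder set \<Rightarrow> 'k. top_cycle U d K z"
  using assms(2-5)
proof (induction d arbitrary: K)
  case 0
  have "top_cycle U 0 K (\<lambda>A. if A = {} then (1::'k) else 0)"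
    using scomplex_empty[OF 0(1)] by (auto simp: top_cycle_def bd_def)
  then show ?case by blast
next
  case (Suc d)
  note sc = \<open>scomplex K\<close>
  have cmD: "cm TYPE('k) U (Suc d) K" "cm TYPE('k) U (Suc d) (deletion K {v})" for v
    using Suc.prems(4) by (auto simp: doubly_cm_def)
  obtain F where F: "F \<in> K" "Suc d \<le> card F" using cm_pure[OF sc cmD(1) scomplex_empty[OF sc]] by blast
  then obtain v where v: "v \<in> F" by fastforce
  then have vD: "{v} \<in> K" using subface[OF sc F(1)] by simp
  have vU: "v \<in> U" using v F(1) Suc.prems(2) by blast
  have "\<exists>z::'v set \<Rightarrow> 'k. top_cycle U d (link K {v}) z"
  proof (rule Suc.IH)
    show "scomplex (link K {v})" using sc vD by (rule scomplex_link)
    show "\<Union> (link K {v}) \<subseteq> U" using Suc.prems(2) by (auto simp: link_def)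
    show "\<forall>F\<in>link K {v}. card F \<le> d" using card_link_face[OF sc Suc.prems(3), of _ "{v}"] by simp
    show "doubly_cm TYPE('k) U d (link K {v})" using doubly_cm_link[OF sc vD Suc.prems(4)] by simp
  qed
  then obtain z' :: "'v set \<Rightarrow> 'k" where z': "top_cycle U d (link K {v}) z'" by blast
  have z's: "z' A \<noteq> 0 \<Longrightarrow> v \<notin> A \<and> A \<in> K \<and> insert v A \<in> K \<and> card A = d \<and> finite A" for A
    using z' finite_face[OF sc, of A] by (auto simp: top_cycle_def link_def)
  have zb: "\<forall>G. bd U z' G = 0" using z' by (simp add: top_cycle_def)
  have "exact_at TYPE('k) U (link (deletion K {v}) {}) d"
    using cmD(2)[of v] scomplex_empty[OF scomplex_deletion[OF sc, of "{v}"]] unfolding cm_def by fastforce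
  moreover have "chain (deletion K {v}) d z'" using z's by (auto simp: chain_def deletion_def)
  ultimately obtain w where w: "chain (deletion K {v}) (Suc d) w" "\<forall>G. bd U w G = z' G"
    using zb unfolding exact_at_def link_empty by blast
  define z where "z A = w A - cone v z' A" for A
  have "bd U z G = 0" for G
    unfolding z_def bd_diff using w(2) bd_cone[OF assms(1) vU _ zb] z's by simp
  moreover have "A \<in> K \<and> card A = Suc d" if "z A \<noteq> 0" for A
  proof (cases "w A = 0")
    case True
    then have A: "v \<in> A" "z' (A - {v}) \<noteq> 0" using that by (auto simp: z_def cone_def split: if_splits)
    then show ?thesis using z's[OF A(2)] by (metis card_Suc_Diff1 finite_Diff2 finite.emptyI finite.insertI insert_Diff)
  next
    case False
    then show ?thesis using w(1) by (auto simp: chain_def deletion_def)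
  qed
  moreover obtain B where B: "z' B \<noteq> 0" using z' by (auto simp: top_cycle_def)
  have "z (insert v B) \<noteq> 0"
  proof
    assume "z (insert v B) = 0"
    moreover have "w (insert v B) = 0" using w(1) by (auto simp: chain_def deletion_def)
    moreover have "insert v B - {v} = B" using z's[OF B] by auto
    ultimately have "sg v (insert v B) * z' B = 0" by (simp add: z_def cone_def)
    then show False using B by (metis mult_zero_right sg_square(2))
  qed
  ultimately show ?case unfolding top_cycle_def by blast
qed

theorem weight_doubly_cm:
  fixes K :: "'v::linorder set set"
  assumes "finite U" "infinite (UNIV :: 'k::field set)"
    and "scomplex K" "\<Union>K \<subseteq> U" "\<forall>F\<in>K. card F \<le> d" "nonfaces_le i K" "doubly_cm TYPE('k) U d K"
  shows "epoly 1 i d \<preceq> weight (1 - [:0, 1:]) d K"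
  using assms(3-)
proof (induction d arbitrary: K rule: less_induct)
  case (less d)
  let ?z = "1 - [:0, 1:] :: int poly"
  note sc = \<open>scomplex K\<close>
  have cmD: "cm TYPE('k) U d K" "cm TYPE('k) U d (deletion K {v})" for v
    using less.prems(5) by (auto simp: doubly_cm_def)
  show ?case
  proof (cases "d = 0")
    case True
    have "F = {}" if "F \<in> K" for F
      using less.prems(3) that True finite_face[OF sc] by auto
    then have "K = {{}}" using scomplex_empty[OF sc] by blast
    then show ?thesis using True by (simp add: epoly_small weight_def)
  next
    case False
    obtain F where F: "F \<in> K" "d \<le> card F" using cm_pure[OF sc cmD(1) scomplex_empty[OF sc]] by blast
    then obtain v0 where v0: "v0 \<in> F" using False by fastforce
    \<comment> \<open>A face with d vertices survives the deletion of a vertex of F; its union with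
      F is too large for K and so contains a minimal nonface.\<close>
    obtain F' where F': "F' \<in> deletion K {v0}" "d \<le> card F'"
      using cm_pure[OF _ cmD(2)] scomplex_deletion[OF sc] scomplex_empty by metis
    have F'D: "F' \<in> K" "v0 \<notin> F'" using F'(1) by (auto simp: deletion_def)
    have fin: "finite (F \<union> F')" using finite_face[OF sc] F(1) F'D(1) by simp
    have "F' \<subset> F \<union> F'" using v0 F'D(2) by blast
    from psubset_card_mono[OF fin this] have "F \<union> F' \<notin> K" using F'(2) less.prems(3) by force
    then obtain M where M: "M \<subseteq> F \<union> F'" "min_nonface K M" using min_nonface_ex[OF fin] by blast
    then have "M \<subseteq> \<Union>K" using F(1) F'D(1) by blast
    then obtain m where m: "card M = Suc m" "1 \<le> m" using min_nonface_card[OF sc M(2)] by blast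
    have fM: "finite M" using M(2) by (simp add: min_nonface_def)
    have face: "A \<in> K" if "A \<subset> M" for A using M(2) that by (simp add: min_nonface_def)
    have cM: "card (M - {v}) = m" if "v \<in> M" for v using that m fM by simp
    have mi: "m \<le> i" using M(2) m less.prems(4) by (force simp: nonfaces_le_def)
    obtain v1 where v1: "v1 \<in> M" using m(1) by fastforce
    then have "M - {v1} \<in> K" by (intro face) blast
    then have "card (M - {v1}) \<le> d" using less.prems(3) by blast
    then have md: "m \<le> d" using cM[OF v1] by simp
    let ?Q = "epoly 1 i (d - m)"
    have "bpoly 1 m * ?Q \<preceq> weight ?z d K"
    proof (rule weight_min_nonface[OF sc M(2) m(1)])
      fix A v assume A: "A \<subset> M" "v \<in> M - A"
      let ?\<Gamma> = "deletion (link K A) {v}" and ?B = "M - {v} - A" and ?L = "link K (M - {v})"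
      note split = min_nonface_link_split[OF sc M(2) m(1) A]
      have psub: "M - {v} \<subset> M" using A(2) by auto
      note sL = scomplex_link[OF sc face[OF psub]]
      note sA = scomplex_link[OF sc face[OF A(1)]]
      have cv: "card (M - {v}) = m" using cM A(2) by blast
      have Q: "?Q \<preceq> weight ?z (d - m) ?L"
      proof (rule less.IH)
        show "d - m < d" using m(2) False by simp
        show "\<Union>?L \<subseteq> U" using less.prems(2) by (auto simp: link_def)
        show "\<forall>F\<in>?L. card F \<le> d - m" using card_link_face[OF sc less.prems(3), of _ "M - {v}"] cv by metis
        show "nonfaces_le i ?L" using nonfaces_le_link[OF sc less.prems(4) face[OF psub]] .
        show "doubly_cm TYPE('k) U (d - m) ?L"
          using doubly_cm_link[OF sc face[OF psub] less.prems(5)] cv by metis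
      qed (rule sL)
      \<comment> \<open>The deletion of v in the link of A is Cohen-Macaulay because that link is
        again doubly Cohen-Macaulay. As y = 1, no power of y is left to account for.\<close>
      have "weight ?z (d - card A - card ?B) (link ?\<Gamma> ?B) \<preceq> weight ?z (d - card A) ?\<Gamma>"
      proof (rule weight_link_le[OF assms(1) _ _ _ _ split(2) assms(2)])
        show "scomplex ?\<Gamma>" using sA by (rule scomplex_deletion)
        show "\<Union>?\<Gamma> \<subseteq> U" using less.prems(2) by (auto simp: deletion_def link_def)
        show "cm TYPE('k) U (d - card A) ?\<Gamma>"
          using doubly_cm_link[OF sc face[OF A(1)] less.prems(5)] by (simp add: doubly_cm_def)
        show "\<forall>F\<in>?\<Gamma>. card F \<le> d - card A"
          using card_link_face[OF sc less.prems(3), of _ A] by (auto simp: deletion_def)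
      qed
      then have "weight ?z (d - m) ?L \<preceq> weight ?z (d - card A) ?\<Gamma>"
        using split(1) unfolding split(3) by (metis diff_diff_left)
      then show "1 ^ (m - card A) * ?Q \<preceq> weight ?z (d - card A) ?\<Gamma>"
        using coeff_le_trans[OF Q] by simp
    qed
    moreover have "epoly 1 i d \<preceq> bpoly 1 m * ?Q"
      using m mi md by (intro epoly_le) auto
    ultimately show ?thesis using coeff_le_trans by blast
  qed
qed

section \<open>Homology, f-numbers and h-numbers\<close>

lemma simplicial_boundary_eq_bd:
  assumes "finite U" "\<Union>\<Gamma> \<subseteq> U" "\<forall>A. c A \<noteq> 0 \<longrightarrow> A \<in> \<Gamma>"
  shows "simplicial_boundary \<Gamma> c G = bd U c G"
  unfolding simplicial_boundary_def bd_def sg_def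
proof (rule sum.mono_neutral_left)
  show "\<forall>v\<in>U - G - (\<Union>\<Gamma> - G). (- 1) ^ card {u \<in> G. u < v} * c (insert v G) = 0"
  proof
    fix v assume "v \<in> U - G - (\<Union>\<Gamma> - G)"
    then have "insert v G \<notin> \<Gamma>" by auto
    then have "c (insert v G) = 0" using assms(3) by auto
    then show "(- 1) ^ card {u \<in> G. u < v} * c (insert v G) = 0" by simp
  qed
qed (use assms in auto)

lemma simplicial_chains_eq: "simplicial_chains \<Gamma> (int a - 1) = {c. chain \<Gamma> a c}"
  by (auto simp: simplicial_chains_def chain_def face_dim_def)

lemma simplicial_cycles_eq:
  assumes "finite U" "\<Union>\<Gamma> \<subseteq> U"
  shows "simplicial_cycles \<Gamma> (int a - 1) = {c. chain \<Gamma> a c \<and> (\<forall>G. bd U c G = 0)}"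
proof -
  have "simplicial_boundary \<Gamma> c = (\<lambda>_. 0) \<longleftrightarrow> (\<forall>G. bd U c G = 0)" if "chain \<Gamma> a c" for c :: "'a set \<Rightarrow> 'b"
    using simplicial_boundary_eq_bd[OF assms, of c] that by (simp add: chain_def fun_eq_iff)
  then show ?thesis unfolding simplicial_cycles_def simplicial_chains_eq by auto
qed

lemma simplicial_boundary_zero: "simplicial_boundary \<Gamma> (\<lambda>_. 0) = (\<lambda>_. 0)"
  by (auto simp: simplicial_boundary_def)

lemma homology_vanishes_exact_at:
  assumes "finite U" "\<Union>\<Gamma> \<subseteq> U" "homology_vanishes k \<Gamma> (int a - 1)"
  shows "exact_at (k :: 'k::comm_ring_1 itself) U \<Gamma> a"
  unfolding exact_at_def
proof (intro allI impI)
  fix c :: "'a set \<Rightarrow> 'k"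
  assume c: "chain \<Gamma> a c" "\<forall>G. bd U c G = 0"
  let ?G = "cycle_group \<Gamma> (int a - 1) :: ('a set \<Rightarrow> 'k) monoid"
  let ?B = "simplicial_boundaries \<Gamma> (int a - 1) :: ('a set \<Rightarrow> 'k) set"
  have "c \<in> carrier ?G" using c by (simp add: cycle_group_def simplicial_cycles_eq[OF assms(1,2)])
  \<comment> \<open>The quotient has one element, so the coset of c is the set of boundaries; c lies
    in its own coset because 0 is a boundary.\<close>
  then have "?B #>\<^bsub>?G\<^esub> c \<in> carrier (?G Mod ?B)" by (auto simp: FactGroup_def RCOSETS_def)
  then have "?B #>\<^bsub>?G\<^esub> c = ?B"
    using assms(3) by (auto simp: homology_vanishes_def reduced_homology_def trivial_group_def FactGroup_def)
  moreover have "(\<lambda>_. 0) \<in> ?B"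
    unfolding simplicial_boundaries_def
    by (rule image_eqI[where x = "\<lambda>_. 0"]) (simp_all add: simplicial_boundary_zero simplicial_chains_def)
  then have "c \<in> ?B #>\<^bsub>?G\<^esub> c" by (force simp: r_coset_def cycle_group_def)
  ultimately have "c \<in> ?B" by simp
  then obtain e where e: "e \<in> simplicial_chains \<Gamma> (int (Suc a) - 1)" "c = simplicial_boundary \<Gamma> e"
    by (auto simp: simplicial_boundaries_def)
  then have e': "chain \<Gamma> (Suc a) e" by (simp only: simplicial_chains_eq mem_Collect_eq)
  then have "\<forall>G. bd U e G = c G"
    using simplicial_boundary_eq_bd[OF assms(1,2), of e] e(2) by (simp add: chain_def)
  with e' show "\<exists>e. chain \<Gamma> (Suc a) e \<and> (\<forall>G. bd U e G = c G)" by blast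
qed

text \<open>No face has d + 1 vertices, so 0 is the only boundary. If 0 were also the only cycle,
  the quotient would be a trivial group.\<close>

lemma top_homology_cycle:
  fixes K :: "'v::linorder set set"
  assumes "finite U" "\<Union>K \<subseteq> U" "\<forall>F\<in>K. card F \<le> d" "\<not> homology_vanishes TYPE('k::comm_ring_1) K (int d - 1)"
  shows "\<exists>z::'v set \<Rightarrow> 'k. top_cycle U d K z"
proof (rule ccontr)
  assume no: "\<not> ?thesis"
  let ?G = "cycle_group K (int d - 1) :: ('v set \<Rightarrow> 'k) monoid"
  let ?B = "simplicial_boundaries K (int d - 1) :: ('v set \<Rightarrow> 'k) set"
  have cyc: "carrier ?G = {\<lambda>_. 0}"
  proof -
    have "c = (\<lambda>_. 0)" if c: "chain K d c" "\<forall>G. bd U c G = 0" for c :: "'v set \<Rightarrow> 'k"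
    proof (rule ccontr)
      assume "c \<noteq> (\<lambda>_. 0)"
      then have "\<exists>F. c F \<noteq> 0" by auto
      then have "top_cycle U d K c" using c unfolding top_cycle_def chain_def by blast
      then show False using no by blast
    qed
    moreover have "chain K d (\<lambda>_. 0 :: 'k)" "bd U (\<lambda>_. 0 :: 'k) G = 0" for G
      by (simp_all add: chain_def bd_def)
    ultimately have "{c :: 'v set \<Rightarrow> 'k. chain K d c \<and> (\<forall>G. bd U c G = 0)} = {\<lambda>_. 0}" by blast
    then show ?thesis by (simp only: cycle_group_def simplicial_cycles_eq[OF assms(1,2)] partial_object.simps)
  qed
  have "c = (\<lambda>_. 0)" if "c \<in> simplicial_chains K (int d - 1 + 1)" for c :: "'v set \<Rightarrow> 'k"
  proof
    fix F
    have "face_dim F \<noteq> int d - 1 + 1 \<or> F \<notin> K" using assms(3) by (force simp: face_dim_def)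
    then show "c F = 0" using that by (auto simp: simplicial_chains_def)
  qed
  moreover have "(\<lambda>_. 0 :: 'k) \<in> simplicial_chains K (int d - 1 + 1)" by (simp add: simplicial_chains_def)
  ultimately have "simplicial_chains K (int d - 1 + 1) = {\<lambda>_. 0 :: 'k}" by blast
  then have B: "?B = {\<lambda>_. 0}" by (simp add: simplicial_boundaries_def simplicial_boundary_zero)
  have m: "(\<lambda>_. 0) \<otimes>\<^bsub>?G\<^esub> (\<lambda>_. 0) = (\<lambda>_. 0)" by (simp add: cycle_group_def)
  have car: "carrier (?G Mod ?B) = {{\<lambda>_. 0}}"
    by (auto simp: FactGroup_def RCOSETS_def r_coset_def B cyc m)
  have one: "\<one>\<^bsub>?G Mod ?B\<^esub> = {\<lambda>_. 0}" by (simp add: FactGroup_def B)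
  have mul: "{\<lambda>_. 0} \<otimes>\<^bsub>?G Mod ?B\<^esub> {\<lambda>_. 0} = {\<lambda>_. 0}"
    by (simp add: FactGroup_def set_mult_def m)
  have "group (?G Mod ?B)"
    by (rule groupI) (auto simp only: car one mul singleton_iff bex_simps)
  then have "trivial_group (?G Mod ?B)" by (simp only: trivial_group_def car one simp_thms)
  then show False using assms(4) by (simp add: homology_vanishes_def reduced_homology_def)
qed

lemma cohen_macaulay_cm:
  assumes "finite U" "\<Union>K \<subseteq> U" "cohen_macaulay k K" "complex_dim K = int d - 1"
  shows "cm k U d K"
  unfolding cm_def
proof (intro ballI allI impI)
  fix F a assume F: "F \<in> K" "a + card F < d"
  show "exact_at k U (link K F) a"
  proof (rule homology_vanishes_exact_at[OF assms(1)])
    show "\<Union>(link K F) \<subseteq> U" using assms(2) by (auto simp: link_def)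
    have "int a - 1 < complex_dim K - int (card F)" using F(2) assms(4) by simp
    then show "homology_vanishes k (link K F) (int a - 1)"
      using assms(3) F(1) unfolding cohen_macaulay_def by blast
  qed
qed

lemma deletion_nonvertex: "\<Union>K \<inter> W = {} \<Longrightarrow> deletion K W = K"
  by (auto simp: deletion_def)

lemma multi_cohen_macaulay_doubly_cm:
  assumes "\<Union>K \<subseteq> {1..n}" "multi_cohen_macaulay k 2 n K" "complex_dim K = int d - 1"
  shows "doubly_cm k {1..n} d K"
proof -
  have "cm k {1..n} d (deletion K W)" if "W \<subseteq> {1..n}" "card W \<le> 1" for W
  proof (rule cohen_macaulay_cm)
    show "\<Union>(deletion K W) \<subseteq> {1..n}" using assms(1) by (auto simp: deletion_def)
    have *: "int (card W) \<le> int 2 - 1" using that by simp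
    show "cohen_macaulay k (deletion K W)" "complex_dim (deletion K W) = int d - 1"
      using assms(2,3) that(1) * unfolding multi_cohen_macaulay_def by auto
  qed simp
  moreover have "deletion K {} = K" by (rule deletion_nonvertex) simp
  moreover have "deletion K {v} = K" if "v \<notin> {1..n}" for v
    using that assms(1) by (intro deletion_nonvertex) blast
  moreover have "{v} \<subseteq> {1..n} \<and> card {v} \<le> 1" if "v \<in> {1..n}" for v using that by auto
  ultimately show ?thesis unfolding doubly_cm_def by (metis card.empty empty_subsetI zero_le_one)
qed

section \<open>Face numbers and h-numbers as coefficients of enumerators\<close>

lemma f_num_eq: "f_num K (int k - 1) = card {F \<in> K. card F = k}"
  unfolding f_num_def face_dim_def by (rule arg_cong[of _ _ card]) auto

lemma f_num_negative: "j < - 1 \<Longrightarrow> f_num K j = 0"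
  by (auto simp: f_num_def face_dim_def)

lemma weight_alt:
  assumes "finite K" "\<forall>F\<in>K. card F \<le> d"
  shows "weight z d K = (\<Sum>k=0..d. of_nat (f_num K (int k - 1)) * ([:0, 1:] ^ k * z ^ (d - k)))"
  unfolding weight_def f_num_eq
  by (rule sum_fun_comp) (use assms in auto)

text \<open>The embedding of integer polynomials into rational power series, where the quotient x /
  (1 - x) in the definition of \<open>h_series\<close> makes sense.\<close>

definition rat_fps :: "int poly \<Rightarrow> rat fps" where
  "rat_fps p = Abs_fps (\<lambda>k. of_int (coeff p k))"

lemma rat_fps_hom:
  "rat_fps (p + q) = rat_fps p + rat_fps q" "rat_fps (p * q) = rat_fps p * rat_fps q"
  "rat_fps 1 = 1" "rat_fps 0 = 0" "rat_fps [:0, 1:] = fps_X" "rat_fps (p - q) = rat_fps p - rat_fps q"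
proof -
  show "rat_fps (p * q) = rat_fps p * rat_fps q"
    by (rule fps_ext) (simp add: rat_fps_def fps_mult_nth coeff_mult atLeast0AtMost)
qed (auto simp: rat_fps_def fps_eq_iff coeff_pCons split: nat.split)

lemma rat_fps_sum: "rat_fps (sum f A) = (\<Sum>x\<in>A. rat_fps (f x))"
  by (induction A rule: infinite_finite_induct) (auto simp: rat_fps_hom)

lemma rat_fps_power: "rat_fps (p ^ n) = rat_fps p ^ n"
  by (induction n) (auto simp: rat_fps_hom)

lemma rat_fps_of_nat: "rat_fps (of_nat n) = of_nat n"
  by (induction n) (auto simp: rat_fps_hom)

lemma h_num_eq:
  assumes "finite K" "\<forall>F\<in>K. card F \<le> d" "complex_dim K = int d - 1"
  shows "h_num K j = of_int (coeff (weight (1 - [:0, 1:]) d K) j)"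
proof -
  let ?Y = "1 - fps_X :: rat fps"
  have inv: "?Y * inverse ?Y = 1" by (rule inverse_mult_eq_1') simp
  have e: "?Y ^ d * (fps_X / ?Y) ^ k = fps_X ^ k * ?Y ^ (d - k)" if "k \<le> d" for k
  proof -
    have 1: "?Y ^ d = ?Y ^ (d - k) * ?Y ^ k" using that by (simp flip: power_add)
    have 2: "(fps_X / ?Y) ^ k = fps_X ^ k * inverse ?Y ^ k"
      by (simp add: fps_divide_unit power_mult_distrib)
    have 3: "?Y ^ k * inverse ?Y ^ k = 1" using inv by (simp flip: power_mult_distrib)
    have "?Y ^ d * (fps_X / ?Y) ^ k = fps_X ^ k * ?Y ^ (d - k) * (?Y ^ k * inverse ?Y ^ k)"
      unfolding 1 2 by (simp only: ac_simps)
    then show ?thesis by (simp only: 3 mult_1_right)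
  qed
  have "nat (complex_dim K + 1) = d" using assms(3) by simp
  then have "h_series K = (\<Sum>k=0..d. of_nat (f_num K (int k - 1)) * (?Y ^ d * (fps_X / ?Y) ^ k))"
    by (simp add: h_series_def f_eval_def sum_distrib_left mult.left_commute)
  also have "\<dots> = (\<Sum>k=0..d. of_nat (f_num K (int k - 1)) * (fps_X ^ k * ?Y ^ (d - k)))"
    by (rule sum.cong) (auto simp: e)
  also have "\<dots> = rat_fps (weight (1 - [:0, 1:]) d K)"
    unfolding weight_alt[OF assms(1,2)]
    by (simp only: rat_fps_sum rat_fps_hom rat_fps_power rat_fps_of_nat)
  finally show ?thesis by (simp add: h_num_def rat_fps_def)
qed

text \<open>The passage from face numbers to h-numbers is unitriangular: faces with exactly j
  vertices enter with coefficient 1.\<close>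

lemma coeff_weight_h:
  assumes "finite K"
  shows "coeff (weight (1 - [:0, 1:]) d K) j =
    coeff (weight 1 d K) j + (\<Sum>k<j. coeff (weight 1 d K) k * coeff ((1 - [:0, 1:]) ^ (d - k)) (j - k))"
proof -
  let ?z = "1 - [:0, 1:] :: int poly"
  let ?g = "\<lambda>k. coeff (?z ^ (d - k)) (j - k)"
  have "coeff (weight ?z d K) j = (\<Sum>F\<in>K. if card F \<le> j then ?g (card F) else 0)"
    unfolding weight_def X_power coeff_sum coeff_monom_mult by (intro sum.cong) auto
  also have "\<dots> = (\<Sum>F\<in>{F \<in> K. card F \<le> j}. ?g (card F))"
    using assms by (simp add: sum.inter_filter)
  also have "\<dots> = (\<Sum>k\<le>j. of_nat (card {F \<in> {F \<in> K. card F \<le> j}. card F = k}) * ?g k)"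
    by (rule sum_fun_comp) (use assms in auto)
  also have "\<dots> = (\<Sum>k\<le>j. coeff (weight 1 d K) k * ?g k)"
  proof (rule sum.cong[OF refl])
    fix k assume "k \<in> {..j}"
    then have "{F \<in> {F \<in> K. card F \<le> j}. card F = k} = {F \<in> K. card F = k}" by auto
    then show "of_nat (card {F \<in> {F \<in> K. card F \<le> j}. card F = k}) * ?g k = coeff (weight 1 d K) k * ?g k"
      by (simp add: coeff_weight_1[OF assms])
  qed
  also have "\<dots> = coeff (weight 1 d K) j * ?g j + (\<Sum>k<j. coeff (weight 1 d K) k * ?g k)"
    unfolding lessThan_Suc_atMost[symmetric] by simp
  also have "?g j = 1" by (simp add: coeff_0_power)
  finally show ?thesis by simp
qed

lemma coeff_weight_1_from_h:
  assumes "finite K" "finite \<Gamma>" "\<And>k. k < j \<Longrightarrow> coeff (weight 1 d K) k = coeff (weight 1 d \<Gamma>) k"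
    and "coeff (weight (1 - [:0, 1:]) d K) j = coeff (weight (1 - [:0, 1:]) d \<Gamma>) j"
  shows "coeff (weight 1 d K) j = coeff (weight 1 d \<Gamma>) j"
  using assms(4) unfolding coeff_weight_h[OF assms(1)] coeff_weight_h[OF assms(2)]
  by (simp add: assms(3))

lemma complex_dim_extremal_sphere:
  assumes "1 \<le> r" "r \<le> i"
  shows "complex_dim (extremal_sphere i q r) = int (q * i + r) - 1"
proof -
  let ?S = "extremal_sphere i q r"
  \<comment> \<open>A facet: one vertex is removed from each of the q + 1 blocks.\<close>
  define X where "X = (\<Union>a<Suc q. std_blocks i r q a) - (\<lambda>a. (a, 0)) ` {..q}"
  note b = blocks_std_blocks[of i r q]
  have S: "scomplex ?S" "\<forall>F\<in>?S. card F \<le> q * i + r"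
    unfolding extremal_sphere_eq
    using scomplex_block_complex[OF b assms] card_block_complex_face[OF b assms] by auto
  have "(\<lambda>a. (a, 0)) ` {..q} \<subseteq> (\<Union>a<Suc q. std_blocks i r q a)"
    by (auto simp: std_blocks_def)
  then have "card X = q * Suc i + Suc r - card ((\<lambda>a. (a, 0::nat)) ` {..q})"
    unfolding X_def card_Union_block_complex[OF b assms, symmetric] by (intro card_Diff_subset) auto
  also have "card ((\<lambda>a. (a, 0::nat)) ` {..q}) = Suc q" by (simp add: card_image inj_on_def)
  finally have cX: "card X = q * i + r" by simp
  have "\<not> std_blocks i r q a \<subseteq> X" if "a < Suc q" for a
  proof -
    have "(a, 0) \<in> std_blocks i r q a" "(a, 0) \<notin> X" using that by (auto simp: std_blocks_def X_def)
    then show ?thesis by blast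
  qed
  then have "X \<in> ?S" unfolding extremal_sphere_eq block_complex_def by (auto simp: X_def)
  show ?thesis
    unfolding complex_dim_def
  proof (rule Max_eqI)
    show "finite (face_dim ` ?S)" using scomplex_finite[OF S(1)] by simp
    show "int (q * i + r) - 1 \<in> face_dim ` ?S"
      using \<open>X \<in> ?S\<close> cX by (intro image_eqI[of _ _ X]) (simp_all add: face_dim_def)
    fix y assume "y \<in> face_dim ` ?S"
    then obtain F where F: "F \<in> ?S" "y = face_dim F" by blast
    then have "int (card F) \<le> int (q * i + r)" using S(2) by (simp only: of_nat_le_iff)
    then show "y \<le> int (q * i + r) - 1" unfolding F(2) face_dim_def by (rule diff_right_mono)
  qed
qed

lemma scomplex_extremal_sphere: "1 \<le> r \<Longrightarrow> r \<le> i \<Longrightarrow> scomplex (extremal_sphere i q r)"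
  unfolding extremal_sphere_eq by (rule scomplex_block_complex[OF blocks_std_blocks])

lemma weight_extremal_sphere:
  "1 \<le> r \<Longrightarrow> r \<le> i \<Longrightarrow> z \<noteq> 0 \<Longrightarrow> weight z (q * i + r) (extremal_sphere i q r) = epoly ([:0, 1:] + z) i (q * i + r)"
  unfolding extremal_sphere_eq by (rule weight_block_complex[OF blocks_std_blocks])

lemma coeff_weight_1_0: "scomplex K \<Longrightarrow> coeff (weight 1 d K) 0 = 1"
proof -
  assume sc: "scomplex K"
  then have "{F \<in> K. card F = 0} = {{}}"
    using finite_face[OF sc] scomplex_empty[OF sc] by auto
  then show ?thesis by (simp add: coeff_weight_1[OF scomplex_finite[OF sc]])
qed

lemma cyclic_complex_iso_extremal_sphere:
  fixes z :: "'v::linorder set \<Rightarrow> 'k::comm_ring_1"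
  assumes "cyclic_complex U i d K z" "d = q * i + r" "1 \<le> r" "r \<le> i"
    and f0: "coeff (weight 1 d K) 1 = coeff (epoly ([:0, 1:] + 1) i d) 1"
    and fr: "r < i \<Longrightarrow> coeff (weight 1 d K) (Suc r) = coeff (epoly ([:0, 1:] + 1) i d) (Suc r)"
  shows "complex_iso K (extremal_sphere i q r)"
proof -
  have sc: "scomplex K" using cyclic_complexD(2)[OF assms(1)] .
  have "int (card (\<Union>K)) = int (q * Suc i + Suc r)"
    using f0 unfolding assms(2) coeff_epoly_1[OF assms(3,4)] coeff_weight_1[OF scomplex_finite[OF sc]] card_vertices[OF sc] .
  then have "card (\<Union>K) = q * Suc i + Suc r" by (simp only: of_nat_eq_iff)
  then obtain N where N: "blocks i r q N" "K = block_complex N (Suc q)"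
    using cyclic_complex_extremal[OF assms(1-4) _ fr] by blast
  show ?thesis
    unfolding N(2) extremal_sphere_eq by (rule blocks_iso[OF N(1) blocks_std_blocks assms(3,4)])
qed

theorem theorem3p1:
  fixes i d q r n :: nat and \<Delta> :: "nat set set"
  assumes "i > 0" and "d > 0"
    and "d = q * i + r" and "1 \<le> r" and "r \<le> i"
    and "field_or_integers TYPE('k::comm_ring_1)"
    and "simplicial_complex n \<Delta>"
    and "complex_dim \<Delta> = int d - 1"
    and "\<forall>F. missing_face n \<Delta> F \<longrightarrow> face_dim F \<le> int i"
  shows
    "(\<not> homology_vanishes TYPE('k) \<Delta> (int d - 1) \<longrightarrow>
        (\<forall>j::int. f_num \<Delta> j \<ge> f_num (extremal_sphere i q r) j) \<and>
        (f_num \<Delta> 0 = f_num (extremal_sphere i q r) 0 \<and>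
         (\<not> i dvd d \<longrightarrow> f_num \<Delta> (int r) = f_num (extremal_sphere i q r) (int r)) \<longrightarrow>
         complex_iso \<Delta> (extremal_sphere i q r)))
     \<and>
     (multi_cohen_macaulay TYPE('k) 2 n \<Delta> \<longrightarrow>
        (\<forall>j::nat. h_num \<Delta> j \<ge> h_num (extremal_sphere i q r) j) \<and>
        (h_num \<Delta> 1 = h_num (extremal_sphere i q r) 1 \<and>
         (\<not> i dvd d \<longrightarrow> h_num \<Delta> (r + 1) = h_num (extremal_sphere i q r) (r + 1)) \<longrightarrow>
         complex_iso \<Delta> (extremal_sphere i q r)))"
proof -
  let ?U = "{1..n}" and ?S = "extremal_sphere i q r"
  let ?P = "epoly ([:0, 1:] + 1) i d" and ?z = "1 - [:0, 1:] :: int poly"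
  note r = assms(4,5)
  have D: "\<Delta> \<subseteq> Pow ?U" "{} \<in> \<Delta>" "\<forall>F\<in>\<Delta>. \<forall>G. G \<subseteq> F \<longrightarrow> G \<in> \<Delta>" "\<forall>v\<in>?U. {v} \<in> \<Delta>"
    using assms(7) by (auto simp: simplicial_complex_def)
  have fin: "finite \<Delta>" using finite_subset[OF D(1)] by simp
  have "finite F" if "F \<in> \<Delta>" for F using finite_subset[of F ?U] D(1) that by auto
  then have sc: "scomplex \<Delta>" unfolding scomplex_def using fin D(2,3) by simp
  have U: "\<Union>\<Delta> \<subseteq> ?U" using D(1) by blast
  have dim: "\<forall>F\<in>\<Delta>. card F \<le> d"
  proof
    fix F assume "F \<in> \<Delta>"
    then have "face_dim F \<le> complex_dim \<Delta>" using fin by (simp add: complex_dim_def)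
    then show "card F \<le> d" using assms(8) by (simp add: face_dim_def)
  qed
  have nf: "nonfaces_le i \<Delta>"
    unfolding nonfaces_le_def
  proof (intro allI impI)
    fix M assume M: "min_nonface \<Delta> M"
    show "card M \<le> Suc i"
    proof (cases "M \<subseteq> ?U")
      case True
      then have "missing_face n \<Delta> M" using M by (auto simp: missing_face_def min_nonface_def)
      then show ?thesis using assms(9) by (force simp: face_dim_def)
    next
      \<comment> \<open>Minimal nonfaces that leave the ground set are single points.\<close>
      case False
      then obtain v where v: "v \<in> M" "v \<notin> ?U" by blast
      then have "{v} \<notin> \<Delta>" using U by auto
      then have "\<not> {v} \<subset> M" using M by (auto simp: min_nonface_def)
      then have "M = {v}" using v(1) by blast
      then show ?thesis by simp
    qed
  qed
  have S: "scomplex ?S" "finite ?S" using scomplex_extremal_sphere[OF r] scomplex_finite by auto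
  have dimS: "\<forall>F\<in>?S. card F \<le> d"
    unfolding extremal_sphere_eq assms(3) by (rule card_block_complex_face[OF blocks_std_blocks r])
  have wS: "weight 1 d ?S = ?P" using weight_extremal_sphere[OF r, of 1 q] assms(3) by simp
  have f: "int (f_num \<Delta> (int k - 1)) = coeff (weight 1 d \<Delta>) k" "int (f_num ?S (int k - 1)) = coeff ?P k" for k
    unfolding f_num_eq wS[symmetric] by (simp_all add: coeff_weight_1 fin S(2))
  \<comment> \<open>As 1 \<le> r \<le> i, the extra equality is assumed exactly when r < i.\<close>
  have dvd: "i dvd d \<longleftrightarrow> r = i"
  proof -
    have "i dvd d \<longleftrightarrow> i dvd r" unfolding assms(3) by (simp add: dvd_add_right_iff)
    then show ?thesis using r assms(1) dvd_imp_le[of i r] by auto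
  qed
  have cyc: "cyclic_complex ?U i d \<Delta> z" if "top_cycle ?U d \<Delta> z" for z :: "nat set \<Rightarrow> 'k"
    using that sc U dim nf by (simp add: cyclic_complex_def)
  have part1: "(\<forall>j::int. f_num \<Delta> j \<ge> f_num ?S j) \<and>
      (f_num \<Delta> 0 = f_num ?S 0 \<and> (\<not> i dvd d \<longrightarrow> f_num \<Delta> (int r) = f_num ?S (int r)) \<longrightarrow> complex_iso \<Delta> ?S)"
    if nonzero: "\<not> homology_vanishes TYPE('k) \<Delta> (int d - 1)"
  proof -
    obtain z :: "nat set \<Rightarrow> 'k" where z: "cyclic_complex ?U i d \<Delta> z"
      using top_homology_cycle[OF _ U dim nonzero] cyc by auto
    have "f_num \<Delta> j \<ge> f_num ?S j" for j
    proof (cases "j < - 1")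
      case False
      then have "j = int (nat (j + 1)) - 1" by simp
      moreover have "int (f_num ?S (int k - 1)) \<le> int (f_num \<Delta> (int k - 1))" for k
        unfolding f using weight_1_cyclic_complex[OF z] by (simp add: coeff_le_def)
      ultimately show ?thesis by (metis of_nat_le_iff)
    qed (simp add: f_num_negative)
    moreover have "complex_iso \<Delta> ?S"
      if h: "f_num \<Delta> 0 = f_num ?S 0" "\<not> i dvd d \<longrightarrow> f_num \<Delta> (int r) = f_num ?S (int r)"
    proof (rule cyclic_complex_iso_extremal_sphere[OF z assms(3) r])
      show "coeff (weight 1 d \<Delta>) 1 = coeff ?P 1" using f[of 1] h(1) by simp
      show "coeff (weight 1 d \<Delta>) (Suc r) = coeff ?P (Suc r)" if "r < i"
        using f[of "Suc r"] h(2) that by (simp add: dvd)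
    qed
    ultimately show ?thesis by blast
  qed
  have h: "h_num \<Delta> j = of_int (coeff (weight ?z d \<Delta>) j)" "h_num ?S j = of_int (coeff (weight ?z d ?S) j)" for j
    using h_num_eq[OF fin dim assms(8)] h_num_eq[OF S(2) dimS] complex_dim_extremal_sphere[OF r, of q] assms(3)
    by simp_all
  have part2: "(\<forall>j::nat. h_num \<Delta> j \<ge> h_num ?S j) \<and>
      (h_num \<Delta> 1 = h_num ?S 1 \<and> (\<not> i dvd d \<longrightarrow> h_num \<Delta> (r + 1) = h_num ?S (r + 1)) \<longrightarrow> complex_iso \<Delta> ?S)"
    if "multi_cohen_macaulay TYPE('k) 2 n \<Delta>"
  proof -
    have dcm: "doubly_cm TYPE('k) ?U d \<Delta>"
      using multi_cohen_macaulay_doubly_cm[OF U that assms(8)] .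
    then have dcm': "doubly_cm TYPE('k coeff_domain poly fract) ?U d \<Delta>"
      using cm_extend[OF assms(6)] fin finite_subset[of "deletion \<Delta> _" \<Delta>]
      by (auto simp: doubly_cm_def deletion_def)
    have zS: "weight ?z d ?S = epoly 1 i d"
      using weight_extremal_sphere[OF r, of ?z q] assms(3) by (simp add: one_pCons)
    have "epoly 1 i d \<preceq> weight ?z d \<Delta>"
      by (rule weight_doubly_cm[OF _ infinite_poly_fract sc U dim nf dcm']) simp
    then have "h_num \<Delta> j \<ge> h_num ?S j" for j unfolding h zS by (simp add: coeff_le_def)
    moreover have "complex_iso \<Delta> ?S"
      if eq: "h_num \<Delta> 1 = h_num ?S 1" "\<not> i dvd d \<longrightarrow> h_num \<Delta> (r + 1) = h_num ?S (r + 1)"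
    proof -
      \<comment> \<open>Equality is settled by face numbers over the original ring, so a top cycle
        with coefficients in k is produced.\<close>
      obtain z :: "nat set \<Rightarrow> 'k" where z: "cyclic_complex ?U i d \<Delta> z"
        using doubly_cm_top_cycle[OF _ sc U dim dcm] cyc by auto
      have f1: "coeff (weight 1 d \<Delta>) 1 = coeff (weight 1 d ?S) 1"
        by (rule coeff_weight_1_from_h[OF fin S(2)])
          (use eq(1) in \<open>simp_all add: h coeff_weight_1_0 sc S(1)\<close>)
      show ?thesis
      proof (rule cyclic_complex_iso_extremal_sphere[OF z assms(3) r])
        show "coeff (weight 1 d \<Delta>) 1 = coeff ?P 1" using f1 unfolding wS .
        have "int (card (\<Union>\<Delta>)) = int (q * Suc i + Suc r)"
          using f1[unfolded wS] unfolding assms(3) coeff_epoly_1[OF r] coeff_weight_1[OF fin] card_vertices[OF sc] .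
        then have V: "card (\<Union>\<Delta>) = q * Suc i + Suc r" by (simp only: of_nat_eq_iff)
        \<comment> \<open>The sphere contains all sets of at most r of its vertices, and the complex
          has equally many vertices, so its face numbers up to that size cannot be larger; the lower
          bound makes them equal. Then h_(r+1) determines f_r.\<close>
        have low: "coeff (weight 1 d \<Delta>) k = coeff (weight 1 d ?S) k" if "k < Suc r" for k
        proof (rule antisym)
          have "card {F \<in> \<Delta>. card F = k} \<le> card {F. F \<subseteq> \<Union>\<Delta> \<and> card F = k}"
            using finite_Union_scomplex[OF sc] by (intro card_mono) auto
          also have "\<dots> = (q * Suc i + Suc r) choose k"
            unfolding n_subsets[OF finite_Union_scomplex[OF sc]] V ..
          finally have "coeff (weight 1 d \<Delta>) k \<le> int ((q * Suc i + Suc r) choose k)"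
            unfolding coeff_weight_1[OF fin] by (simp only: of_nat_le_iff)
          also have "\<dots> = coeff (weight 1 d ?S) k"
            unfolding wS unfolding assms(3) using coeff_epoly_choose(1)[OF r] that by simp
          finally show "coeff (weight 1 d \<Delta>) k \<le> coeff (weight 1 d ?S) k" .
          show "coeff (weight 1 d ?S) k \<le> coeff (weight 1 d \<Delta>) k"
            unfolding wS using weight_1_cyclic_complex[OF z] by (simp add: coeff_le_def)
        qed
        show "coeff (weight 1 d \<Delta>) (Suc r) = coeff ?P (Suc r)" if "r < i"
          unfolding wS[symmetric]
          by (rule coeff_weight_1_from_h[OF fin S(2) low]) (use eq(2) that in \<open>simp_all add: h dvd\<close>)
      qed
    qed
    ultimately show ?thesis by blast
  qed
  show ?thesis using part1 part2 by blast
qed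

end
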